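(* Let $V$ be a five-dimensional complex vector space. Let $\mathcal{U}\subset S^3V$ be the set of smooth cubic forms $F\in S^3V$ such that $(J_{F,3})^\perp\subset S^3V^*$ contains a smooth cubic form. Then $\mathcal{U}$ is a nonempty Zariski open subset of $S^3V$. Moreover, for every $F\in\mathcal{U}$ there exists $Q\in S^2V$ such that the surface $Y=\{F=Q=0\}\subset\mathbb{P}V^*$ is smooth and the cubic form $C\in S^3V^*$ associated with $(F,Q)$ is smooth.
   Context: $S^\bullet V=\mathrm{Sym}^\bullet V$ is the homogeneous coordinate ring of $\mathbb{P}V^*\cong\mathbb{P}^4$; choosing a basis, it is $\mathbb{C}[x_0,\dots,x_4]$, and $S^\bullet V^*$ is $\mathbb{C}[y_0,\dots,y_4]$ in the dual basis, the homogeneous coordinate ring of $\mathbb{P}V\cong\mathbb{P}^4$. A form $F\in S^3V$ (resp. $G\in S^3V^*$) is called smooth if it is nonzero and the hypersurface $\{F=0\}\subset\mathbb{P}V^*$ (resp. $\{G=0\}\subset\mathbb{P}V$) is smooth. That is, its first partial derivatives have no common zero in projective space; in particular the zero form is not smooth. For $F\in S^3V$, $J_F\subset S^\bullet V$ is the ideal generated by the first partial derivatives of $F$, and $J_{F,k}=J_F\cap S^kV$. The duality pairing $\langle\ ,\ \rangle:S^3V\times S^3V^*\to\mathbb{C}$ is the polar pairing $(F,G)\mapsto G\left(\frac{\partial}{\partial x_0},\dots,\frac{\partial}{\partial x_4}\right)F$. For $E\subset S^3V$, $E^\perp=\{a\in S^3V^*:\langle b,a\rangle=0\ \ \forall b\in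 E\}$. For $F\in S^3V$ smooth and $Q\in S^2V$, set $(J_{F,5}:Q)=\{b\in S^3V: bQ\in J_{F,5}\}$. Since $F$ is smooth, $\dim S^5V/J_{F,5}=1$, so $(J_{F,5}:Q)^\perp$ has dimension at most one. The cubic form $C\in S^3V^*$ associated with $(F,Q)$ is characterized, up to a nonzero scalar, by $\mathbb{C}C=(J_{F,5}:Q)^\perp$. The surface $Y=\{F=Q=0\}$ is smooth if it is a smooth complete intersection of dimension $2$, i.e. the gradients of $F$ and $Q$ are linearly independent at every common zero of $F$ and $Q$ in $\mathbb{P}V^*$. *)

theory Defs
  imports Complex_Main "HOL-Library.Poly_Mapping" "HOL-Library.Numeral_Type"
begin

text \<open>
  Multivariate polynomials over the complex numbers are finitely supported functions from
  monomials to coefficients, a monomial being a finitely supported exponent vector.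
  A basis of the five-dimensional space \<open>V\<close> is fixed, so that \<open>Sym V\<close> is
  \<open>\<complex>[x\<^sub>0,\<dots>,x\<^sub>4]\<close>, and \<open>Sym V\<^sup>*\<close> is \<open>\<complex>[y\<^sub>0,\<dots>,y\<^sub>4]\<close> in the dual basis; both are
  represented by the type \<open>poly5\<close>.  The variables are indexed by the
  type \<open>5\<close>, whose elements are \<open>0,1,2,3,4\<close>.
\<close>

type_synonym 'v cpoly = "('v \<Rightarrow>\<^sub>0 nat) \<Rightarrow>\<^sub>0 complex"
type_synonym poly5 = "5 cpoly"

definition mdeg :: "('v \<Rightarrow>\<^sub>0 nat) \<Rightarrow> nat" where
  "mdeg m = (\<Sum>v\<in>Poly_Mapping.keys m. Poly_Mapping.lookup m v)"

definition forms :: "nat \<Rightarrow> poly5 set" where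
  "forms k = {F. \<forall>m\<in>Poly_Mapping.keys F. mdeg m = k}"

definition peval :: "'v cpoly \<Rightarrow> ('v \<Rightarrow> complex) \<Rightarrow> complex" where
  "peval P a = (\<Sum>m\<in>Poly_Mapping.keys P. Poly_Mapping.lookup P m *
      (\<Prod>v\<in>Poly_Mapping.keys m. a v ^ Poly_Mapping.lookup m v))"

text \<open>
  Subtraction of exponents truncates at 0, but the coefficient
  vanishes in that case.
\<close>
definition pd :: "5 \<Rightarrow> poly5 \<Rightarrow> poly5" where
  "pd i P = (\<Sum>m\<in>Poly_Mapping.keys P.
      Poly_Mapping.single (m - Poly_Mapping.single i 1)
        (of_nat (Poly_Mapping.lookup m i) * Poly_Mapping.lookup P m))"

definition const5 :: "complex \<Rightarrow> poly5" where
  "const5 c = Poly_Mapping.single 0 c"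

text \<open>Points of projective space are represented by nonzero vectors.\<close>
definition smooth_form :: "poly5 \<Rightarrow> bool" where
  "smooth_form F \<longleftrightarrow> F \<noteq> 0 \<and> \<not> (\<exists>a. a \<noteq> (\<lambda>_. 0) \<and> (\<forall>i. peval (pd i F) a = 0))"

text \<open>The span of a subset of a commutative ring, as a module over itself, is the ideal
  it generates.\<close>
definition jacobian_ideal :: "poly5 \<Rightarrow> poly5 set" where
  "jacobian_ideal F = module.span (*) (range (\<lambda>i. pd i F))"

definition jacobian_part :: "poly5 \<Rightarrow> nat \<Rightarrow> poly5 set" where
  "jacobian_part F k = jacobian_ideal F \<inter> forms k"

text \<open>The operator obtained by substituting \<open>\<partial>/\<partial>x\<^sub>i\<close> for \<open>y\<^sub>i\<close> in \<open>G\<close>.\<close>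
definition diff_op :: "poly5 \<Rightarrow> poly5 \<Rightarrow> poly5" where
  "diff_op G F = (\<Sum>m\<in>Poly_Mapping.keys G. const5 (Poly_Mapping.lookup G m) *
      foldr (\<lambda>i. pd i ^^ Poly_Mapping.lookup m i) [0, 1, 2, 3, 4] F)"

text \<open>For cubic forms \<open>F\<close> and \<open>G\<close> the polynomial \<open>diff_op G F\<close> is constant; the pairing is
  its value.\<close>
definition polar_pairing :: "poly5 \<Rightarrow> poly5 \<Rightarrow> complex" where
  "polar_pairing F G = Poly_Mapping.lookup (diff_op G F) 0"

definition perp :: "poly5 set \<Rightarrow> poly5 set" where
  "perp E = {a \<in> forms 3. \<forall>b\<in>E. polar_pairing b a = 0}"

definition colon :: "poly5 \<Rightarrow> poly5 \<Rightarrow> poly5 set" where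
  "colon F Q = {b \<in> forms 3. b * Q \<in> jacobian_part F 5}"

definition associated_cubic :: "poly5 \<Rightarrow> poly5 \<Rightarrow> poly5 \<Rightarrow> bool" where
  "associated_cubic F Q C \<longleftrightarrow> C \<in> forms 3 \<and> range (\<lambda>c. const5 c * C) = perp (colon F Q)"

definition smooth_surface :: "poly5 \<Rightarrow> poly5 \<Rightarrow> bool" where
  "smooth_surface F Q \<longleftrightarrow>
    (\<forall>a. a \<noteq> (\<lambda>_. 0) \<and> peval F a = 0 \<and> peval Q a = 0 \<longrightarrow>
      (\<forall>s t. (\<forall>i. s * peval (pd i F) a + t * peval (pd i Q) a = 0) \<longrightarrow> s = 0 \<and> t = 0))"

text \<open>
  Zariski closed subsets of the affine space of forms of degree \<open>k\<close>, with the coefficients as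
  coordinates: the equations are polynomials in variables indexed by the monomials in
  \<open>x\<^sub>0,\<dots>,x\<^sub>4\<close>. Variables indexed by monomials of degree other than \<open>k\<close> take
  the value 0 on all forms of degree \<open>k\<close> and so add no closed sets.
\<close>
definition zariski_closed_forms :: "nat \<Rightarrow> poly5 set \<Rightarrow> bool" where
  "zariski_closed_forms k Z \<longleftrightarrow>
    (\<exists>Ps :: (5 \<Rightarrow>\<^sub>0 nat) cpoly set.
      Z = {F \<in> forms k. \<forall>P\<in>Ps. peval P (Poly_Mapping.lookup F) = 0})"

definition zariski_open_forms :: "nat \<Rightarrow> poly5 set \<Rightarrow> bool" where
  "zariski_open_forms k U \<longleftrightarrow> U \<subseteq> forms k \<and> zariski_closed_forms k (forms k - U)"

definition cubic_locus :: "poly5 set" where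
  "cubic_locus = {F \<in> forms 3. smooth_form F \<and> (\<exists>G \<in> perp (jacobian_part F 3). smooth_form G)}"

end

theory Submission
  imports Defs "HOL-Analysis.Analysis" "HOL-Computational_Algebra.Fundamental_Theorem_Algebra"
begin

text \<open>
  Five quadrics without common zero form a regular sequence, and the socle of their quotient ring is
  a line in degree 5. Both facts are clear for the squares of the variables; they are transported to
  any other system by exchanging one quadric at a time, through intermediate systems that stay free
  of base points. For the partial derivatives of a smooth cubic \<open>F\<close> this gives Macaulay duality:
  every \<open>G\<close> orthogonal to \<open>J\<^bsub>F,3\<^esub>\<close> is the cubic associated with some quadric \<open>Q\<^sub>0\<close>. If \<open>Q\<^sub>1\<close> cuts
  \<open>F\<close> in a smooth surface, the surface of \<open>Q\<^sub>1 + t Q\<^sub>0\<close> is smooth for almost all \<open>t\<close>, and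
  so is its cubic, which depends linearly on the quadric.

  Openness rests on elimination: by the Nullstellensatz, the absence of base points is witnessed
  by finitely many identities, hence by the nonvanishing of a polynomial in the coefficients. The
  25 products \<open>x\<^sub>j \<partial>\<^sub>i F\<close> are linearly independent for smooth \<open>F\<close>, so a cubic orthogonal to
  \<open>J\<^bsub>F,3\<^esub>\<close> deforms with \<open>F\<close>.
\<close>

section \<open>Polynomials and evaluation\<close>

text \<open>The quadric \<open>Q\<^sub>0\<close> dual to a smooth \<open>G\<close> may cut
  \<open>F\<close> in a singular surface, while a Bertini argument yields a smooth surface and no
  control of its cubic. Both conditions are open on the pencil spanned by the two quadrics, and each
  holds at one of its ends. Bertini itself is a measure argument: the diagonal quadrics with
  singular section have parameters in a Lebesgue null set.

  Exchanging single quadrics replaces Koszul complexes and Hilbert series: a dimension count in one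
  large degree moves the nonzerodivisor property, and neighbouring socles correspond by multiplying
  with one quadric and dividing by the other.

  Nonemptiness needs an explicit pair, and the Fermat cubic fails: cubics orthogonal to all x_j
  x_i^2 are squarefree, hence singular at the coordinate points.\<close>

abbreviation (input) lookup :: "('a \<Rightarrow>\<^sub>0 'b::zero) \<Rightarrow> 'a \<Rightarrow> 'b" where "lookup \<equiv> Poly_Mapping.lookup"
abbreviation (input) keys :: "('a \<Rightarrow>\<^sub>0 'b::zero) \<Rightarrow> 'a set" where "keys \<equiv> Poly_Mapping.keys"
abbreviation (input) single :: "'a \<Rightarrow> 'b::zero \<Rightarrow> 'a \<Rightarrow>\<^sub>0 'b" where "single \<equiv> Poly_Mapping.single"

definition mono_eval :: "('v \<Rightarrow>\<^sub>0 nat) \<Rightarrow> ('v \<Rightarrow> complex) \<Rightarrow> complex" where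
  "mono_eval m a = (\<Prod>v\<in>keys m. a v ^ lookup m v)"

lemma mono_eval_superset:
  assumes "finite A" "keys m \<subseteq> A"
  shows "mono_eval m a = (\<Prod>v\<in>A. a v ^ lookup m v)"
  unfolding mono_eval_def using assms by (intro prod.mono_neutral_left) (auto simp: in_keys_iff)

lemma mono_eval_add: "mono_eval (m + n) a = mono_eval m a * mono_eval n a"
proof -
  let ?A = "keys m \<union> keys n"
  have "keys (m + n) \<subseteq> ?A" by (rule keys_add)
  then show ?thesis
    by (simp add: mono_eval_superset[of ?A] lookup_add power_add prod.distrib)
qed

lemma mono_eval_0 [simp]: "mono_eval 0 a = 1"
  by (simp add: mono_eval_def)

lemma mono_eval_single [simp]: "mono_eval (single v k) a = a v ^ k"
  by (simp add: mono_eval_superset[of "{v}"])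

lemma peval_alt: "peval P a = (\<Sum>m\<in>keys P. lookup P m * mono_eval m a)"
  by (simp add: peval_def mono_eval_def)

lemma peval_superset:
  assumes "finite A" "keys P \<subseteq> A"
  shows "peval P a = (\<Sum>m\<in>A. lookup P m * mono_eval m a)"
  unfolding peval_alt using assms by (intro sum.mono_neutral_left) (auto simp: in_keys_iff)

lemma peval_add [simp]: "peval (P + Q) a = peval P a + peval Q a"
proof -
  let ?A = "keys P \<union> keys Q"
  have "keys (P + Q) \<subseteq> ?A" by (rule keys_add)
  then show ?thesis
    by (simp add: peval_superset[of ?A] lookup_add distrib_right sum.distrib)
qed

lemma peval_0 [simp]: "peval 0 a = 0"
  by (simp add: peval_def)

lemma peval_single [simp]: "peval (single m c) a = c * mono_eval m a"
  by (simp add: peval_superset[of "{m}"])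

lemma peval_1 [simp]: "peval 1 a = 1"
  by (simp flip: single_one)

lemma peval_sum [simp]: "peval (sum f A) a = (\<Sum>x\<in>A. peval (f x) a)"
  by (induction A rule: infinite_finite_induct) auto

lemma poly_mapping_sum_single: "P = (\<Sum>m\<in>keys P. single m (lookup P m))"
  by (rule poly_mapping_eqI)
    (auto simp: lookup_sum lookup_single when_def in_keys_iff sum.delta')

lemma poly_mapping_additive_induct [case_names add single]:
  assumes "\<And>P Q. R P \<Longrightarrow> R Q \<Longrightarrow> R (P + Q)" "\<And>m c. R (single m c)"
  shows "R (P :: 'a \<Rightarrow>\<^sub>0 'b::comm_monoid_add)"
proof -
  have "R (\<Sum>m\<in>A. single m (lookup P m))" if "finite A" for A
    using that
  proof (induction A)
    case empty
    show ?case using assms(2)[of undefined 0] by simp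
  qed (simp add: assms)
  from this[of "keys P"] show ?thesis by (simp flip: poly_mapping_sum_single)
qed

lemma peval_mult [simp]: "peval (P * Q) a = peval P a * peval Q a"
proof (induction P rule: poly_mapping_additive_induct)
  case (single m c)
  show ?case
    by (induction Q rule: poly_mapping_additive_induct)
      (auto simp: distrib_left mult_single mono_eval_add)
qed (simp add: distrib_right)

lemma peval_uminus [simp]: "peval (- P) a = - peval P a"
  using peval_add[of P "- P" a] by (simp add: add_eq_0_iff)

lemma peval_diff [simp]: "peval (P - Q) a = peval P a - peval Q a"
  using peval_add[of P "- Q" a] by simp

lemma peval_power [simp]: "peval (P ^ n) a = peval P a ^ n"
  by (induction n) auto

definition cst :: "complex \<Rightarrow> 'v cpoly" where
  "cst c = single 0 c"

definition var :: "'v \<Rightarrow> 'v cpoly" where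
  "var v = single (single v 1) 1"

lemma const5_eq_cst: "const5 = cst"
  by (simp add: fun_eq_iff const5_def cst_def)

lemma peval_cst [simp]: "peval (cst c) a = c"
  by (simp add: cst_def)

lemma peval_var [simp]: "peval (var v) a = a v"
  by (simp add: var_def)

lemma cst_add: "cst (a + b) = cst a + cst b"
  by (simp add: cst_def single_add)

lemma cst_mult: "cst (a * b) = cst a * cst b"
  by (simp add: cst_def mult_single)

lemma cst_0 [simp]: "cst 0 = 0" and cst_1 [simp]: "cst 1 = 1"
  by (simp_all add: cst_def)

lemma cst_uminus: "cst (- a) = - cst a"
  by (simp add: cst_def single_uminus)

lemma cst_diff: "cst (a - b) = cst a - cst b"
  by (simp add: cst_def single_diff)

lemma lookup_cst_mult [simp]: "lookup (cst c * P) m = c * lookup P m"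
  by (induction P rule: poly_mapping_additive_induct)
    (auto simp: distrib_left lookup_add cst_def mult_single lookup_single when_def)

lemma single_eq_cst_mult: "single m c = cst c * single m 1"
  by (simp add: cst_def mult_single)

text \<open>Polynomials carry two linear structures: over the ring itself, so that spans are ideals,
  and over \<complex>, where dimensions can be counted.\<close>

interpretation rmod: module "(*) :: 'a::comm_ring_1 \<Rightarrow> 'a \<Rightarrow> 'a"
  by (rule module.intro) (simp_all only: distrib_left distrib_right mult.assoc mult_1_left)

interpretation cvs: vector_space "\<lambda>c (P :: 'v cpoly). cst c * P"
  by (rule vector_space.intro)
    (simp_all only: distrib_left distrib_right mult.assoc mult_1_left cst_add cst_mult cst_1)

text \<open>As simplification rules both would regroup products to the left, against the
  right-nested normal form of \<open>algebra_simps\<close>.\<close>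

declare rmod.scale_scale [simp del] cvs.scale_scale [simp del]

abbreviation "ideal_span \<equiv> rmod.span"

lemma ideal_span_mult: "P \<in> ideal_span A \<Longrightarrow> R * P \<in> ideal_span A"
  by (rule rmod.span_scale)

lemma ideal_span_mult': "P \<in> ideal_span A \<Longrightarrow> P * R \<in> ideal_span A"
  using ideal_span_mult[of P A R] by (simp add: mult.commute)

lemma ideal_span_insert_iff: "P \<in> ideal_span (insert a A) \<longleftrightarrow> (\<exists>k. P - k * a \<in> ideal_span A)"
  by (rule rmod.span_breakdown_eq)

lemma ideal_span_vanish:
  assumes "P \<in> ideal_span A" "\<And>f. f \<in> A \<Longrightarrow> peval f a = 0"
  shows "peval P a = 0"
  using assms(1) by (induction rule: rmod.span_induct_alt) (auto simp: assms(2))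

section \<open>Hilbert's Nullstellensatz\<close>

lemma single_split:
  assumes "k \<le> lookup m i"
  shows "single m c = single (m - single i k) c * (single (single i k) 1 :: 'v cpoly)"
proof -
  have "(m - single i k) + single i k = m"
    using assms by (intro poly_mapping_eqI) (auto simp: lookup_add lookup_minus lookup_single when_def)
  then show ?thesis by (simp add: mult_single)
qed

lemma mdeg_alt: "mdeg (m :: 'v::finite \<Rightarrow>\<^sub>0 nat) = (\<Sum>v\<in>UNIV. lookup m v)"
  unfolding mdeg_def by (intro sum.mono_neutral_left) (auto simp: in_keys_iff)

lemma finite_mdeg_le: "finite {m :: 'v::finite \<Rightarrow>\<^sub>0 nat. mdeg m \<le> d}"
proof (rule finite_imageD)
  have "lookup m v \<le> d" if "mdeg m \<le> d" for m :: "'v \<Rightarrow>\<^sub>0 nat" and v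
    using that member_le_sum[of v UNIV "lookup m"] by (simp add: mdeg_alt)
  then have "lookup ` {m :: 'v \<Rightarrow>\<^sub>0 nat. mdeg m \<le> d} \<subseteq> (\<Pi>\<^sub>E v\<in>UNIV. {..d})"
    by (auto simp: PiE_def)
  then show "finite (lookup ` {m :: 'v \<Rightarrow>\<^sub>0 nat. mdeg m \<le> d})"
    by (rule finite_subset) (intro finite_PiE; simp)
  show "inj_on lookup {m :: 'v \<Rightarrow>\<^sub>0 nat. mdeg m \<le> d}"
    by (intro inj_onI) (simp add: poly_mapping.lookup_inject)
qed

section \<open>Substitution into univariate polynomials\<close>

definition upoly_eval :: "'v cpoly \<Rightarrow> complex poly \<Rightarrow> 'v cpoly" where
  "upoly_eval x p = (\<Sum>i\<le>degree p. cst (coeff p i) * x ^ i)"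

lemma upoly_eval_superset: "degree p \<le> n \<Longrightarrow> upoly_eval x p = (\<Sum>i\<le>n. cst (coeff p i) * x ^ i)"
  unfolding upoly_eval_def by (intro sum.mono_neutral_left) (auto simp: coeff_eq_0)

lemma upoly_eval_pCons: "upoly_eval x (pCons a p) = cst a + x * upoly_eval x p"
proof -
  have "upoly_eval x (pCons a p) = (\<Sum>i\<le>Suc (degree p). cst (coeff (pCons a p) i) * x ^ i)"
    by (rule upoly_eval_superset) (rule degree_pCons_le)
  also have "\<dots> = cst a + (\<Sum>i\<le>degree p. cst (coeff p i) * x ^ Suc i)"
    by (subst sum.atMost_Suc_shift) simp
  finally show ?thesis by (simp add: upoly_eval_def sum_distrib_left algebra_simps)
qed

lemma upoly_eval_0 [simp]: "upoly_eval x 0 = 0"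
  by (simp add: upoly_eval_def)

lemma upoly_eval_add: "upoly_eval x (p + q) = upoly_eval x p + upoly_eval x q"
  by (simp add: upoly_eval_superset[of _ "max (degree p) (degree q)"] degree_add_le sum.distrib
      distrib_right cst_add)

lemma upoly_eval_smult: "upoly_eval x (smult c p) = cst c * upoly_eval x p"
  by (induction p) (auto simp: upoly_eval_pCons cst_mult algebra_simps)

lemma upoly_eval_mult: "upoly_eval x (p * q) = upoly_eval x p * upoly_eval x q"
  by (induction p) (auto simp: upoly_eval_pCons upoly_eval_add upoly_eval_smult algebra_simps)

lemma upoly_eval_sum: "upoly_eval x (sum f A) = (\<Sum>i\<in>A. upoly_eval x (f i))"
  by (induction A rule: infinite_finite_induct) (auto simp: upoly_eval_add)

lemma upoly_eval_1 [simp]: "upoly_eval x 1 = 1"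
  by (simp add: upoly_eval_def)

lemma upoly_eval_linear [simp]: "upoly_eval x [:- b, 1:] = x - cst b"
  by (simp add: upoly_eval_pCons cst_uminus)

lemma upoly_eval_prod_linear: "upoly_eval x (\<Prod>b\<in>A. [:- b, 1:]) = (\<Prod>b\<in>A. x - cst b)"
  by (induction A rule: infinite_finite_induct) (auto simp: upoly_eval_mult simp del: mult_pCons_left)

text \<open>Over \<complex> a nonconstant \<open>p\<close> has a root b, and primeness puts into
  \<open>M\<close> either x - b or the value at x of a cofactor of smaller degree. A nonzero
  constant cannot occur since \<open>1 \<notin> M\<close>.\<close>

lemma prime_ideal_contains_linear_factor:
  fixes M :: "('v::finite) cpoly set" and v :: 'v and p :: "complex poly"
  assumes M: "rmod.subspace M" and prime: "\<And>x y. x * y \<in> M \<Longrightarrow> x \<in> M \<or> y \<in> M" and one: "1 \<notin> M"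
    and "p \<noteq> 0" "upoly_eval x p \<in> M"
  shows "\<exists>b. x - cst b \<in> M"
  using assms(4,5)
proof (induction "degree p" arbitrary: p rule: less_induct)
  case (less p)
  show ?case
  proof (cases "degree p = 0")
    case True
    then obtain c where p: "p = [:c:]" by (rule degree_eq_zeroE)
    with less have "c \<noteq> 0" "cst c \<in> M" by (auto simp: upoly_eval_pCons)
    then have "cst (inverse c) * cst c \<in> M" using M by (intro rmod.subspace_scale)
    with \<open>c \<noteq> 0\<close> one show ?thesis by (simp flip: cst_mult)
  next
    case False
    then obtain b where "poly p b = 0"
      using alg_closed_imp_poly_has_root[of p] by auto
    then obtain q where q: "p = [:- b, 1:] * q" by (auto simp: poly_eq_0_iff_dvd)
    with less have "(x - cst b) * upoly_eval x q \<in> M" by (simp only: upoly_eval_mult upoly_eval_linear)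
    then consider "x - cst b \<in> M" | "upoly_eval x q \<in> M" using prime by blast
    then show ?thesis
    proof cases
      case 2
      have "q \<noteq> 0" using q less by auto
      then have "degree q < degree p" by (simp add: q degree_mult_eq del: mult_pCons_left)
      then show ?thesis using less.hyps \<open>q \<noteq> 0\<close> 2 by blast
    qed blast
  qed
qed

text \<open>If \<open>x - b\<close> were invertible modulo \<open>M\<close> up to a power of \<open>g\<close> for all \<open>b\<close>, the inverses would
  be linearly dependent, because \<open>\<complex>\<close> is uncountable while the polynomials are a countable union of
  finite-dimensional spaces; clearing denominators, some nonzero \<open>p(x)\<close> lies in \<open>M\<close>.\<close>
lemma prime_avoiding_contains_linear:
  fixes M :: "('v::finite) cpoly set"
  assumes M: "rmod.subspace M" and prime: "\<And>x y. x * y \<in> M \<Longrightarrow> x \<in> M \<or> y \<in> M"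
    and g: "\<And>n. g ^ n \<notin> M"
    and max: "\<And>h. h \<notin> M \<Longrightarrow> \<exists>n r. g ^ n - r * h \<in> M"
  shows "\<exists>b. x - cst b \<in> M"
proof (rule ccontr)
  assume "\<not> (\<exists>b. x - cst b \<in> M)"
  with max have "\<forall>b. \<exists>n r. g ^ n - r * (x - cst b) \<in> M" by blast
  then obtain n h where nh: "\<And>b. g ^ n b - h b * (x - cst b) \<in> M" by metis
  have gM: "g \<notin> M" using g[of 1] by simp
  have one: "1 \<notin> M" using g[of 0] by simp
  \<comment> \<open>Pigeonhole: countably many pairs of an exponent of \<open>g\<close> and a degree
    bound for \<open>h b\<close> cover the uncountably many b, so one class is infinite.\<close>
  define B where "B k d = {b. n b = k \<and> keys (h b) \<subseteq> {m. mdeg m \<le> d}}" for k d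
  have "\<exists>d. keys (h b) \<subseteq> {m. mdeg m \<le> d}" for b
    using finite_nat_set_iff_bounded_le[of "mdeg ` keys (h b)"] by auto
  then have "UNIV = (\<Union>(k, d)\<in>UNIV. B k d)" by (auto simp: B_def)
  moreover have "countable (\<Union>(k, d)\<in>UNIV. B k d)" if "\<forall>k d. finite (B k d)"
    by (rule countable_UN) (use that in \<open>auto intro: countable_finite\<close>)
  ultimately obtain k d where inf: "infinite (B k d)" using uncountable_UNIV_complex by metis
  define K :: "('v cpoly) set" where "K = (\<lambda>m. single m 1) ` {m. mdeg m \<le> d}"
  have K: "finite K" unfolding K_def by (intro finite_imageI finite_mdeg_le)
  have hM: "h b \<notin> M" for b
  proof
    assume "h b \<in> M"
    then have "h b * (x - cst b) \<in> M"
      using rmod.subspace_scale[OF M, of "h b" "x - cst b"] by (simp add: mult.commute)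
    from rmod.subspace_add[OF M nh[of b] this] have "g ^ n b \<in> M" by simp
    then show False using g by blast
  qed
  \<comment> \<open>Within a class, \<open>h b = h c\<close> would put (c - b) \<open>h b\<close>
    into \<open>M\<close>. So the class yields infinitely many elements of a finite-dimensional
    space, hence a dependency.\<close>
  have inj: "inj_on h (B k d)"
  proof (rule inj_onI, rule ccontr)
    fix b c assume bc: "b \<in> B k d" "c \<in> B k d" "h b = h c" "b \<noteq> c"
    then have "n b = n c" by (simp add: B_def)
    with bc have "h b * (x - cst b) - h b * (x - cst c) \<in> M"
      using rmod.subspace_diff[OF M nh[of c] nh[of b]] by simp
    moreover have "h b * (x - cst b) - h b * (x - cst c) = cst (c - b) * h b"
      by (simp add: algebra_simps cst_diff)
    ultimately have "cst (inverse (c - b)) * (cst (c - b) * h b) \<in> M"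
      using M by (metis rmod.subspace_scale)
    moreover have "cst (inverse (c - b)) * (cst (c - b) * h b) = cst (inverse (c - b) * (c - b)) * h b"
      unfolding cst_mult by (simp add: mult.assoc)
    ultimately show False using hM bc by simp
  qed
  have "h ` B k d \<subseteq> cvs.span K"
  proof
    fix P assume "P \<in> h ` B k d"
    then have P: "keys P \<subseteq> {m. mdeg m \<le> d}" by (auto simp: B_def)
    have "(\<Sum>m\<in>keys P. cst (lookup P m) * single m 1) \<in> cvs.span K"
      using P by (intro cvs.span_sum cvs.span_scale cvs.span_base) (auto simp: K_def)
    then show "P \<in> cvs.span K"
      by (subst poly_mapping_sum_single) (simp add: single_eq_cst_mult[of _ "lookup _ _"])
  qed
  moreover have "infinite (h ` B k d)" using inf inj by (simp add: finite_image_iff)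
  ultimately have "cvs.dependent (h ` B k d)"
    using cvs.independent_span_bound[OF K] by blast
  then obtain T u where T: "finite T" "T \<subseteq> h ` B k d" "(\<Sum>P\<in>T. cst (u P) * P) = 0" "\<exists>P\<in>T. u P \<noteq> 0"
    unfolding cvs.dependent_explicit by blast
  then obtain A where A: "A \<subseteq> B k d" "T = h ` A" by (meson subset_imageE)
  have injA: "inj_on h A" using inj A inj_on_subset by blast
  have "finite A" using T A injA by (simp add: finite_image_iff)
  define c where "c b = u (h b)" for b
  have c0: "(\<Sum>b\<in>A. cst (c b) * h b) = 0"
    using T(3) injA unfolding A c_def by (simp add: sum.reindex)
  obtain b0 where b0: "b0 \<in> A" "c b0 \<noteq> 0" using T(4) by (auto simp: A c_def)
  \<comment> \<open>Lagrange products: \<open>q b\<close> vanishes on \<open>A\<close> except at b,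
    so \<open>p\<close> does not vanish at a point whose coefficient is nonzero.\<close>
  define q where "q b = (\<Prod>a\<in>A - {b}. [:- a, 1:])" for b :: complex
  define p where "p = (\<Sum>b\<in>A. smult (c b) (q b))"
  have "poly p b0 = (\<Sum>b\<in>A. if b = b0 then c b0 * poly (q b0) b0 else 0)"
    unfolding p_def poly_sum
    using b0 \<open>finite A\<close> by (intro sum.cong) (auto simp: q_def poly_prod)
  also have "\<dots> = c b0 * poly (q b0) b0" using b0 \<open>finite A\<close> by simp
  also have "\<dots> \<noteq> 0" using b0 \<open>finite A\<close> by (auto simp: q_def poly_prod)
  finally have "p \<noteq> 0" by auto
  \<comment> \<open>Clearing denominators: modulo \<open>M\<close> each summand becomes c_b
    \<open>h b\<close> times the product of all x - a, and in the sum the vanishing combination of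
    the \<open>h b\<close> factors out.\<close>
  have "g ^ k * (cst (c b) * upoly_eval x (q b)) - cst (c b) * h b * (\<Prod>a\<in>A. x - cst a) \<in> M"
    if "b \<in> A" for b
  proof -
    have eq: "(\<Prod>a\<in>A. x - cst a) = (x - cst b) * upoly_eval x (q b)"
      using that \<open>finite A\<close> by (simp add: q_def upoly_eval_prod_linear prod.remove)
    have "g ^ k * (cst (c b) * upoly_eval x (q b)) - cst (c b) * h b * (\<Prod>a\<in>A. x - cst a)
       = (cst (c b) * upoly_eval x (q b)) * (g ^ k - h b * (x - cst b))"
      unfolding eq by (simp add: algebra_simps)
    moreover have "n b = k" using that A by (auto simp: B_def)
    ultimately show ?thesis using rmod.subspace_scale[OF M nh[of b]] by simp
  qed
  then have "(\<Sum>b\<in>A. g ^ k * (cst (c b) * upoly_eval x (q b)) - cst (c b) * h b * (\<Prod>a\<in>A. x - cst a)) \<in> M"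
    by (intro rmod.subspace_sum M)
  also have "(\<Sum>b\<in>A. g ^ k * (cst (c b) * upoly_eval x (q b)) - cst (c b) * h b * (\<Prod>a\<in>A. x - cst a))
     = g ^ k * upoly_eval x p"
    using c0 by (simp add: sum_subtractf upoly_eval_sum upoly_eval_smult p_def
        flip: sum_distrib_left sum_distrib_right)
  finally have "upoly_eval x p \<in> M" using prime g by blast
  with prime_ideal_contains_linear_factor[OF M prime one \<open>p \<noteq> 0\<close>] \<open>\<not> (\<exists>b. x - cst b \<in> M)\<close>
  show False by blast
qed

text \<open>Among the ideals containing \<open>I\<close> and no power of \<open>g\<close>, a maximal
  one is prime and contains x_v - a_v for some point a, so reduction modulo it is evaluation at a.
  Hence \<open>I\<close> vanishes at a and \<open>g\<close> does not. Avoiding all powers of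
  \<open>g\<close> gives the strong form without an auxiliary variable.\<close>

theorem nullstellensatz:
  fixes I :: "('v::finite) cpoly set"
  assumes I: "rmod.subspace I" and van: "\<And>a. (\<And>f. f \<in> I \<Longrightarrow> peval f a = 0) \<Longrightarrow> peval g a = 0"
  shows "\<exists>n. g ^ n \<in> I"
proof (rule ccontr)
  assume nI: "\<not> (\<exists>n. g ^ n \<in> I)"
  define \<A> where "\<A> = {J. rmod.subspace J \<and> I \<subseteq> J \<and> (\<forall>n. g ^ n \<notin> J)}"
  have "\<exists>M\<in>\<A>. \<forall>X\<in>\<A>. M \<subseteq> X \<longrightarrow> X = M"
  proof (rule subset_Zorn_nonempty)
    show "\<A> \<noteq> {}" using I nI by (auto simp: \<A>_def)
    fix \<C> assume C: "\<C> \<noteq> {}" "subset.chain \<A> \<C>"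
    have CA: "J \<in> \<A>" if "J \<in> \<C>" for J using C that by (auto simp: subset.chain_def)
    have "rmod.subspace (\<Union>\<C>)"
    proof (rule rmod.subspaceI)
      show "0 \<in> \<Union>\<C>" using C CA by (auto simp: \<A>_def intro: rmod.subspace_0)
      fix P Q assume "P \<in> \<Union>\<C>" "Q \<in> \<Union>\<C>"
      then obtain J K where "J \<in> \<C>" "K \<in> \<C>" "P \<in> J" "Q \<in> K" by blast
      moreover have "J \<subseteq> K \<or> K \<subseteq> J" using C calculation by (auto simp: subset.chain_def)
      ultimately obtain L where "L \<in> \<C>" "P \<in> L" "Q \<in> L" by blast
      then show "P + Q \<in> \<Union>\<C>" using CA[of L] by (auto simp: \<A>_def intro: rmod.subspace_add)
    next
      fix c P assume "P \<in> \<Union>\<C>"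
      then show "c * P \<in> \<Union>\<C>" using CA by (auto simp: \<A>_def intro: rmod.subspace_scale)
    qed
    then show "\<Union>\<C> \<in> \<A>" using C CA by (fastforce simp: \<A>_def)
  qed
  then obtain M where "M \<in> \<A>" and maxM: "\<And>X. X \<in> \<A> \<Longrightarrow> M \<subseteq> X \<Longrightarrow> X = M" by blast
  then have M: "rmod.subspace M" "I \<subseteq> M" and g: "\<And>n. g ^ n \<notin> M" by (auto simp: \<A>_def)
  \<comment> \<open>Maximality: adjoining \<open>h\<close> captures a power of \<open>g\<close>, so
    \<open>h\<close> is invertible modulo \<open>M\<close> up to powers of \<open>g\<close>.\<close>
  have max: "\<exists>n r. g ^ n - r * h \<in> M" if "h \<notin> M" for h
  proof -
    have "M \<subseteq> ideal_span (insert h M)" by (meson rmod.span_superset subset_insertI subset_trans)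
    moreover have "h \<in> ideal_span (insert h M)" by (simp add: rmod.span_base)
    ultimately have "ideal_span (insert h M) \<notin> \<A>" using maxM that by blast
    with \<open>M \<subseteq> ideal_span (insert h M)\<close> M obtain n where "g ^ n \<in> ideal_span (insert h M)"
      by (auto simp: \<A>_def)
    moreover have "ideal_span M = M" using M by (simp add: rmod.span_eq_iff)
    ultimately show ?thesis by (auto simp: ideal_span_insert_iff)
  qed
  have prime: "x \<in> M \<or> y \<in> M" if xy: "x * y \<in> M" for x y
  proof (rule ccontr)
    assume "\<not> (x \<in> M \<or> y \<in> M)"
    then obtain n r k s where "g ^ n - r * x \<in> M" "g ^ k - s * y \<in> M" using max by meson
    then have "g ^ k * (g ^ n - r * x) + (r * x) * (g ^ k - s * y) + r * s * (x * y) \<in> M"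
      by (intro rmod.subspace_add[OF M(1)] rmod.subspace_scale[OF M(1)] xy)
    also have "g ^ k * (g ^ n - r * x) + (r * x) * (g ^ k - s * y) + r * s * (x * y) = g ^ (n + k)"
      by (simp add: algebra_simps power_add)
    finally show False using g by blast
  qed
  have "\<exists>b. var v - cst b \<in> M" for v
    using prime_avoiding_contains_linear[OF M(1) prime g max] by blast
  then obtain a where a: "\<And>v. var v - cst (a v) \<in> M" by metis
  have mult: "P * Q - cst (p * q) \<in> M" if "P - cst p \<in> M" "Q - cst q \<in> M" for P Q p q
  proof -
    have "Q * (P - cst p) + cst p * (Q - cst q) \<in> M"
      by (intro rmod.subspace_add[OF M(1)] rmod.subspace_scale[OF M(1)] that)
    then show ?thesis by (simp add: algebra_simps cst_mult)
  qed
  have pow: "var v ^ k - cst (a v ^ k) \<in> M" for v k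
    by (induction k) (use M a mult in \<open>auto simp: rmod.subspace_0\<close>)
  have mono: "single m 1 - cst (mono_eval m a) \<in> M" for m
  proof -
    have vp: "var v ^ k = single (single v k) 1" for v :: 'v and k
      by (induction k) (auto simp: var_def mult_single simp flip: single_add)
    have prd: "(\<Prod>v\<in>A. var v ^ lookup m v) - cst (\<Prod>v\<in>A. a v ^ lookup m v) \<in> M" if "finite A" for A
      using that by (induction A) (use M pow mult in \<open>auto simp: rmod.subspace_0\<close>)
    have "(\<Prod>v\<in>A. var v ^ lookup m v) = single (\<Sum>v\<in>A. single v (lookup m v)) 1" if "finite A" for A
      using that by (induction A) (auto simp: vp mult_single)
    from this[of "keys m"] have "(\<Prod>v\<in>keys m. var v ^ lookup m v) = single m 1"
      by (simp flip: poly_mapping_sum_single)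
    with prd[of "keys m"] show ?thesis by (simp add: mono_eval_def)
  qed
  have ev: "P - cst (peval P a) \<in> M" for P
  proof (induction P rule: poly_mapping_additive_induct)
    case (add P Q)
    then show ?case
      using rmod.subspace_add[OF M(1) add] by (simp add: cst_add algebra_simps)
  next
    case (single m c)
    have "cst c * (single m 1 - cst (mono_eval m a)) \<in> M" by (intro rmod.subspace_scale M mono)
    then show ?case by (simp add: algebra_simps cst_mult flip: single_eq_cst_mult)
  qed
  have "peval f a = 0" if "f \<in> I" for f
  proof (rule ccontr)
    assume f: "peval f a \<noteq> 0"
    have "f \<in> M" using that M by blast
    from rmod.subspace_diff[OF M(1) this ev[of f]] have "cst (peval f a) \<in> M" by simp
    then have "cst (inverse (peval f a)) * cst (peval f a) \<in> M" by (rule rmod.subspace_scale[OF M(1)])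
    then show False using f g[of 0] by (simp flip: cst_mult)
  qed
  then have "peval g a = 0" by (rule van)
  then show False using ev[of g] g[of 1] by simp
qed

section \<open>Forms and homogeneous ideals\<close>

lemma mdeg_add [simp]: "mdeg (m + n) = mdeg m + mdeg (n :: 'v::finite \<Rightarrow>\<^sub>0 nat)"
  by (simp add: mdeg_alt lookup_add sum.distrib)

lemma mdeg_single [simp]: "mdeg (single v k) = k"
  by (simp add: mdeg_def)

lemma mdeg_0 [simp]: "mdeg 0 = 0"
  by (simp add: mdeg_def)

lemma mdeg_eq_0_iff [simp]: "mdeg (m :: 'v::finite \<Rightarrow>\<^sub>0 nat) = 0 \<longleftrightarrow> m = 0"
  by (auto simp: mdeg_alt intro: poly_mapping_eqI)

lemma finite_mdeg_eq: "finite {m :: 'v::finite \<Rightarrow>\<^sub>0 nat. mdeg m = d}"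
  by (rule finite_subset[OF _ finite_mdeg_le[of d]]) auto

lemma lookup_single_mult:
  "lookup (single k c * Q) m = (if \<exists>q. m = k + q then c * lookup Q (m - k) else 0)"
  for Q :: "'v cpoly"
  by (induction Q rule: poly_mapping_additive_induct)
    (auto simp: distrib_left lookup_add mult_single lookup_single when_def, metis)

lemma forms_iff: "P \<in> forms k \<longleftrightarrow> (\<forall>m. lookup P m \<noteq> 0 \<longrightarrow> mdeg m = k)"
  by (auto simp: forms_def in_keys_iff)

lemma forms_0 [simp]: "0 \<in> forms k"
  by (simp add: forms_iff)

lemma forms_add: "P \<in> forms k \<Longrightarrow> Q \<in> forms k \<Longrightarrow> P + Q \<in> forms k"
  by (simp add: forms_iff lookup_add) (metis add_0)

lemma forms_diff: "P \<in> forms k \<Longrightarrow> Q \<in> forms k \<Longrightarrow> P - Q \<in> forms k"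
  by (simp add: forms_iff lookup_minus) metis

lemma forms_cst_mult: "P \<in> forms k \<Longrightarrow> cst c * P \<in> forms k"
  by (auto simp: forms_iff)

lemma forms_sum: "(\<And>i. i \<in> A \<Longrightarrow> f i \<in> forms k) \<Longrightarrow> sum f A \<in> forms k"
  by (induction A rule: infinite_finite_induct) (auto simp: forms_add)

lemma forms_single: "c = 0 \<or> mdeg m = k \<Longrightarrow> single m c \<in> forms k"
  by (auto simp: forms_iff lookup_single when_def)

lemma forms_var: "var i \<in> forms 1"
  by (simp add: var_def forms_single)

lemma forms_1: "1 \<in> forms 0"
  by (simp add: forms_single flip: single_one)

lemma forms_mult:
  assumes "P \<in> forms k" "Q \<in> forms l"
  shows "P * Q \<in> forms (k + l)"
  unfolding forms_def
proof (clarify)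
  fix m assume "m \<in> keys (P * Q)"
  then obtain a b where "m = a + b" "a \<in> keys P" "b \<in> keys Q"
    using keys_mult[of P Q] by auto
  then show "mdeg m = k + l" using assms by (simp add: forms_def)
qed

lemma forms_power: "P \<in> forms k \<Longrightarrow> P ^ n \<in> forms (n * k)"
  by (induction n) (auto simp: forms_1 forms_mult)

lemma cvs_subspace_forms: "cvs.subspace (forms k)"
  by (rule cvs.subspaceI) (auto intro: forms_add forms_cst_mult)

lemma peval_form_scale:
  assumes "P \<in> forms k"
  shows "peval P (\<lambda>i. c * a i) = c ^ k * peval P a"
proof -
  have "mono_eval m (\<lambda>i. c * a i) = c ^ mdeg m * mono_eval m a" for m :: "5 \<Rightarrow>\<^sub>0 nat"
    by (simp add: mono_eval_superset[of UNIV] power_mult_distrib prod.distrib mdeg_alt flip: power_sum)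
  then show ?thesis
    using assms by (simp add: peval_alt forms_def sum_distrib_left mult_ac)
qed

section \<open>Homogeneous components and homogeneous ideals\<close>

definition hcomp :: "nat \<Rightarrow> poly5 \<Rightarrow> poly5" where
  "hcomp k P = (\<Sum>m | m \<in> keys P \<and> mdeg m = k. single m (lookup P m))"

lemma lookup_hcomp: "lookup (hcomp k P) m = (if mdeg m = k then lookup P m else 0)"
  by (auto simp: hcomp_def lookup_sum lookup_single when_def sum.delta' in_keys_iff)

lemma hcomp_in_forms [simp]: "hcomp k P \<in> forms k"
  by (auto simp: forms_iff lookup_hcomp)

lemma hcomp_add: "hcomp k (P + Q) = hcomp k P + hcomp k Q"
  by (rule poly_mapping_eqI) (simp add: lookup_hcomp lookup_add)

lemma hcomp_diff: "hcomp k (P - Q) = hcomp k P - hcomp k Q"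
  by (rule poly_mapping_eqI) (simp add: lookup_hcomp lookup_minus)

lemma hcomp_0 [simp]: "hcomp k 0 = 0"
  by (rule poly_mapping_eqI) (simp add: lookup_hcomp)

lemma hcomp_sum: "hcomp k (sum f A) = (\<Sum>i\<in>A. hcomp k (f i))"
  by (induction A rule: infinite_finite_induct) (auto simp: hcomp_add)

lemma hcomp_form: "P \<in> forms k \<Longrightarrow> hcomp n P = (if n = k then P else 0)"
  by (rule poly_mapping_eqI) (auto simp: lookup_hcomp forms_iff)

lemma hcomp_mult_form:
  assumes "f \<in> forms d"
  shows "hcomp n (h * f) = (if d \<le> n then hcomp (n - d) h * f else 0)"
proof (induction h rule: poly_mapping_additive_induct)
  case (single m c)
  have "single m c * f \<in> forms (mdeg m + d)" by (intro forms_mult forms_single assms) simp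
  moreover have "single m c \<in> forms (mdeg m)" by (rule forms_single) simp
  ultimately show ?case by (auto simp: hcomp_form)
qed (auto simp: distrib_right hcomp_add)

definition homogeneous :: "poly5 set \<Rightarrow> bool" where
  "homogeneous A \<longleftrightarrow> (\<forall>f\<in>A. \<exists>d. f \<in> forms d)"

lemma hcomp_ideal_span:
  assumes "homogeneous A" "P \<in> ideal_span A"
  shows "hcomp n P \<in> ideal_span A"
  using assms(2)
proof (induction rule: rmod.span_induct_alt)
  case (step c x y)
  obtain d where "x \<in> forms d" using step assms(1) by (auto simp: homogeneous_def)
  then have "hcomp n (c * x) \<in> ideal_span A"
    using step by (auto simp: hcomp_mult_form intro: rmod.span_scale rmod.span_base rmod.span_zero)
  then show ?case using step by (auto simp: hcomp_add intro: rmod.span_add)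
qed (auto intro: rmod.span_zero)

text \<open>Taking degree n components of any relation makes the cofactor homogeneous. For
  \<open>n < d\<close> the difference truncates to 0, and membership in \<open>forms (n - d)\<close>
  alone would admit nonzero constants.\<close>

lemma homogeneous_cofactor:
  assumes "homogeneous A" "a \<in> forms d" "P \<in> forms n" "P \<in> ideal_span (insert a A)"
  obtains k where "k \<in> forms (n - d)" "n < d \<Longrightarrow> k = 0" "P - k * a \<in> ideal_span A"
proof -
  obtain k where "P - k * a \<in> ideal_span A" using assms(4) by (auto simp: ideal_span_insert_iff)
  from hcomp_ideal_span[OF assms(1) this, of n]
  have *: "P - (if d \<le> n then hcomp (n - d) k * a else 0) \<in> ideal_span A"
    using assms by (simp add: hcomp_diff hcomp_form hcomp_mult_form)
  show thesis
    by (rule that[of "if d \<le> n then hcomp (n - d) k else 0"]) (use * in \<open>auto split: if_splits\<close>)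
qed

lemma ideal_span_image_iff:
  assumes "finite J"
  shows "P \<in> ideal_span (f ` J) \<longleftrightarrow> (\<exists>r. P = (\<Sum>j\<in>J. r j * f j))"
  using assms
proof (induction J arbitrary: P)
  case (insert j J)
  have "P \<in> ideal_span (f ` insert j J) \<longleftrightarrow> (\<exists>k r. P - k * f j = (\<Sum>j\<in>J. r j * f j))"
    by (simp add: ideal_span_insert_iff insert.IH)
  also have "\<dots> \<longleftrightarrow> (\<exists>r. P = (\<Sum>j\<in>insert j J. r j * f j))"
  proof safe
    fix k r assume "P - k * f j = (\<Sum>j\<in>J. r j * f j)"
    then have "P = k * f j + (\<Sum>j\<in>J. r j * f j)" by (simp add: algebra_simps)
    also have "(\<Sum>j\<in>J. r j * f j) = (\<Sum>i\<in>J. (r(j := k)) i * f i)"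
      using insert by (intro sum.cong) auto
    also have "k * f j + \<dots> = (\<Sum>i\<in>insert j J. (r(j := k)) i * f i)" using insert by simp
    finally show "\<exists>r. P = (\<Sum>j\<in>insert j J. r j * f j)" by blast
  next
    fix r
    have "(\<Sum>j\<in>insert j J. r j * f j) - r j * f j = (\<Sum>j\<in>J. r j * f j)" using insert by simp
    then show "\<exists>k r'. (\<Sum>j\<in>insert j J. r j * f j) - k * f j = (\<Sum>j\<in>J. r' j * f j)" by blast
  qed
  finally show ?case .
qed auto

lemma form_in_homogeneous_ideal:
  assumes J: "finite J" and f: "\<And>j. j \<in> J \<Longrightarrow> f j \<in> forms (d j)"
    and P: "P \<in> forms n" "P \<in> ideal_span (f ` J)"
  obtains r where "\<And>j. r j \<in> forms (n - d j)" "\<And>j. n < d j \<Longrightarrow> r j = 0" "P = (\<Sum>j\<in>J. r j * f j)"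
proof -
  obtain r where r: "P = (\<Sum>j\<in>J. r j * f j)" using P J by (auto simp: ideal_span_image_iff)
  have "P = hcomp n P" using P by (simp add: hcomp_form)
  also have "\<dots> = (\<Sum>j\<in>J. (if d j \<le> n then hcomp (n - d j) (r j) else 0) * f j)"
    unfolding r hcomp_sum using hcomp_mult_form[OF f] by (intro sum.cong) auto
  finally show thesis
    by (intro that[of "\<lambda>j. if d j \<le> n then hcomp (n - d j) (r j) else 0"]) auto
qed

definition base_point_free :: "poly5 set \<Rightarrow> bool" where
  "base_point_free A \<longleftrightarrow> (\<forall>a. (\<forall>f\<in>A. peval f a = 0) \<longrightarrow> a = (\<lambda>_. 0))"

text \<open>The ideal contains a power of each variable, and a monomial whose degree exceeds the sum
  of these exponents is divisible by one of the powers.\<close>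

lemma projective_nullstellensatz:
  assumes "base_point_free A"
  obtains N where "\<And>n P. N \<le> n \<Longrightarrow> P \<in> forms n \<Longrightarrow> P \<in> ideal_span A"
proof -
  have "\<exists>k. var i ^ k \<in> ideal_span A" for i
  proof (rule nullstellensatz)
    fix a assume "\<And>f. f \<in> ideal_span A \<Longrightarrow> peval f a = 0"
    then have "a = (\<lambda>_. 0)" using assms by (auto simp: base_point_free_def intro: rmod.span_base)
    then show "peval (var i) a = 0" by simp
  qed simp
  then obtain k where k: "\<And>i. var i ^ k i \<in> ideal_span A" by metis
  have var_pow: "var i ^ e = single (single i e) 1" for i :: 5 and e
    by (induction e) (auto simp: var_def mult_single simp flip: single_add)
  show thesis
  proof (rule that)
    fix n P assume n: "Suc (sum k UNIV) \<le> n" and P: "P \<in> forms n"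
    have "single m c \<in> ideal_span A" if m: "mdeg m = n" for m c
    proof -
      have "\<exists>i. k i \<le> lookup m i"
      proof (rule ccontr)
        assume "\<not> ?thesis"
        then have "sum (lookup m) UNIV \<le> sum k UNIV" by (intro sum_mono) (simp add: not_le less_imp_le)
        then show False using n m by (simp add: mdeg_alt)
      qed
      then obtain i where i: "k i \<le> lookup m i" by blast
      then have "single m c = single (m - single i (k i)) c * var i ^ k i"
        unfolding var_pow by (rule single_split)
      then show ?thesis using k by (auto intro: ideal_span_mult)
    qed
    then have "(\<Sum>m\<in>keys P. single m (lookup P m)) \<in> ideal_span A"
      using P by (intro rmod.span_sum) (auto simp: forms_def)
    then show "P \<in> ideal_span A" by (simp flip: poly_mapping_sum_single)
  qed
qed

section \<open>Elimination of projective variables\<close>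

text \<open>An abstract ring of parameter functions lets one elimination argument serve polynomials
  in a line parameter t and polynomials in the coefficients of a cubic.\<close>

definition function_algebra :: "('p \<Rightarrow> complex) set \<Rightarrow> bool" where
  "function_algebra \<A> \<longleftrightarrow> (\<forall>c. (\<lambda>_. c) \<in> \<A>) \<and>
     (\<forall>f\<in>\<A>. \<forall>g\<in>\<A>. (\<lambda>p. f p + g p) \<in> \<A> \<and> (\<lambda>p. f p * g p) \<in> \<A>)"

lemma function_algebraD:
  assumes "function_algebra \<A>"
  shows "(\<lambda>_. c) \<in> \<A>"
    and "f \<in> \<A> \<Longrightarrow> g \<in> \<A> \<Longrightarrow> (\<lambda>p. f p + g p) \<in> \<A>"
    and "f \<in> \<A> \<Longrightarrow> g \<in> \<A> \<Longrightarrow> (\<lambda>p. f p * g p) \<in> \<A>"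
    and "f \<in> \<A> \<Longrightarrow> g \<in> \<A> \<Longrightarrow> (\<lambda>p. f p - g p) \<in> \<A>"
    and "(\<And>i. i \<in> I \<Longrightarrow> h i \<in> \<A>) \<Longrightarrow> (\<lambda>p. \<Sum>i\<in>I. h i p) \<in> \<A>"
proof -
  show c: "(\<lambda>_. c) \<in> \<A>" for c using assms by (simp add: function_algebra_def)
  show a: "f \<in> \<A> \<Longrightarrow> g \<in> \<A> \<Longrightarrow> (\<lambda>p. f p + g p) \<in> \<A>" for f g
    using assms by (simp add: function_algebra_def)
  show m: "f \<in> \<A> \<Longrightarrow> g \<in> \<A> \<Longrightarrow> (\<lambda>p. f p * g p) \<in> \<A>" for f g
    using assms by (simp add: function_algebra_def)
  show "f \<in> \<A> \<Longrightarrow> g \<in> \<A> \<Longrightarrow> (\<lambda>p. f p - g p) \<in> \<A>"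
    using a[of f "\<lambda>p. - 1 * g p"] m[of "\<lambda>_. - 1" g] c[of "- 1"] by simp
  show "(\<And>i. i \<in> I \<Longrightarrow> h i \<in> \<A>) \<Longrightarrow> (\<lambda>p. \<Sum>i\<in>I. h i p) \<in> \<A>"
    by (induction I rule: infinite_finite_induct) (auto simp: c a)
qed

text \<open>Gaussian elimination without division, hence uniform in the parameter.\<close>
lemma left_inverse_family:
  assumes alg: "function_algebra \<A>" and "finite C" "finite R"
    and E: "\<And>i j. i \<in> R \<Longrightarrow> j \<in> C \<Longrightarrow> (\<lambda>p. E p i j) \<in> \<A>"
    and inj: "\<And>v. (\<And>i. i \<in> R \<Longrightarrow> (\<Sum>j\<in>C. E p0 i j * v j) = 0) \<Longrightarrow> \<forall>j\<in>C. v j = 0"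
  shows "\<exists>D B. D \<in> \<A> \<and> D p0 \<noteq> 0 \<and> (\<forall>i\<in>R. \<forall>j\<in>C. (\<lambda>p. B p j i) \<in> \<A>) \<and>
    (\<forall>p v. \<forall>j\<in>C. D p * v j = (\<Sum>i\<in>R. B p j i * (\<Sum>k\<in>C. E p i k * v k)))"
  using assms(2,3) E inj
proof (induction C arbitrary: R E rule: finite_induct)
  case empty
  show ?case
    by (rule exI[of _ "\<lambda>_. 1"], rule exI[of _ "\<lambda>_ _ _. 0"]) (auto intro: function_algebraD(1)[OF alg])
next
  case (insert s C)
  have "\<exists>i\<in>R. E p0 i s \<noteq> 0"
  proof (rule ccontr)
    assume *: "\<not> ?thesis"
    have "\<forall>j\<in>insert s C. (if j = s then 1 else 0 :: complex) = 0"
    proof (rule insert.prems(3))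
      fix i assume "i \<in> R"
      have "(\<Sum>j\<in>C. E p0 i j * (if j = s then 1 else 0)) = 0"
        using insert.hyps by (intro sum.neutral) auto
      then show "(\<Sum>j\<in>insert s C. E p0 i j * (if j = s then 1 else 0)) = 0"
        using * \<open>i \<in> R\<close> insert.hyps by simp
    qed
    then show False by simp
  qed
  then obtain i0 where i0: "i0 \<in> R" "E p0 i0 s \<noteq> 0" by blast
  define R' where "R' = R - {i0}"
  \<comment> \<open>Cross multiplication instead of division: the pivot is known to be nonzero only
    at \<open>p0\<close>.\<close>
  define E' where "E' p k j = E p i0 s * E p k j - E p k s * E p i0 j" for p k j
  have elim: "(\<Sum>j\<in>C. E' p k j * v j) =
      E p i0 s * (\<Sum>j\<in>insert s C. E p k j * v j) - E p k s * (\<Sum>j\<in>insert s C. E p i0 j * v j)" for p k v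
    using insert(1,2)
    by (simp add: E'_def left_diff_distrib sum_subtractf sum_distrib_left algebra_simps)
  have "\<exists>D B. D \<in> \<A> \<and> D p0 \<noteq> 0 \<and> (\<forall>i\<in>R'. \<forall>j\<in>C. (\<lambda>p. B p j i) \<in> \<A>) \<and>
    (\<forall>p v. \<forall>j\<in>C. D p * v j = (\<Sum>i\<in>R'. B p j i * (\<Sum>k\<in>C. E' p i k * v k)))"
  proof (rule insert.IH)
    show "finite R'" using insert.prems(1) by (simp add: R'_def)
    show "(\<lambda>p. E' p i j) \<in> \<A>" if "i \<in> R'" "j \<in> C" for i j
      unfolding E'_def using that i0 insert.prems(2)
      by (intro function_algebraD[OF alg]) (auto simp: R'_def)
    fix v assume v: "\<And>i. i \<in> R' \<Longrightarrow> (\<Sum>j\<in>C. E' p0 i j * v j) = 0"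
    \<comment> \<open>At \<open>p0\<close> the pivot is invertible, so a kernel vector of the
      reduced matrix extends to one of \<open>E p0\<close> by solving row \<open>i0\<close> for the
      entry at s.\<close>
    define w where "w = v(s := - (\<Sum>j\<in>C. E p0 i0 j * v j) / E p0 i0 s)"
    have wC: "(\<Sum>j\<in>C. F j * w j) = (\<Sum>j\<in>C. F j * v j)" for F
      using insert(2) by (intro sum.cong) (auto simp: w_def)
    have w0: "(\<Sum>j\<in>insert s C. E p0 i0 j * w j) = 0"
      using insert(1,2) i0 by (simp add: wC) (simp add: w_def)
    have "\<forall>j\<in>insert s C. w j = 0"
    proof (rule insert.prems(3))
      fix i assume "i \<in> R"
      show "(\<Sum>j\<in>insert s C. E p0 i j * w j) = 0"
      proof (cases "i = i0")
        case False
        then have "(\<Sum>j\<in>C. E' p0 i j * w j) = 0" using v[of i] \<open>i \<in> R\<close> by (simp add: wC R'_def)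
        then show ?thesis using i0 w0 by (simp add: elim)
      qed (use w0 in simp)
    qed
    then show "\<forall>j\<in>C. v j = 0" using insert(2) by (auto simp: w_def split: if_splits)
  qed
  then obtain D B where D: "D \<in> \<A>" "D p0 \<noteq> 0" and B: "\<forall>i\<in>R'. \<forall>j\<in>C. (\<lambda>p. B p j i) \<in> \<A>"
    and DB: "\<And>p v j. j \<in> C \<Longrightarrow> D p * v j = (\<Sum>i\<in>R'. B p j i * (\<Sum>k\<in>C. E' p i k * v k))"
    by blast
  have Rsplit: "(\<Sum>i\<in>R. F i) = F i0 + (\<Sum>i\<in>R'. F i)" for F :: "_ \<Rightarrow> complex"
    using i0 insert.prems(1) by (simp add: R'_def sum.remove)
  define B1 where "B1 p j i = (if i = i0 then - (\<Sum>k\<in>R'. B p j k * E p k s) else E p i0 s * B p j i)" for p j i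
  have aux: "(\<Sum>i\<in>R'. b i * (c * S i - e i * S0)) = - (\<Sum>k\<in>R'. b k * e k) * S0 + (\<Sum>i\<in>R'. c * b i * S i)"
    for b S e :: "_ \<Rightarrow> complex" and c S0
    by (simp add: right_diff_distrib sum_subtractf sum_distrib_left mult_ac)
  have aux2: "(\<Sum>i\<in>R. (\<Sum>k\<in>C. e k * b k i) * S i) = (\<Sum>k\<in>C. e k * (\<Sum>i\<in>R. b k i * S i))"
    for b e and S :: "_ \<Rightarrow> complex"
    unfolding sum_distrib_left sum_distrib_right by (subst sum.swap) (simp only: mult_ac)
  have DB1: "D p * v j = (\<Sum>i\<in>R. B1 p j i * (\<Sum>k\<in>insert s C. E p i k * v k))" if "j \<in> C" for p v j
  proof -
    let ?S = "\<lambda>i. \<Sum>k\<in>insert s C. E p i k * v k"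
    have "D p * v j = (\<Sum>i\<in>R'. B p j i * (E p i0 s * ?S i - E p i s * ?S i0))"
      unfolding DB[OF that] elim ..
    also have "\<dots> = - (\<Sum>k\<in>R'. B p j k * E p k s) * ?S i0 + (\<Sum>i\<in>R'. E p i0 s * B p j i * ?S i)"
      by (rule aux)
    also have "(\<Sum>i\<in>R'. E p i0 s * B p j i * ?S i) = (\<Sum>i\<in>R'. B1 p j i * ?S i)"
      by (intro sum.cong) (auto simp: B1_def R'_def)
    finally show ?thesis unfolding Rsplit by (simp add: B1_def)
  qed
  have B1: "(\<lambda>p. B1 p j i) \<in> \<A>" if "i \<in> R" "j \<in> C" for i j
  proof (cases "i = i0")
    case True
    have "(\<lambda>p. 0 - (\<Sum>k\<in>R'. B p j k * E p k s)) \<in> \<A>"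
      using that B insert.prems(2) by (intro function_algebraD[OF alg]) (auto simp: R'_def)
    then show ?thesis using True by (simp add: B1_def)
  next
    case False
    then show ?thesis using that B insert.prems(2) i0
      by (simp add: B1_def) (intro function_algebraD[OF alg]; auto simp: R'_def)
  qed
  \<comment> \<open>Back substitution: row \<open>i0\<close> yields the entry at s from those in
    \<open>C\<close>, known up to the factor \<open>D p\<close>; the other rows only acquire the
    pivot as a factor.\<close>
  define B2 where "B2 p j i = (if j = s then D p * (if i = i0 then 1 else 0) - (\<Sum>k\<in>C. E p i0 k * B1 p k i)
      else E p i0 s * B1 p j i)" for p j i
  show ?case
  proof (intro exI[of _ "\<lambda>p. D p * E p i0 s"] exI[of _ B2] conjI ballI allI)
    show "(\<lambda>p. D p * E p i0 s) \<in> \<A>" "D p0 * E p0 i0 s \<noteq> 0"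
      using D i0 insert.prems(2) by (auto intro: function_algebraD[OF alg])
    fix j assume j: "j \<in> insert s C"
    show "(\<lambda>p. B2 p j i) \<in> \<A>" if "i \<in> R" for i
    proof (cases "j = s")
      case True
      have "(\<lambda>p. D p * (if i = i0 then 1 else 0) - (\<Sum>k\<in>C. E p i0 k * B1 p k i)) \<in> \<A>"
        using that B1 D i0 insert.prems(2) by (intro function_algebraD[OF alg]) auto
      then show ?thesis using True by (simp add: B2_def)
    next
      case False
      then have "(\<lambda>p. E p i0 s * B1 p j i) \<in> \<A>"
        using that j B1 i0 insert.prems(2) by (intro function_algebraD[OF alg]) auto
      then show ?thesis using False by (simp add: B2_def)
    qed
    fix p v
    let ?S = "\<lambda>i. \<Sum>k\<in>insert s C. E p i k * v k"
    show "D p * E p i0 s * v j = (\<Sum>i\<in>R. B2 p j i * ?S i)"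
    proof (cases "j = s")
      case True
      have "(\<Sum>i\<in>R. B2 p s i * ?S i) =
          (\<Sum>i\<in>R. D p * (if i = i0 then 1 else 0) * ?S i) - (\<Sum>i\<in>R. (\<Sum>k\<in>C. E p i0 k * B1 p k i) * ?S i)"
        by (simp only: B2_def if_True left_diff_distrib sum_subtractf refl)
      also have "(\<Sum>i\<in>R. D p * (if i = i0 then 1 else 0) * ?S i) = D p * ?S i0"
        unfolding Rsplit by (simp add: R'_def)
      also have "(\<Sum>i\<in>R. (\<Sum>k\<in>C. E p i0 k * B1 p k i) * ?S i) = (\<Sum>k\<in>C. E p i0 k * (\<Sum>i\<in>R. B1 p k i * ?S i))"
        by (rule aux2)
      also have "\<dots> = (\<Sum>k\<in>C. E p i0 k * (D p * v k))" using DB1 by (intro sum.cong) auto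
      also have "D p * ?S i0 - \<dots> = D p * E p i0 s * v s"
        using insert(1,2) by (simp add: distrib_left sum_distrib_left mult_ac)
      finally show ?thesis using True by simp
    next
      case False
      then have "(\<Sum>i\<in>R. B2 p j i * ?S i) = E p i0 s * (\<Sum>i\<in>R. B1 p j i * ?S i)"
        by (simp add: B2_def sum_distrib_left mult.assoc)
      also have "\<dots> = E p i0 s * (D p * v j)" using DB1[of j p v] False j by simp
      finally show ?thesis by (simp add: mult_ac)
    qed
  qed
qed

lemma coefficients_mult_const:
  fixes f :: "'p \<Rightarrow> 'v cpoly"
  assumes alg: "function_algebra \<A>" and f: "\<And>m. (\<lambda>p. lookup (f p) m) \<in> \<A>"
  shows "(\<lambda>p. lookup (h * f p) m) \<in> \<A>"
proof (induction h rule: poly_mapping_additive_induct)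
  case (single k c)
  show ?case
  proof (cases "\<exists>q. m = k + q")
    case True
    then show ?thesis using f
      by (auto simp: lookup_single_mult intro!: function_algebraD[OF alg])
  qed (simp add: lookup_single_mult function_algebraD(1)[OF alg])
qed (auto simp: distrib_right lookup_add intro: function_algebraD(2)[OF alg])

text \<open>In a large degree n every monomial is a combination of the \<open>f p0 j\<close>.
  Freezing these cofactors while p varies gives a square coefficient matrix that is the identity at
  \<open>p0\<close>. Wherever \<open>D\<close> does not vanish, a common zero kills all monomials of
  degree n, in particular the pure powers.\<close>

lemma elimination:
  fixes f :: "'p \<Rightarrow> 'j \<Rightarrow> poly5"
  assumes alg: "function_algebra \<A>" and J: "finite J"
    and f: "\<And>p j. j \<in> J \<Longrightarrow> f p j \<in> forms (d j)"
    and coeffs: "\<And>j m. j \<in> J \<Longrightarrow> (\<lambda>p. lookup (f p j) m) \<in> \<A>"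
    and p0: "base_point_free (f p0 ` J)"
  shows "\<exists>D\<in>\<A>. D p0 \<noteq> 0 \<and> (\<forall>p. D p \<noteq> 0 \<longrightarrow> base_point_free (f p ` J))"
proof -
  obtain N where N: "\<And>n P. N \<le> n \<Longrightarrow> P \<in> forms n \<Longrightarrow> P \<in> ideal_span (f p0 ` J)"
    using projective_nullstellensatz[OF p0] by blast
  \<comment> \<open>The successor makes n positive, so a vanishing n-th power forces its coordinate
    to vanish.\<close>
  define n where "n = Suc N"
  define K where "K = {m :: 5 \<Rightarrow>\<^sub>0 nat. mdeg m = n}"
  have K: "finite K" by (simp add: K_def finite_mdeg_eq)
  have "\<exists>r. (\<forall>j. r j \<in> forms (n - d j)) \<and> (\<forall>j. n < d j \<longrightarrow> r j = 0) \<and> single m 1 = (\<Sum>j\<in>J. r j * f p0 j)"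
    if "m \<in> K" for m
  proof -
    have m: "single m 1 \<in> forms n" using that by (simp add: K_def forms_single)
    have mem: "single m 1 \<in> ideal_span (f p0 ` J)" by (rule N[OF _ m]) (simp add: n_def)
    show ?thesis
      by (rule form_in_homogeneous_ideal[OF J f[where p = p0] m mem]) blast+
  qed
  then have "\<forall>m\<in>K. \<exists>r. (\<forall>j. r j \<in> forms (n - d j)) \<and> (\<forall>j. n < d j \<longrightarrow> r j = 0) \<and>
      single m 1 = (\<Sum>j\<in>J. r j * f p0 j)" by blast
  from bchoice[OF this] obtain r where
    r: "\<And>m j. m \<in> K \<Longrightarrow> r m j \<in> forms (n - d j)" "\<And>m j. m \<in> K \<Longrightarrow> n < d j \<Longrightarrow> r m j = 0"
    and r0: "\<And>m. m \<in> K \<Longrightarrow> single m 1 = (\<Sum>j\<in>J. r m j * f p0 j)"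
    by blast
  define P where "P p m = (\<Sum>j\<in>J. r m j * f p j)" for p m
  have P_forms: "P p m \<in> forms n" if "m \<in> K" for p m
    unfolding P_def
  proof (rule forms_sum)
    fix j assume "j \<in> J"
    show "r m j * f p j \<in> forms n"
    proof (cases "n < d j")
      case False
      have "r m j * f p j \<in> forms (n - d j + d j)" using r f that \<open>j \<in> J\<close> by (intro forms_mult) auto
      then show ?thesis using False by simp
    qed (use r that in simp)
  qed
  define E where "E p m m' = lookup (P p m) m'" for p m m'
  have E: "(\<lambda>p. E p m m') \<in> \<A>" for m m'
  proof -
    have "(\<lambda>p. lookup (h * f p j) m') \<in> \<A>" if "j \<in> J" for h j m'
      by (rule coefficients_mult_const[OF alg coeffs[OF that]])
    then show ?thesis unfolding E_def P_def lookup_sum by (intro function_algebraD[OF alg]) auto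
  qed
  have "\<exists>D B. D \<in> \<A> \<and> D p0 \<noteq> 0 \<and> (\<forall>i\<in>K. \<forall>j\<in>K. (\<lambda>p. B p j i) \<in> \<A>) \<and>
    (\<forall>p v. \<forall>j\<in>K. D p * v j = (\<Sum>i\<in>K. B p j i * (\<Sum>k\<in>K. E p i k * v k)))"
  proof (rule left_inverse_family[OF alg K K E])
    fix v assume v: "\<And>i. i \<in> K \<Longrightarrow> (\<Sum>j\<in>K. E p0 i j * v j) = 0"
    have "E p0 i j = (if i = j then 1 else 0)" if "i \<in> K" for i j
      using r0[OF that] by (simp add: E_def P_def lookup_single when_def flip: r0[OF that])
    then show "\<forall>j\<in>K. v j = 0" using v K by (simp add: if_distrib[of "\<lambda>x. x * _"] cong: if_cong)
  qed
  then obtain D B where D: "D \<in> \<A>" "D p0 \<noteq> 0"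
    and DB: "\<And>p v j. j \<in> K \<Longrightarrow> D p * v j = (\<Sum>i\<in>K. B p j i * (\<Sum>k\<in>K. E p i k * v k))" by blast
  show ?thesis
  proof (intro bexI[OF _ D(1)] conjI allI impI D(2))
    fix p assume "D p \<noteq> 0"
    show "base_point_free (f p ` J)"
      unfolding base_point_free_def
    proof (intro allI impI)
      fix a assume a: "\<forall>g\<in>f p ` J. peval g a = 0"
      have "(\<Sum>k\<in>K. E p m k * mono_eval k a) = 0" if "m \<in> K" for m
      proof -
        have "keys (P p m) \<subseteq> K" using P_forms[OF that, of p] by (auto simp: forms_def K_def)
        then have "(\<Sum>k\<in>K. E p m k * mono_eval k a) = peval (P p m) a"
          using K by (simp add: E_def peval_superset)
        also have "\<dots> = 0" using a by (simp add: P_def)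
        finally show ?thesis .
      qed
      then have "D p * mono_eval m a = 0" if "m \<in> K" for m
        using DB[OF that, of p "\<lambda>k. mono_eval k a"] by simp
      then have "mono_eval m a = 0" if "m \<in> K" for m using that \<open>D p \<noteq> 0\<close> by simp
      from this[of "single _ n"] have "a i ^ n = 0" for i by (simp add: K_def)
      then show "a = (\<lambda>_. 0)" by (auto simp: n_def)
    qed
  qed
qed

section \<open>Regular sequences of quadrics\<close>

text \<open>A dimension count with bases: \<open>f\<close> sends a complement of \<open>V0\<close>
  injectively into W/W0, and \<open>g\<close> maps V/V0 onto W/W0, so \<open>g\<close> is injective
  as well. Were x outside \<open>V0\<close>, it could be taken into a basis \<open>C\<close> of a
  complement, and \<open>W\<close> would be spanned by fewer vectors than an independent subset of
  it has.\<close>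

lemma (in vector_space) surjective_mod_imp_injective_mod:
  assumes lin: "Vector_Spaces.linear scale scale f" "Vector_Spaces.linear scale scale g"
    and fin: "finite K" "V \<subseteq> span K" "finite L" "W \<subseteq> span L"
    and sub: "subspace V" "subspace V0" "V0 \<subseteq> V" "subspace W" "subspace W0" "W0 \<subseteq> W"
    and f: "f ` V \<subseteq> W" "\<And>x. x \<in> V \<Longrightarrow> f x \<in> W0 \<Longrightarrow> x \<in> V0"
    and g: "g ` V0 \<subseteq> W0" "\<And>y. y \<in> W \<Longrightarrow> \<exists>x\<in>V. y - g x \<in> W0"
    and x: "x \<in> V" "g x \<in> W0"
  shows "x \<in> V0"
proof (rule ccontr)
  interpret f: Vector_Spaces.linear scale scale f by fact
  interpret g: Vector_Spaces.linear scale scale g by fact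
  assume "x \<notin> V0"
  obtain B0 where B0: "B0 \<subseteq> V0" "independent B0" "V0 \<subseteq> span B0" using maximal_independent_subset by blast
  have spB0: "span B0 = V0" using B0 sub by (intro span_subspace)
  have "independent (insert x B0)" using B0 spB0 \<open>x \<notin> V0\<close> by (simp add: independent_insertI)
  moreover have "insert x B0 \<subseteq> V" using x B0 sub by blast
  ultimately obtain B where B: "insert x B0 \<subseteq> B" "B \<subseteq> V" "independent B" "V \<subseteq> span B"
    using maximal_independent_subset_extend[of "insert x B0" V] by blast
  obtain D where D: "D \<subseteq> W0" "independent D" "W0 \<subseteq> span D" using maximal_independent_subset by blast
  have spD: "span D = W0" using D sub by (intro span_subspace)
  have finB: "finite B" using independent_span_bound[OF fin(1) B(3)] B(2) fin(2) by blast
  have finD: "finite D" using independent_span_bound[OF fin(3) D(2)] D(1) sub fin(4) by blast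
  define C where "C = B - B0"
  have C: "finite C" "x \<in> C" "B = B0 \<union> C"
    using finB B x \<open>x \<notin> V0\<close> B0 by (auto simp: C_def)
  have "independent (D \<union> f ` C') \<and> card (D \<union> f ` C') = card D + card C'" if "finite C'" "C' \<subseteq> C" for C'
    using that
  proof (induction C')
    case (insert b C')
    then have IH: "independent (D \<union> f ` C')" "card (D \<union> f ` C') = card D + card C'" by blast+
    have "f b \<notin> span (D \<union> f ` C')"
    proof
      assume "f b \<in> span (D \<union> f ` C')"
      then obtain d c where dc: "f b = d + f c" "d \<in> span D" "c \<in> span C'"
        by (auto simp: span_Un f.span_image)
      have "b \<in> V" "c \<in> V"
        using insert B C_def dc(3) span_minimal[of C' V] sub by blast+
      then have "b - c \<in> V0"
        using dc spD sub by (intro f) (auto simp: f.diff intro: subspace_diff)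
      then have "(b - c) + c \<in> span (B0 \<union> C')"
        using spB0 dc span_mono[of B0 "B0 \<union> C'"] span_mono[of C' "B0 \<union> C'"] by (intro span_add) auto
      moreover have sub': "B0 \<union> C' \<subseteq> B - {b}"
        using insert.hyps insert.prems B(1) by (auto simp: C_def)
      ultimately have "b \<in> span (B - {b})"
        using span_mono[OF sub'] by auto
      then show False using B(3) insert.prems C_def by (auto simp: dependent_def)
    qed
    then have "f b \<notin> D \<union> f ` C'" "independent (insert (f b) (D \<union> f ` C'))"
      using independent_insertI[OF _ IH(1)] span_base[of "f b" "D \<union> f ` C'"] by blast+
    then show ?case using IH insert.hyps finD by simp
  qed (use D in simp)
  from this[of C] C have fC: "independent (D \<union> f ` C)" "card (D \<union> f ` C) = card D + card C" by auto
  let ?S = "D \<union> g ` (C - {x})"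
  have "W \<subseteq> span ?S"
  proof
    fix y assume "y \<in> W"
    then obtain z where z: "z \<in> V" "y - g z \<in> W0" using g by blast
    have "z \<in> span (B0 \<union> C)" using z B C by blast
    then obtain v c where vc: "z = v + c" "v \<in> V0" "c \<in> span C" using spB0 by (auto simp: span_Un)
    have "c \<in> span (insert x (C - {x}))" using C vc by (simp add: insert_absorb)
    then obtain k where k: "c - scale k x \<in> span (C - {x})" unfolding span_breakdown_eq by blast
    have "g (c - scale k x) \<in> span (g ` (C - {x}))" using k by (simp add: g.span_image)
    then have 1: "g (c - scale k x) \<in> span ?S" using span_mono[of "g ` (C - {x})" ?S] by blast
    have W0S: "W0 \<subseteq> span ?S" using spD span_mono[of D ?S] by blast
    have "(y - g z) + g v + scale k (g x) \<in> W0"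
      using sub z vc g x by (intro subspace_add subspace_scale) auto
    from subsetD[OF W0S this] 1
    have "((y - g z) + g v + scale k (g x)) + g (c - scale k x) \<in> span ?S" by (rule span_add)
    also have "((y - g z) + g v + scale k (g x)) + g (c - scale k x) = y"
      by (simp add: vc g.add g.diff g.scale)
    finally show "y \<in> span ?S" .
  qed
  moreover have "C \<subseteq> V" using B(2) by (auto simp: C_def)
  then have "D \<union> f ` C \<subseteq> W" using D(1) sub(6) f(1) by blast
  ultimately have "D \<union> f ` C \<subseteq> span ?S" by blast
  moreover have "finite ?S" using finD C by simp
  ultimately have "card (D \<union> f ` C) \<le> card ?S" using independent_span_bound[OF _ fC(1)] by blast
  also have "\<dots> \<le> card D + card (g ` (C - {x}))" by (rule card_Un_le)
  also have "\<dots> \<le> card D + card (C - {x})" using C by (intro add_left_mono card_image_le) auto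
  also have "\<dots> < card D + card C"
    using C(1,2) by (intro add_strict_left_mono psubset_card_mono) auto
  finally show False using fC by simp
qed

section \<open>Nonzerodivisors modulo homogeneous ideals\<close>

lemma forms_subset_span: "forms n \<subseteq> cvs.span ((\<lambda>m. single m 1) ` {m. mdeg m = n})"
proof
  fix P assume P: "P \<in> forms n"
  have "(\<Sum>m\<in>keys P. cst (lookup P m) * single m 1) \<in> cvs.span ((\<lambda>m. single m 1) ` {m. mdeg m = n})"
    using P by (intro cvs.span_sum cvs.span_scale cvs.span_base) (auto simp: forms_def)
  then show "P \<in> cvs.span ((\<lambda>m. single m 1) ` {m. mdeg m = n})"
    by (subst poly_mapping_sum_single) (simp add: single_eq_cst_mult[of _ "lookup _ _"])
qed

lemma cvs_subspace_ideal_span: "cvs.subspace (ideal_span A)"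
  by (rule cvs.subspaceI) (auto intro: rmod.span_zero rmod.span_add rmod.span_scale)

lemma cvs_linear_mult: "Vector_Spaces.linear (\<lambda>c P. cst c * P) (\<lambda>c P. cst c * P) (\<lambda>P. h * P)"
  by (simp add: Vector_Spaces.linear_iff cvs.vector_space_axioms distrib_left mult.left_commute)

text \<open>Only forms are tested, so the property splits into finite-dimensional statements, one
  for each degree.\<close>

definition nonzerodivisor_mod :: "poly5 set \<Rightarrow> poly5 \<Rightarrow> bool" where
  "nonzerodivisor_mod A g \<longleftrightarrow> (\<forall>n. \<forall>P\<in>forms n. g * P \<in> ideal_span A \<longrightarrow> P \<in> ideal_span A)"

lemma nonzerodivisor_modD: "nonzerodivisor_mod A g \<Longrightarrow> P \<in> forms n \<Longrightarrow> g * P \<in> ideal_span A \<Longrightarrow> P \<in> ideal_span A"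
  by (auto simp: nonzerodivisor_mod_def)

text \<open>In high degrees multiplication by \<open>g\<close> is surjective modulo \<open>A\<close>, hence injective, because
  multiplication by \<open>f\<close> is injective; low degrees are lifted by powers of \<open>f\<close>.\<close>
lemma nonzerodivisor_exchange:
  assumes "0 < d" and A: "homogeneous A" and f: "f \<in> forms d" "nonzerodivisor_mod A f" and g: "g \<in> forms d" "base_point_free (insert g A)"
  shows "nonzerodivisor_mod A g"
proof -
  obtain N where N: "\<And>n P. N \<le> n \<Longrightarrow> P \<in> forms n \<Longrightarrow> P \<in> ideal_span (insert g A)"
    using projective_nullstellensatz[OF g(2)] by blast
  have high: "P \<in> ideal_span A" if n: "N \<le> n" and P: "P \<in> forms n" "g * P \<in> ideal_span A" for n P
  proof -
    have fin: "finite ((\<lambda>m. single m (1::complex)) ` {m :: 5 \<Rightarrow>\<^sub>0 nat. mdeg m = n})" for n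
      by (intro finite_imageI finite_mdeg_eq)
    have fg: "(\<lambda>P. h * P) ` forms n \<subseteq> forms (n + d)" if "h \<in> forms d" for h
      using forms_mult[OF _ that, of _ n] by (auto simp: mult.commute)
    have gP: "g * P \<in> forms (n + d)" using forms_mult[OF P(1) g(1)] by (simp add: mult.commute)
    have "P \<in> forms n \<inter> ideal_span A"
    proof (rule cvs.surjective_mod_imp_injective_mod[OF cvs_linear_mult[of f] cvs_linear_mult[of g]
          fin forms_subset_span fin forms_subset_span,
          where ?V0.0 = "forms n \<inter> ideal_span A" and ?W0.0 = "forms (n + d) \<inter> ideal_span A"])
      show "(\<lambda>P. f * P) ` forms n \<subseteq> forms (n + d)" by (rule fg) fact
      show "x \<in> forms n \<inter> ideal_span A" if "x \<in> forms n" "f * x \<in> forms (n + d) \<inter> ideal_span A" for x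
        using that f nonzerodivisor_modD by blast
      show "(\<lambda>P. g * P) ` (forms n \<inter> ideal_span A) \<subseteq> forms (n + d) \<inter> ideal_span A"
        using fg[OF g(1)] by (auto intro: ideal_span_mult)
      show "\<exists>x\<in>forms n. y - g * x \<in> forms (n + d) \<inter> ideal_span A" if y: "y \<in> forms (n + d)" for y
      proof -
        have "y \<in> ideal_span (insert g A)" using N[OF _ y] n by simp
        then obtain k where k: "k \<in> forms (n + d - d)" "y - k * g \<in> ideal_span A"
          by (rule homogeneous_cofactor[OF A g(1) y]) blast
        moreover have "k * g \<in> forms (n + d)" using forms_mult[OF k(1) g(1)] by simp
        ultimately show ?thesis using forms_diff[OF y] by (intro bexI[of _ k]) (auto simp: mult.commute)
      qed
    qed (use P gP in \<open>auto
        intro: cvs.subspace_inter cvs_subspace_forms cvs_subspace_ideal_span\<close>)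
    then show ?thesis by blast
  qed
  show ?thesis
    unfolding nonzerodivisor_mod_def
  proof (intro allI ballI impI)
    fix n P assume P: "P \<in> forms n" "g * P \<in> ideal_span A"
    show "P \<in> ideal_span A"
    proof -
      have "f ^ N * P \<in> forms (N * d + n)" by (intro forms_mult forms_power f P)
      moreover have "g * (f ^ N * P) \<in> ideal_span A"
        using ideal_span_mult[OF P(2), of "f ^ N"] by (simp add: mult.left_commute)
      moreover have "N \<le> N * d + n" using \<open>0 < d\<close> by (cases d) auto
      ultimately have "f ^ N * P \<in> ideal_span A" using high by blast
      moreover have "f ^ k * P \<in> ideal_span A \<Longrightarrow> P \<in> ideal_span A" for k
      proof (induction k)
        case (Suc k)
        have "f ^ k * P \<in> forms (k * d + n)" by (intro forms_mult forms_power f P)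
        then show ?case using nonzerodivisor_modD[OF f(2)] Suc by (simp add: mult.assoc)
      qed simp
      ultimately show ?thesis by blast
    qed
  qed
qed

lemma forms_cofactor_mult:
  assumes "c \<in> forms (n - d)" "n < d \<Longrightarrow> c = 0" "g \<in> forms d"
  shows "c * g \<in> forms n"
proof (cases "n < d")
  case False
  then show ?thesis using forms_mult[OF assms(1,3)] by simp
qed (use assms in simp)

text \<open>Every subset T is allowed: the notion does not depend on an order, and any entry can be
  exchanged in place.\<close>

definition regular :: "(5 \<Rightarrow> poly5) \<Rightarrow> bool" where
  "regular f \<longleftrightarrow> (\<forall>T k. k \<notin> T \<longrightarrow> nonzerodivisor_mod (f ` T) (f k))"

lemma regularD:
  "regular f \<Longrightarrow> k \<notin> T \<Longrightarrow> P \<in> forms n \<Longrightarrow> f k * P \<in> ideal_span (f ` T) \<Longrightarrow> P \<in> ideal_span (f ` T)"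
  unfolding regular_def nonzerodivisor_mod_def by blast

lemma homogeneous_image: "(\<And>i. f i \<in> forms 2) \<Longrightarrow> homogeneous (f ` T)"
  by (auto simp: homogeneous_def)

text \<open>Descent from the full set of other quadrics, removing one f_j at a time. If gP lies in
  the ideal of T, the result for T and f_j gives P = c f_j modulo T. Cancelling f_j puts gc into the
  ideal, and c has degree smaller by 2.\<close>

lemma nonzerodivisor_mod_subset:
  assumes f: "\<And>i. f i \<in> forms 2" and reg: "regular f" and g: "g \<in> forms 2" and "k \<notin> T"
    and full: "nonzerodivisor_mod (f ` (- {k})) g"
  shows "nonzerodivisor_mod (f ` T) g"
  using \<open>k \<notin> T\<close>
proof (induction "card (- T)" arbitrary: T rule: less_induct)
  case less
  show ?case
  proof (cases "T = - {k}")
    case False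
    then obtain j where j: "j \<notin> T" "j \<noteq> k" using less by auto
    then have "- insert j T \<subset> - T" by auto
    then have "card (- insert j T) < card (- T)" by (intro psubset_card_mono) auto
    then have IH: "nonzerodivisor_mod (f ` insert j T) g" using less.hyps[of "insert j T"] less.prems j by simp
    have "P \<in> ideal_span (f ` T)" if "P \<in> forms n" "g * P \<in> ideal_span (f ` T)" for n P
      using that
    proof (induction n arbitrary: P rule: less_induct)
      case (less n)
      have "g * P \<in> ideal_span (f ` insert j T)"
        using less rmod.span_mono[of "f ` T" "f ` insert j T"] by blast
      then have "P \<in> ideal_span (insert (f j) (f ` T))" using nonzerodivisor_modD[OF IH] less by simp
      then obtain c where c: "c \<in> forms (n - 2)" "n < 2 \<Longrightarrow> c = 0" "P - c * f j \<in> ideal_span (f ` T)"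
        using homogeneous_cofactor[OF homogeneous_image[of f, OF f] f less(2)] by blast
      have "g * P - g * (P - c * f j) \<in> ideal_span (f ` T)"
        by (rule rmod.span_diff[OF less.prems(2) ideal_span_mult[OF c(3)]])
      then have "f j * (g * c) \<in> ideal_span (f ` T)" by (simp add: algebra_simps)
      moreover have "g * c \<in> forms (2 + (n - 2))" using g c by (intro forms_mult)
      ultimately have "g * c \<in> ideal_span (f ` T)" using regularD[OF reg j(1)] by blast
      then have "c \<in> ideal_span (f ` T)"
        using less.IH[of "n - 2" c] c by (cases "n < 2") (auto intro: rmod.span_zero)
      then have "(P - c * f j) + c * f j \<in> ideal_span (f ` T)"
        using c by (intro rmod.span_add ideal_span_mult')
      then show ?case by simp
    qed
    then show ?thesis by (auto simp: nonzerodivisor_mod_def)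
  qed (use full in simp)
qed

text \<open>The new entry g is covered by the dimension count and the descent. For an old f_j modulo
  g and U, read a relation f_j P = b g modulo f_j and U: cancelling g gives b = c f_j modulo U, and
  cancelling f_j then gives P = c g modulo U. This is the permutability of homogeneous regular
  sequences.\<close>

lemma regular_exchange:
  assumes f: "\<And>i. f i \<in> forms 2" and reg: "regular f" and g: "g \<in> forms 2"
    and bpf: "base_point_free (range (f(k := g)))"
  shows "regular (f(k := g))"
proof -
  have "range (f(k := g)) = insert g (f ` (- {k}))" by (auto simp: image_iff)
  with bpf have full: "nonzerodivisor_mod (f ` (- {k})) g"
    using reg by (intro nonzerodivisor_exchange[OF _ homogeneous_image[of f, OF f] f[of k] _ g]) (auto simp: regular_def)
  have A: "nonzerodivisor_mod (f ` T) g" if "k \<notin> T" for T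
    by (rule nonzerodivisor_mod_subset[of f, OF f reg g that full])
  have "nonzerodivisor_mod ((f(k := g)) ` T) ((f(k := g)) j)" if "j \<notin> T" for j T
  proof (cases "k \<in> T")
    case False
    then have *: "(f(k := g)) ` T = f ` T" by auto
    show ?thesis unfolding * using False that A reg by (auto simp: regular_def)
  next
    case True
    define U where "U = T - {k}"
    have T: "(f(k := g)) ` T = insert g (f ` U)" and "j \<noteq> k" using True that by (auto simp: U_def)
    have "P \<in> ideal_span (insert g (f ` U))" if P: "P \<in> forms n" "f j * P \<in> ideal_span (insert g (f ` U))" for n P
    proof -
      have "f j * P \<in> forms (2 + n)" by (intro forms_mult f P)
      then obtain b where b: "b \<in> forms (2 + n - 2)" "f j * P - b * g \<in> ideal_span (f ` U)"
        using homogeneous_cofactor[OF homogeneous_image[of f, OF f] g _ P(2)] by blast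
      have "f j * P - b * g \<in> ideal_span (f ` insert j U)"
        using b rmod.span_mono[of "f ` U" "f ` insert j U"] by auto
      moreover have "P * f j \<in> ideal_span (f ` insert j U)"
        by (intro ideal_span_mult rmod.span_base) simp
      ultimately have "P * f j - (f j * P - b * g) \<in> ideal_span (f ` insert j U)"
        by (rule rmod.span_diff[rotated])
      then have "g * b \<in> ideal_span (f ` insert j U)" by (simp add: algebra_simps)
      then have "b \<in> ideal_span (insert (f j) (f ` U))"
        using nonzerodivisor_modD[OF A[of "insert j U"], of b n] \<open>j \<noteq> k\<close> b by (simp add: U_def)
      then obtain c where c: "c \<in> forms (n - 2)" "n < 2 \<Longrightarrow> c = 0" "b - c * f j \<in> ideal_span (f ` U)"
        using homogeneous_cofactor[OF homogeneous_image[of f, OF f] f, of b n j U] b by auto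
      have "(f j * P - b * g) + (b - c * f j) * g \<in> ideal_span (f ` U)"
        using b c by (intro rmod.span_add ideal_span_mult')
      then have 1: "f j * (P - c * g) \<in> ideal_span (f ` U)" by (simp add: algebra_simps)
      have "c * g \<in> forms n"
        by (rule forms_cofactor_mult[OF c(1,2) g])
      then have "P - c * g \<in> forms n" using P by (intro forms_diff)
      then have "P - c * g \<in> ideal_span (f ` U)"
        using 1 regularD[OF reg, of j U] \<open>j \<notin> T\<close> by (auto simp: U_def)
      then show ?thesis by (auto simp: ideal_span_insert_iff)
    qed
    then show ?thesis using \<open>j \<noteq> k\<close> unfolding T nonzerodivisor_mod_def by auto
  qed
  then show ?thesis by (simp add: regular_def)
qed

section \<open>Socles of quotients under exchange of a quadric\<close>

definition in_socle :: "poly5 set \<Rightarrow> poly5 \<Rightarrow> bool" where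
  "in_socle A P \<longleftrightarrow> (\<forall>i. var i * P \<in> ideal_span A)"

text \<open>The expected socle degree of five quadrics is 5(2 - 1). Dimension at most one is phrased
  as dependence of any two elements modulo the ideal; that the socle is nonzero is derived
  later.\<close>

definition socle_line_deg5 :: "poly5 set \<Rightarrow> bool" where
  "socle_line_deg5 A \<longleftrightarrow>
     (\<forall>n P. P \<in> forms n \<and> in_socle A P \<and> n \<noteq> 5 \<longrightarrow> P \<in> ideal_span A) \<and>
     (\<forall>P Q. P \<in> forms 5 \<and> Q \<in> forms 5 \<and> in_socle A P \<and> in_socle A Q \<longrightarrow>
       (\<exists>\<alpha> \<beta>. (\<alpha> \<noteq> 0 \<or> \<beta> \<noteq> 0) \<and> cst \<alpha> * P + cst \<beta> * Q \<in> ideal_span A))"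

lemma form_eq_sum_var:
  assumes "f \<in> forms (Suc n)"
  shows "f \<in> ideal_span (range var)"
proof -
  have "single m c \<in> ideal_span (range var)" if m: "mdeg m = Suc n" for m :: "5 \<Rightarrow>\<^sub>0 nat" and c :: complex
  proof -
    have "m \<noteq> 0" using m by auto
    then obtain i where "lookup m i \<noteq> 0" by (metis lookup_zero poly_mapping_eqI)
    then have "single m c = single (m - single i 1) c * var i"
      unfolding var_def by (intro single_split) simp
    then show ?thesis by (auto intro: ideal_span_mult rmod.span_base)
  qed
  then have "(\<Sum>m\<in>keys f. single m (lookup f m)) \<in> ideal_span (range var)"
    using assms by (intro rmod.span_sum) (auto simp: forms_def)
  then show ?thesis by (simp flip: poly_mapping_sum_single)
qed

lemma in_socle_mult:
  assumes "in_socle A P" "h \<in> ideal_span (range var)"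
  shows "h * P \<in> ideal_span A"
  using assms(2)
proof (induction rule: rmod.span_induct_alt)
  case (step c x y)
  then obtain i where "x = var i" by auto
  then have "c * (x * P) \<in> ideal_span A" using assms(1) by (auto simp: in_socle_def intro: ideal_span_mult)
  then have "c * (x * P) + y * P \<in> ideal_span A" using step by (intro rmod.span_add)
  then show ?case by (simp add: algebra_simps)
qed (simp add: rmod.span_zero)

text \<open>The correspondence is P' = fP/g modulo \<open>A\<close>. If x_i P = c g modulo
  \<open>A\<close>, then g(x_i P' - c f) vanishes modulo \<open>A\<close>, and cancelling g shows
  that P' is a socle element again. The degree is kept because f and g have the same degree.\<close>

lemma socle_transfer:
  assumes A: "homogeneous A" and f: "f \<in> forms 2" and g: "g \<in> forms 2" "nonzerodivisor_mod A g"
    and P: "P \<in> forms n" "in_socle (insert g A) P"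
  obtains P' where "P' \<in> forms n" "f * P - g * P' \<in> ideal_span A" "in_socle (insert f A) P'"
proof -
  have "f \<in> ideal_span (range var)" using f form_eq_sum_var[of f 1] by (simp add: numeral_2_eq_2)
  then have fP: "f * P \<in> ideal_span (insert g A)" by (rule in_socle_mult[OF P(2)])
  have "f * P \<in> forms (2 + n)" by (intro forms_mult f P)
  then obtain P' where P': "P' \<in> forms (2 + n - 2)" "f * P - P' * g \<in> ideal_span A"
    using homogeneous_cofactor[OF A g(1) _ fP] by blast
  have "var i * P' \<in> ideal_span (insert f A)" for i
  proof -
    have "var i * P \<in> forms (1 + n)" by (intro forms_mult forms_var P)
    moreover have "var i * P \<in> ideal_span (insert g A)" using P by (simp add: in_socle_def)
    ultimately obtain c where c: "c \<in> forms (1 + n - 2)" "1 + n < 2 \<Longrightarrow> c = 0" "var i * P - c * g \<in> ideal_span A"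
      using homogeneous_cofactor[OF A g(1)] by blast
    have "f * (var i * P - c * g) - var i * (f * P - P' * g) \<in> ideal_span A"
      by (rule rmod.span_diff[OF ideal_span_mult[OF c(3)] ideal_span_mult[OF P'(2)]])
    then have 1: "g * (var i * P' - c * f) \<in> ideal_span A" by (simp add: algebra_simps)
    have "c * f \<in> forms (1 + n)"
      by (rule forms_cofactor_mult[OF c(1,2) f])
    moreover have "var i * P' \<in> forms (1 + n)" using P'(1) by (intro forms_mult forms_var) simp
    ultimately have "var i * P' - c * f \<in> forms (1 + n)" by (intro forms_diff)
    with 1 have "var i * P' - c * f \<in> ideal_span A" using g nonzerodivisor_modD by blast
    then show ?thesis by (auto simp: ideal_span_insert_iff)
  qed
  then show thesis using P' by (intro that[of P']) (auto simp: in_socle_def mult.commute)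
qed

text \<open>Injectivity of the correspondence: P' = c f modulo \<open>A\<close> gives f(P - c g) = 0
  modulo \<open>A\<close>, and f cancels.\<close>

lemma socle_transfer_mem:
  assumes A: "homogeneous A" and f: "f \<in> forms 2" "nonzerodivisor_mod A f" and g: "g \<in> forms 2"
    and P: "P \<in> forms n" "P' \<in> forms n" "f * P - g * P' \<in> ideal_span A" "P' \<in> ideal_span (insert f A)"
  shows "P \<in> ideal_span (insert g A)"
proof -
  obtain c where c: "c \<in> forms (n - 2)" "n < 2 \<Longrightarrow> c = 0" "P' - c * f \<in> ideal_span A"
    using homogeneous_cofactor[OF A f(1) P(2,4)] by blast
  have "(f * P - g * P') + g * (P' - c * f) \<in> ideal_span A"
    by (rule rmod.span_add[OF P(3) ideal_span_mult[OF c(3)]])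
  then have 1: "f * (P - c * g) \<in> ideal_span A" by (simp add: algebra_simps)
  have "c * g \<in> forms n" by (rule forms_cofactor_mult[OF c(1,2) g])
  then have "P - c * g \<in> forms n" using P by (intro forms_diff)
  with 1 have "P - c * g \<in> ideal_span A" using f nonzerodivisor_modD by blast
  then show ?thesis by (auto simp: ideal_span_insert_iff)
qed

lemma socle_exchange:
  assumes A: "homogeneous A" and f: "f \<in> forms 2" "nonzerodivisor_mod A f" and g: "g \<in> forms 2" "nonzerodivisor_mod A g"
    and soc: "socle_line_deg5 (insert f A)"
  shows "socle_line_deg5 (insert g A)"
  unfolding socle_line_deg5_def
proof (intro conjI allI impI; elim conjE)
  fix n P assume P: "P \<in> forms n" "in_socle (insert g A) P" "n \<noteq> 5"
  obtain P' where P': "P' \<in> forms n" "f * P - g * P' \<in> ideal_span A" "in_socle (insert f A) P'"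
    using socle_transfer[OF A f(1) g P(1,2)] by blast
  then have "P' \<in> ideal_span (insert f A)" using soc P(3) by (auto simp: socle_line_deg5_def)
  with P' show "P \<in> ideal_span (insert g A)" using socle_transfer_mem[OF A f g(1) P(1)] by blast
next
  fix P Q assume P: "P \<in> forms 5" "in_socle (insert g A) P" and Q: "Q \<in> forms 5" "in_socle (insert g A) Q"
  obtain P' where P': "P' \<in> forms 5" "f * P - g * P' \<in> ideal_span A" "in_socle (insert f A) P'"
    using socle_transfer[OF A f(1) g P(1,2)] by blast
  obtain Q' where Q': "Q' \<in> forms 5" "f * Q - g * Q' \<in> ideal_span A" "in_socle (insert f A) Q'"
    using socle_transfer[OF A f(1) g Q(1,2)] by blast
  obtain \<alpha> \<beta> where ab: "\<alpha> \<noteq> 0 \<or> \<beta> \<noteq> 0" "cst \<alpha> * P' + cst \<beta> * Q' \<in> ideal_span (insert f A)"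
    using soc P' Q' unfolding socle_line_deg5_def by blast
  have "cst \<alpha> * (f * P - g * P') + cst \<beta> * (f * Q - g * Q') \<in> ideal_span A"
    by (rule rmod.span_add[OF ideal_span_mult[OF P'(2)] ideal_span_mult[OF Q'(2)]])
  then have "f * (cst \<alpha> * P + cst \<beta> * Q) - g * (cst \<alpha> * P' + cst \<beta> * Q') \<in> ideal_span A"
    by (simp add: algebra_simps)
  then have "cst \<alpha> * P + cst \<beta> * Q \<in> ideal_span (insert g A)"
    using P(1) Q(1) P'(1) Q'(1) ab(2)
    by (intro socle_transfer_mem[OF A f g(1)]) (auto intro: forms_add forms_cst_mult)
  then show "\<exists>\<alpha> \<beta>. (\<alpha> \<noteq> 0 \<or> \<beta> \<noteq> 0) \<and> cst \<alpha> * P + cst \<beta> * Q \<in> ideal_span (insert g A)"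
    using ab by blast
qed

section \<open>Generic lines and chains of exchanges\<close>

definition polynomial_functions :: "(complex \<Rightarrow> complex) set" where
  "polynomial_functions = range poly"

lemma function_algebra_polynomial: "function_algebra polynomial_functions"
  unfolding function_algebra_def polynomial_functions_def
proof (intro conjI allI ballI)
  show "(\<lambda>_. c) \<in> range poly" for c :: complex by (rule range_eqI[of _ _ "[:c:]"]) auto
  fix f g :: "complex \<Rightarrow> complex" assume "f \<in> range poly" "g \<in> range poly"
  then obtain p q where "f = poly p" "g = poly q" by blast
  then have "(\<lambda>t. f t + g t) = poly (p + q)" "(\<lambda>t. f t * g t) = poly (p * q)" by auto
  then show "(\<lambda>t. f t + g t) \<in> range poly" "(\<lambda>t. f t * g t) \<in> range poly"
    by (metis rangeI)+
qed

lemma polynomial_functions_id: "(\<lambda>t. t) \<in> polynomial_functions"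
  unfolding polynomial_functions_def by (rule range_eqI[of _ _ "[:0, 1:]"]) auto

text \<open>Both ends of a line in projective space avoid a proper closed subset, so some interior
  point does.\<close>
lemma generic_point_on_line:
  assumes "D \<in> polynomial_functions" "D 0 \<noteq> 0" "E \<in> polynomial_functions" "E 0 \<noteq> 0"
  obtains t where "t \<noteq> 0" "D t \<noteq> 0" "E (inverse t) \<noteq> 0"
proof -
  obtain p q where pq: "D = poly p" "E = poly q" using assms by (auto simp: polynomial_functions_def)
  then have "p \<noteq> 0" "q \<noteq> 0" using assms by auto
  then have "finite ({t. poly p t = 0} \<union> inverse ` {t. poly q t = 0} \<union> {0})"
    by (simp add: poly_roots_finite)
  from ex_new_if_finite[OF infinite_UNIV_char_0 this]
  obtain t where t: "t \<notin> {t. poly p t = 0} \<union> inverse ` {t. poly q t = 0} \<union> {0}" by blast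
  have "poly q (inverse t) \<noteq> 0"
  proof
    assume "poly q (inverse t) = 0"
    then have "inverse (inverse t) \<in> inverse ` {t. poly q t = 0}" by (intro imageI) simp
    with t show False by simp
  qed
  with t show thesis by (intro that[of t]) (auto simp: pq)
qed

lemma base_point_free_line:
  fixes f :: "5 \<Rightarrow> poly5"
  assumes f: "\<And>i. f i \<in> forms 2" and g: "g \<in> forms 2" and bpf: "base_point_free (range f)"
  shows "\<exists>D\<in>polynomial_functions. D 0 \<noteq> 0 \<and>
    (\<forall>t. D t \<noteq> 0 \<longrightarrow> base_point_free (range (f(k := f k + cst t * g))))"
proof -
  note alg = function_algebraD[OF function_algebra_polynomial]
  have "(\<lambda>t. lookup ((f(k := f k + cst t * g)) j) m) \<in> polynomial_functions" for j m
    by (cases "j = k") (auto simp: lookup_add intro!: alg polynomial_functions_id)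
  moreover have "(f(k := f k + cst t * g)) j \<in> forms 2" for t j
    using f g by (auto intro: forms_add forms_cst_mult)
  moreover have "f(k := f k + cst 0 * g) = f" by simp
  ultimately show ?thesis
    using elimination[OF function_algebra_polynomial finite, where
        f = "\<lambda>t. f(k := f k + cst t * g)" and ?p0.0 = 0 and d = "\<lambda>_. 2"] bpf by metis
qed

lemma base_point_free_scale:
  fixes f :: "5 \<Rightarrow> poly5"
  assumes "base_point_free (range f)" "c \<noteq> 0"
  shows "base_point_free (range (f(k := cst c * f k)))"
  unfolding base_point_free_def
proof (intro allI impI)
  fix a assume a: "\<forall>h\<in>range (f(k := cst c * f k)). peval h a = 0"
  have "peval (f i) a = 0" for i
    using bspec[OF a, of "(f(k := cst c * f k)) i"] assms(2) by (cases "i = k") auto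
  then show "a = (\<lambda>_. 0)" using assms(1) by (auto simp: base_point_free_def)
qed

text \<open>Any two base point free systems of quadrics are joined by replacing each entry twice.\<close>
lemma exchange_induct:
  fixes a b :: "5 \<Rightarrow> poly5"
  assumes "\<And>i. a i \<in> forms 2" "\<And>i. b i \<in> forms 2"
    and "base_point_free (range a)" "base_point_free (range b)"
    and "\<Phi> a"
    and step: "\<And>f k g. (\<And>i. f i \<in> forms 2) \<Longrightarrow> g \<in> forms 2 \<Longrightarrow>
      base_point_free (range (f(k := g))) \<Longrightarrow> \<Phi> f \<Longrightarrow> \<Phi> (f(k := g))"
  shows "\<Phi> b"
  using assms(1-5)
proof (induction "card {i. a i \<noteq> b i}" arbitrary: a b rule: less_induct)
  case less
  show ?case
  proof (cases "a = b")
    case False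
    then obtain k where k: "a k \<noteq> b k" by blast
    obtain D where D: "D \<in> polynomial_functions" "D 0 \<noteq> 0"
      "\<And>t. D t \<noteq> 0 \<Longrightarrow> base_point_free (range (a(k := a k + cst t * b k)))"
      using base_point_free_line[of a "b k" k] less.prems by blast
    obtain E where E: "E \<in> polynomial_functions" "E 0 \<noteq> 0"
      "\<And>t. E t \<noteq> 0 \<Longrightarrow> base_point_free (range (b(k := b k + cst t * a k)))"
      using base_point_free_line[of b "a k" k] less.prems by blast
    obtain t where t: "t \<noteq> 0" "D t \<noteq> 0" "E (inverse t) \<noteq> 0"
      using generic_point_on_line[OF D(1,2) E(1,2)] by blast
    \<comment> \<open>One quadric serves both systems: it is \<open>a k\<close> plus a multiple of
      \<open>b k\<close> and, up to the scalar t, \<open>b k\<close> plus a multiple of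
      \<open>a k\<close>. Inserted into both, it leaves them differing in one entry less.\<close>
    define u where "u = a k + cst t * b k"
    have u: "u \<in> forms 2" using less.prems by (auto simp: u_def intro: forms_add forms_cst_mult)
    have au: "base_point_free (range (a(k := u)))" using D t by (simp add: u_def)
    have "cst t * (b k + cst (inverse t) * a k) = u"
      using t by (simp add: u_def distrib_left flip: mult.assoc cst_mult)
    with base_point_free_scale[OF E(3)[OF t(3)] t(1), of k]
    have bu: "base_point_free (range (b(k := u)))" by simp
    have "\<Phi> (b(k := u))"
    proof (rule less.hyps)
      have "{i. (a(k := u)) i \<noteq> (b(k := u)) i} \<subset> {i. a i \<noteq> b i}" using k by auto
      then show "card {i. (a(k := u)) i \<noteq> (b(k := u)) i} < card {i. a i \<noteq> b i}"
        by (intro psubset_card_mono) auto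
      show "\<Phi> (a(k := u))" by (rule step) (use less.prems u au in auto)
    qed (use less.prems u au bu in auto)
    then have "\<Phi> ((b(k := u))(k := b k))"
      by (rule step[rotated 3]) (use less.prems u in auto)
    then show ?thesis by simp
  qed (use less in simp)
qed

section \<open>The model system of squares of the variables\<close>

definition sq_vars :: "5 \<Rightarrow> poly5" where
  "sq_vars i = var i ^ 2"

lemma sq_vars_alt: "sq_vars i = single (single i 2) 1"
  by (simp add: sq_vars_def var_def power2_eq_square mult_single numeral_2_eq_2 flip: single_add)

lemma sq_vars_forms: "sq_vars i \<in> forms 2"
  by (simp add: sq_vars_alt forms_single)

text \<open>The ideal is monomial, so membership is decided monomial by monomial.\<close>

lemma ideal_span_sq_vars_iff:
  "P \<in> ideal_span (sq_vars ` T) \<longleftrightarrow> (\<forall>m\<in>keys P. \<exists>i\<in>T. 2 \<le> lookup m i)"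
proof
  assume "P \<in> ideal_span (sq_vars ` T)"
  then show "\<forall>m\<in>keys P. \<exists>i\<in>T. 2 \<le> lookup m i"
  proof (induction rule: rmod.span_induct_alt)
    case (step c x y)
    show ?case
    proof
      fix m assume "m \<in> keys (c * x + y)"
      then consider "m \<in> keys (c * x)" | "m \<in> keys y" using keys_add[of "c * x" y] by blast
      then show "\<exists>i\<in>T. 2 \<le> lookup m i"
      proof cases
        case 1
        obtain i where i: "i \<in> T" "x = sq_vars i" using step by auto
        then obtain l where "m = l + single i 2" using 1 keys_mult[of c x] by (auto simp: sq_vars_alt)
        then show ?thesis using i by (intro bexI[of _ i]) (auto simp: lookup_add)
      qed (use step in auto)
    qed
  qed auto
next
  assume *: "\<forall>m\<in>keys P. \<exists>i\<in>T. 2 \<le> lookup m i"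
  have "single m (lookup P m) \<in> ideal_span (sq_vars ` T)" if "m \<in> keys P" for m
  proof -
    from bspec[OF * that] obtain i where i: "i \<in> T" "2 \<le> lookup m i" by (elim bexE)
    then have "single m (lookup P m) = single (m - single i 2) (lookup P m) * sq_vars i"
      unfolding sq_vars_alt by (intro single_split)
    moreover have "sq_vars i \<in> ideal_span (sq_vars ` T)" using i by (intro rmod.span_base) simp
    ultimately show ?thesis by (simp only: ideal_span_mult)
  qed
  then have "(\<Sum>m\<in>keys P. single m (lookup P m)) \<in> ideal_span (sq_vars ` T)"
    by (intro rmod.span_sum)
  then show "P \<in> ideal_span (sq_vars ` T)" by (simp flip: poly_mapping_sum_single)
qed

lemma keys_single_mult: "l \<in> keys P \<Longrightarrow> m + l \<in> keys (single m (1::complex) * P)"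
  for P :: "'v cpoly"
  by (auto simp: in_keys_iff lookup_single_mult)

lemma regular_sq_vars: "regular sq_vars"
  unfolding regular_def nonzerodivisor_mod_def
proof (intro allI ballI impI)
  fix T :: "5 set" and k n P
  assume k: "k \<notin> T" and P: "sq_vars k * P \<in> ideal_span (sq_vars ` T)"
  show "P \<in> ideal_span (sq_vars ` T)"
    unfolding ideal_span_sq_vars_iff
  proof
    fix m assume "m \<in> keys P"
    then have "single k 2 + m \<in> keys (sq_vars k * P)" unfolding sq_vars_alt by (rule keys_single_mult)
    then obtain i where "i \<in> T" "2 \<le> lookup (single k 2 + m) i"
      using P by (auto simp: ideal_span_sq_vars_iff)
    then show "\<exists>i\<in>T. 2 \<le> lookup m i"
      using k by (intro bexI[of _ i]) (auto simp: lookup_add lookup_single when_def split: if_splits)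
  qed
qed

lemma base_point_free_sq_vars: "base_point_free (range sq_vars)"
  by (auto simp: base_point_free_def sq_vars_def)

text \<open>Squarefree monomials form a basis modulo the squares. Multiplication by x_j kills such a
  monomial only if x_j divides it, so the only one killed by all variables is x_0 x_1 x_2 x_3 x_4,
  with exponent \<open>e\<close>.\<close>

lemma socle_sq_vars: "socle_line_deg5 (range sq_vars)"
proof -
  define e :: "5 \<Rightarrow>\<^sub>0 nat" where "e = (\<Sum>i\<in>UNIV. single i 1)"
  have lookup_e: "lookup e i = 1" for i by (simp add: e_def lookup_sum lookup_single when_def)
  have e: "mdeg e = 5" by (simp add: mdeg_alt lookup_e)
  have key: "m = e \<or> (\<exists>i. 2 \<le> lookup m i)" if "in_socle (range sq_vars) P" "m \<in> keys P" for P m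
  proof (rule ccontr)
    assume *: "\<not> ?thesis"
    have "lookup m j = 1" for j
    proof -
      have "var j * P \<in> ideal_span (range sq_vars)" using that by (simp add: in_socle_def)
      moreover have "single j 1 + m \<in> keys (var j * P)" unfolding var_def by (rule keys_single_mult) fact
      ultimately obtain i where "2 \<le> lookup (single j 1 + m) i"
        unfolding ideal_span_sq_vars_iff by blast
      then have "2 \<le> lookup (single j 1) i + lookup m i" by (simp add: lookup_add)
      moreover have "lookup m l < 2" for l using * by (simp add: not_le)
      from this[of i] this[of j] calculation show ?thesis
        by (cases "i = j") (auto simp: lookup_single_not_eq)
    qed
    then have "m = e" by (intro poly_mapping_eqI) (simp add: lookup_e)
    with * show False by simp
  qed
  show ?thesis
    unfolding socle_line_deg5_def
  proof (intro conjI allI impI; elim conjE)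
    fix n P assume P: "P \<in> forms n" "in_socle (range sq_vars) P" "n \<noteq> 5"
    then have "e \<notin> keys P" using e by (auto simp: forms_def)
    then show "P \<in> ideal_span (range sq_vars)" using key[OF P(2)] by (auto simp: ideal_span_sq_vars_iff)
  next
    fix P Q assume PQ: "in_socle (range sq_vars) P" "in_socle (range sq_vars) Q"
    obtain \<alpha> \<beta> :: complex where ab: "\<alpha> \<noteq> 0 \<or> \<beta> \<noteq> 0" "\<alpha> * lookup P e + \<beta> * lookup Q e = 0"
    proof (cases "lookup P e = 0")
      case False
      then show ?thesis by (intro that[of "lookup Q e" "- lookup P e"]) auto
    qed (use that[of 1 0] in auto)
    have "cst \<alpha> * P + cst \<beta> * Q \<in> ideal_span (range sq_vars)"
      unfolding ideal_span_sq_vars_iff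
    proof
      fix m assume m: "m \<in> keys (cst \<alpha> * P + cst \<beta> * Q)"
      then have "m \<noteq> e" using ab by (auto simp: in_keys_iff lookup_add)
      moreover have "m \<in> keys P \<or> m \<in> keys Q" using m by (auto simp: in_keys_iff lookup_add)
      ultimately show "\<exists>i\<in>UNIV. 2 \<le> lookup m i" using key PQ by blast
    qed
    with ab show "\<exists>\<alpha> \<beta>. (\<alpha> \<noteq> 0 \<or> \<beta> \<noteq> 0) \<and> cst \<alpha> * P + cst \<beta> * Q \<in> ideal_span (range sq_vars)" by blast
  qed
qed

text \<open>Regularity and the socle travel together along the chain of exchanges, since the socle
  transfer needs the old and the new quadric to be nonzerodivisors modulo the other four.\<close>

theorem base_point_free_quadrics:
  assumes "\<And>i. f i \<in> forms 2" "base_point_free (range f)"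
  shows "regular f \<and> socle_line_deg5 (range f)"
proof (rule exchange_induct[of sq_vars f])
  show "regular sq_vars \<and> socle_line_deg5 (range sq_vars)"
    by (simp add: regular_sq_vars socle_sq_vars)
  fix f :: "5 \<Rightarrow> poly5" and k g
  assume f: "\<And>i. f i \<in> forms 2" and g: "g \<in> forms 2" "base_point_free (range (f(k := g)))"
    and IH: "regular f \<and> socle_line_deg5 (range f)"
  let ?A = "f ` (- {k})"
  have reg: "regular (f(k := g))" using regular_exchange[of f, OF f _ g] IH by blast
  have r: "range f = insert (f k) ?A" "range (f(k := g)) = insert g ?A" by (auto simp: image_iff)
  have "nonzerodivisor_mod ?A (f k)" using IH by (simp add: regular_def)
  moreover have "(f(k := g)) ` (- {k}) = ?A" by auto
  then have "nonzerodivisor_mod ?A g" using reg by (metis fun_upd_same regular_def ComplD singletonI)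
  ultimately have "socle_line_deg5 (range (f(k := g)))"
    using socle_exchange[OF homogeneous_image[of f, OF f] f[of k] _ g(1), of "- {k}"] IH r by metis
  with reg show "regular (f(k := g)) \<and> socle_line_deg5 (range (f(k := g)))" ..
qed (use assms sq_vars_forms base_point_free_sq_vars in auto)

section \<open>Partial derivatives and the polar pairing\<close>

lemma lookup_pd: "lookup (pd i P) l = of_nat (lookup l i + 1) * lookup P (l + single i 1)"
proof -
  have "lookup (pd i P) l = (\<Sum>m\<in>keys P. if m = l + single i 1 then of_nat (lookup l i + 1) * lookup P m else 0)"
    unfolding pd_def lookup_sum
  proof (rule sum.cong)
    fix m
    \<comment> \<open>The middle case is where truncated subtraction could hit l by accident; the
      coefficient vanishes there.\<close>
    consider "m = l + single i 1" | "m \<noteq> l + single i 1" "lookup m i = 0" | "m \<noteq> l + single i 1" "1 \<le> lookup m i"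
      by linarith
    then show "lookup (single (m - single i 1) (of_nat (lookup m i) * lookup P m)) l =
        (if m = l + single i 1 then of_nat (lookup l i + 1) * lookup P m else 0)"
    proof cases
      case 3
      then have "m - single i 1 + single i 1 = m"
        by (intro poly_mapping_eqI) (auto simp: lookup_add lookup_minus lookup_single when_def)
      then have "m - single i 1 \<noteq> l" using 3 by auto
      then show ?thesis using 3 by (simp add: lookup_single_not_eq)
    qed (simp_all add: lookup_add)
  qed simp
  also have "\<dots> = of_nat (lookup l i + 1) * lookup P (l + single i 1)"
    by (simp add: in_keys_iff)
  finally show ?thesis .
qed

lemma pd_add: "pd i (P + Q) = pd i P + pd i Q"
  by (rule poly_mapping_eqI) (simp add: lookup_pd lookup_add algebra_simps)

lemma pd_cst_mult: "pd i (cst c * P) = cst c * pd i P"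
  by (rule poly_mapping_eqI) (simp add: lookup_pd)

lemma pd_0 [simp]: "pd i 0 = 0"
  by (simp add: pd_def)

lemma pd_forms: "P \<in> forms (Suc k) \<Longrightarrow> pd i P \<in> forms k"
  by (auto simp: forms_iff lookup_pd)

text \<open>The zero form is excluded on the right because its derivatives vanish
  everywhere.\<close>

lemma smooth_form_iff: "smooth_form F \<longleftrightarrow> base_point_free (range (\<lambda>i. pd i F))"
proof -
  have "\<not> base_point_free (range (\<lambda>i. pd i 0))"
    by (auto simp: base_point_free_def fun_eq_iff intro!: exI[of _ "\<lambda>_. 1"])
  then show ?thesis by (auto simp: smooth_form_def base_point_free_def)
qed

lemma jacobian_part_eq: "jacobian_part F k = ideal_span (range (\<lambda>i. pd i F)) \<inter> forms k"
  by (simp add: jacobian_part_def jacobian_ideal_def)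

lemma lookup_pd_power:
  "lookup ((pd i ^^ k) P) m = fact (lookup m i + k) / fact (lookup m i) * lookup P (m + single i k)"
proof (induction k arbitrary: m)
  case (Suc k)
  have "lookup ((pd i ^^ Suc k) P) m = of_nat (lookup m i + 1) * lookup ((pd i ^^ k) P) (m + single i 1)"
    by (simp add: lookup_pd)
  also have "\<dots> = of_nat (lookup m i + 1) * (fact (lookup m i + 1 + k) / fact (lookup m i + 1)) * lookup P (m + single i (Suc k))"
    by (simp add: Suc lookup_add add.assoc flip: single_add)
  also have "of_nat (lookup m i + 1) * (fact (lookup m i + 1 + k) / fact (lookup m i + 1)) =
      (fact (lookup m i + Suc k) / fact (lookup m i) :: complex)"
    by (simp add: fact_Suc del: of_nat_Suc)
  finally show ?case .
qed simp

lemma UNIV_5: "(UNIV :: 5 set) = {0, 1, 2, 3, 4}"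
proof -
  have "card {0, 1, 2, 3, 4 :: 5} = card (UNIV :: 5 set)" by simp
  then show ?thesis by (metis card_subset_eq finite subset_UNIV)
qed

definition mfact :: "(5 \<Rightarrow>\<^sub>0 nat) \<Rightarrow> complex" where
  "mfact n = (\<Prod>i\<in>UNIV. fact (lookup n i))"

lemma mfact_nonzero [simp]: "mfact n \<noteq> 0"
  by (simp add: mfact_def)

lemma lookup_foldr_pd:
  assumes "distinct is" "\<forall>i\<in>set is. lookup m i = 0"
  shows "lookup (foldr (\<lambda>i. pd i ^^ lookup n i) is F) m =
    (\<Prod>i\<in>set is. fact (lookup n i)) * lookup F (m + (\<Sum>i\<in>set is. single i (lookup n i)))"
  using assms
proof (induction "is" arbitrary: m)
  case (Cons i "is")
  then have "\<forall>j\<in>set is. lookup (m + single i (lookup n i)) j = 0"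
    by (auto simp: lookup_add lookup_single when_def)
  with Cons show ?case by (simp add: lookup_pd_power add.assoc)
qed simp

text \<open>The pairing is diagonal in the monomial basis with nonzero weights, which is the source
  of its nondegeneracy on cubics.\<close>

lemma polar_pairing_eq:
  assumes "G \<in> forms 3"
  shows "polar_pairing F G = (\<Sum>n | mdeg n = 3. mfact n * lookup F n * lookup G n)"
proof -
  have set5: "set [0, 1, 2, 3, 4] = (UNIV :: 5 set)" by (simp add: UNIV_5)
  have sum_single: "(\<Sum>i\<in>UNIV. single i (lookup n i)) = n" for n :: "5 \<Rightarrow>\<^sub>0 nat"
    by (rule poly_mapping_eqI) (simp add: lookup_sum lookup_single when_def)
  have "lookup (foldr (\<lambda>i. pd i ^^ lookup n i) [0, 1, 2, 3, 4] F) 0 = mfact n * lookup F n" for n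
    using lookup_foldr_pd[of "[0, 1, 2, 3, 4]" 0 n F] unfolding set5 sum_single
    by (simp add: mfact_def)
  then have "polar_pairing F G = (\<Sum>n\<in>keys G. mfact n * lookup F n * lookup G n)"
    unfolding polar_pairing_def diff_op_def const5_eq_cst lookup_sum lookup_cst_mult
    by (simp add: mult_ac)
  also have "\<dots> = (\<Sum>n | mdeg n = 3. mfact n * lookup F n * lookup G n)"
    using assms by (intro sum.mono_neutral_left finite_mdeg_eq) (auto simp: forms_def in_keys_iff)
  finally show ?thesis .
qed

section \<open>Linear functionals on forms\<close>

definition linear_functional :: "(poly5 \<Rightarrow> complex) \<Rightarrow> bool" where
  "linear_functional \<phi> \<longleftrightarrow> (\<forall>P Q. \<phi> (P + Q) = \<phi> P + \<phi> Q) \<and> (\<forall>c P. \<phi> (cst c * P) = c * \<phi> P)"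

lemma linear_functionalD:
  assumes "linear_functional \<phi>"
  shows "\<phi> (P + Q) = \<phi> P + \<phi> Q" "\<phi> (cst c * P) = c * \<phi> P" "\<phi> 0 = 0"
    "\<phi> (P - Q) = \<phi> P - \<phi> Q" "\<phi> (sum h A) = (\<Sum>x\<in>A. \<phi> (h x))"
proof -
  show add: "\<phi> (P + Q) = \<phi> P + \<phi> Q" for P Q using assms by (simp add: linear_functional_def)
  show scale: "\<phi> (cst c * P) = c * \<phi> P" for c P using assms by (simp add: linear_functional_def)
  show zero: "\<phi> 0 = 0" using scale[of 0 0] by simp
  have "\<phi> (P - Q) + \<phi> Q = \<phi> P" using add[of "P - Q" Q] by simp
  then show "\<phi> (P - Q) = \<phi> P - \<phi> Q" by (simp add: algebra_simps)
  show "\<phi> (sum h A) = (\<Sum>x\<in>A. \<phi> (h x))"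
    by (induction A rule: infinite_finite_induct) (auto simp: add zero)
qed

lemma linear_functional_polar_pairing:
  "G \<in> forms 3 \<Longrightarrow> linear_functional (\<lambda>F. polar_pairing F G)"
  by (simp add: linear_functional_def polar_pairing_eq lookup_add sum.distrib distrib_left distrib_right
      sum_distrib_left) (simp add: mult_ac)

lemma form_expand:
  assumes "P \<in> forms n"
  shows "P = (\<Sum>m | mdeg m = n. cst (lookup P m) * single m 1)"
proof -
  have "P = (\<Sum>m\<in>keys P. cst (lookup P m) * single m 1)"
    by (subst poly_mapping_sum_single) (simp add: single_eq_cst_mult[of _ "lookup _ _"])
  also have "\<dots> = (\<Sum>m | mdeg m = n. cst (lookup P m) * single m 1)"
    using assms by (intro sum.mono_neutral_left finite_mdeg_eq) (auto simp: forms_def in_keys_iff)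
  finally show ?thesis .
qed

lemma polar_pairing_single:
  "G \<in> forms 3 \<Longrightarrow> mdeg m = 3 \<Longrightarrow> polar_pairing (single m 1) G = mfact m * lookup G m"
  using finite_mdeg_eq[where ?'v = 5 and d = 3]
  by (simp add: polar_pairing_eq lookup_single when_def if_distrib[of "\<lambda>x. _ * x * _"] cong: if_cong)

lemma functional_represented:
  assumes "linear_functional \<phi>"
  obtains C where "C \<in> forms 3" "\<And>b. b \<in> forms 3 \<Longrightarrow> polar_pairing b C = \<phi> b"
proof
  define C where "C = (\<Sum>m | mdeg m = 3. single m (\<phi> (single m 1) / mfact m))"
  show C: "C \<in> forms 3" unfolding C_def by (intro forms_sum forms_single) simp
  have lookup_C: "lookup C m = \<phi> (single m 1) / mfact m" if "mdeg m = 3" for m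
    using that finite_mdeg_eq[where ?'v = 5 and d = 3] by (simp add: C_def lookup_sum lookup_single when_def)
  fix b assume "b \<in> forms 3"
  note lin = linear_functionalD[OF assms]
  have "\<phi> b = (\<Sum>m | mdeg m = 3. lookup b m * \<phi> (single m 1))"
    by (subst form_expand[OF \<open>b \<in> forms 3\<close>]) (simp add: lin)
  also have "\<dots> = polar_pairing b C" unfolding polar_pairing_eq[OF C]
    by (intro sum.cong) (auto simp: lookup_C)
  finally show "polar_pairing b C = \<phi> b" ..
qed

text \<open>Induction on the kernel of one functional gives the combination there; a multiple of
  that functional, fitted at a single vector outside the kernel, corrects it. Working relative to a
  subspace lets the induction pass to kernels.\<close>

lemma functional_in_span:
  assumes "finite I" "cvs.subspace V" and \<phi>: "linear_functional \<phi>"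
    and \<psi>: "\<And>i. i \<in> I \<Longrightarrow> linear_functional (\<psi> i)"
    and "\<And>x. x \<in> V \<Longrightarrow> (\<And>i. i \<in> I \<Longrightarrow> \<psi> i x = 0) \<Longrightarrow> \<phi> x = 0"
  shows "\<exists>c. \<forall>x\<in>V. \<phi> x = (\<Sum>i\<in>I. c i * \<psi> i x)"
  using assms(1,2,4,5)
proof (induction I arbitrary: V)
  case (insert j I)
  define V' where "V' = {x \<in> V. \<psi> j x = 0}"
  note linj = linear_functionalD[OF insert.prems(2)[OF insertI1]]
  note lin\<phi> = linear_functionalD[OF \<phi>]
  have "cvs.subspace V'"
    using insert.prems(1) by (auto simp: V'_def cvs.subspace_def linj)
  moreover have "\<phi> x = 0" if "x \<in> V'" "\<And>i. i \<in> I \<Longrightarrow> \<psi> i x = 0" for x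
    using that by (intro insert.prems(3)) (auto simp: V'_def)
  ultimately obtain c where c: "\<And>x. x \<in> V' \<Longrightarrow> \<phi> x = (\<Sum>i\<in>I. c i * \<psi> i x)"
    using insert.IH insert.prems(2) by blast
  show ?case
  proof (cases "\<exists>y\<in>V. \<psi> j y \<noteq> 0")
    case False
    then have "V' = V" by (auto simp: V'_def)
    then show ?thesis using insert.hyps False c
      by (intro exI[of _ c]) simp
  next
    case True
    then obtain y where y: "y \<in> V" "\<psi> j y \<noteq> 0" by blast
    define d where "d = (\<phi> y - (\<Sum>i\<in>I. c i * \<psi> i y)) / \<psi> j y"
    have "\<phi> x = (\<Sum>i\<in>insert j I. (c(j := d)) i * \<psi> i x)" if "x \<in> V" for x
    proof -
      define t where "t = \<psi> j x / \<psi> j y"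
      have "x - cst t * y \<in> V'"
        using that y insert.prems(1)
        by (auto simp: V'_def linj t_def intro: cvs.subspace_diff cvs.subspace_scale)
      then have "\<phi> (x - cst t * y) = (\<Sum>i\<in>I. c i * \<psi> i (x - cst t * y))" by (rule c)
      moreover have "\<phi> (x - cst t * y) = \<phi> x - t * \<phi> y" by (simp add: lin\<phi>)
      moreover have "\<psi> i (x - cst t * y) = \<psi> i x - t * \<psi> i y" if "i \<in> I" for i
        using linear_functionalD(2,4)[OF insert.prems(2)[of i]] that by simp
      ultimately have "\<phi> x - t * \<phi> y = (\<Sum>i\<in>I. c i * (\<psi> i x - t * \<psi> i y))" by simp
      then have "\<phi> x = (\<Sum>i\<in>I. c i * \<psi> i x) + t * (\<phi> y - (\<Sum>i\<in>I. c i * \<psi> i y))"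
        by (simp add: sum_subtractf sum_distrib_left algebra_simps)
      also have "t * (\<phi> y - (\<Sum>i\<in>I. c i * \<psi> i y)) = d * \<psi> j x"
        using y by (simp add: t_def d_def)
      also have "(\<Sum>i\<in>I. c i * \<psi> i x) = (\<Sum>i\<in>I. (c(j := d)) i * \<psi> i x)"
        using insert.hyps by (intro sum.cong) auto
      finally show ?thesis using insert.hyps by simp
    qed
    then show ?thesis by blast
  qed
qed simp

text \<open>A functional vanishing on the kernel of another is a multiple of it; the nonzero weights
  turn this into proportionality of cubics.\<close>

lemma perp_kernel:
  assumes C: "C \<in> forms 3"
  shows "perp {b \<in> forms 3. polar_pairing b C = 0} = range (\<lambda>c. const5 c * C)"
proof
  show "range (\<lambda>c. const5 c * C) \<subseteq> perp {b \<in> forms 3. polar_pairing b C = 0}"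
  proof
    fix a assume "a \<in> range (\<lambda>c. const5 c * C)"
    then obtain c where a: "a = cst c * C" by (auto simp: const5_eq_cst)
    have "polar_pairing b a = c * polar_pairing b C" for b
      using C by (simp add: a polar_pairing_eq forms_cst_mult sum_distrib_left) (simp add: mult_ac)
    then show "a \<in> perp {b \<in> forms 3. polar_pairing b C = 0}"
      using C by (auto simp: perp_def a forms_cst_mult)
  qed
  show "perp {b \<in> forms 3. polar_pairing b C = 0} \<subseteq> range (\<lambda>c. const5 c * C)"
  proof
    fix a assume "a \<in> perp {b \<in> forms 3. polar_pairing b C = 0}"
    then have a: "a \<in> forms 3" "\<And>b. b \<in> forms 3 \<Longrightarrow> polar_pairing b C = 0 \<Longrightarrow> polar_pairing b a = 0"
      by (auto simp: perp_def)
    obtain c where c: "\<And>b. b \<in> forms 3 \<Longrightarrow> polar_pairing b a = (\<Sum>i\<in>{()}. c i * polar_pairing b C)"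
      using functional_in_span[of "{()}" "forms 3" "\<lambda>b. polar_pairing b a" "\<lambda>_ b. polar_pairing b C"]
        a C cvs_subspace_forms linear_functional_polar_pairing by blast
    have "lookup a m = c () * lookup C m" for m
    proof (cases "mdeg m = 3")
      case True
      then have "mfact m * lookup a m = mfact m * (c () * lookup C m)"
        using c[of "single m 1"] by (simp add: forms_single polar_pairing_single a C mult_ac)
      then show ?thesis by (simp only: mult_cancel_left mfact_nonzero simp_thms)
    next
      case False
      then have "lookup a m = 0" "lookup C m = 0" using a(1) C unfolding forms_iff by blast+
      then show ?thesis by simp
    qed
    then have "a = const5 (c ()) * C"
      by (intro poly_mapping_eqI) (simp add: const5_eq_cst)
    then show "a \<in> range (\<lambda>c. const5 c * C)" by blast
  qed
qed

section \<open>Macaulay duality\<close>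

lemma ideal_span_cst_mult_cancel:
  assumes "c \<noteq> 0" "cst c * P \<in> ideal_span A"
  shows "P \<in> ideal_span A"
proof -
  have "cst (inverse c) * (cst c * P) = cst (inverse c * c) * P" by (simp only: cst_mult mult.assoc)
  then show ?thesis using ideal_span_mult[OF assms(2), of "cst (inverse c)"] assms(1) by simp
qed

lemma peval_form_zero: "P \<in> forms n \<Longrightarrow> 0 < n \<Longrightarrow> peval P (\<lambda>_. 0) = 0"
  using peval_form_scale[of P n 0 "\<lambda>_. 0"] by (simp add: power_0_left)

text \<open>\<rho> reads off the coefficient of a socle generator \<open>e\<close> in degree 5. For
  nondegeneracy, a cubic outside the ideal is not in the socle, so it can be multiplied by variables
  while staying outside, until degree 5 is reached.\<close>

lemma macaulay_duality:
  fixes f :: "5 \<Rightarrow> poly5"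
  assumes f: "\<And>i. f i \<in> forms 2" and bpf: "base_point_free (range f)"
  obtains \<rho> where "linear_functional \<rho>"
    and "\<And>P. P \<in> forms 5 \<Longrightarrow> \<rho> P = 0 \<longleftrightarrow> P \<in> ideal_span (range f)"
    and "\<And>b. b \<in> forms 3 \<Longrightarrow> (\<And>Q. Q \<in> forms 2 \<Longrightarrow> \<rho> (b * Q) = 0) \<Longrightarrow> b \<in> ideal_span (range f)"
proof -
  let ?I = "ideal_span (range f)"
  have soc: "\<And>n P. P \<in> forms n \<Longrightarrow> in_socle (range f) P \<Longrightarrow> n \<noteq> 5 \<Longrightarrow> P \<in> ?I"
    and soc5: "\<And>P Q. P \<in> forms 5 \<Longrightarrow> Q \<in> forms 5 \<Longrightarrow> in_socle (range f) P \<Longrightarrow> in_socle (range f) Q \<Longrightarrow>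
       \<exists>\<alpha> \<beta>. (\<alpha> \<noteq> 0 \<or> \<beta> \<noteq> 0) \<and> cst \<alpha> * P + cst \<beta> * Q \<in> ?I"
    using base_point_free_quadrics[of f, OF f bpf] unfolding socle_line_deg5_def by blast+
  have var_mult: "var i * P \<in> forms (Suc n)" if "P \<in> forms n" for i P n
    using forms_mult[OF forms_var that] by simp
  obtain N where N: "\<And>n P. N \<le> n \<Longrightarrow> P \<in> forms n \<Longrightarrow> P \<in> ?I"
    using projective_nullstellensatz[OF bpf] by blast
  \<comment> \<open>Downward induction from the Nullstellensatz bound: if all forms of degree n + 1
    lie in the ideal, those of degree n are socle elements, which are trivial above degree
    5.\<close>
  have top: "P \<in> ?I" if "P \<in> forms n" "6 \<le> n" for n P
    using that
  proof (induction "N - n" arbitrary: n P rule: less_induct)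
    case less
    show ?case
    proof (cases "N \<le> n")
      case False
      have "var i * P \<in> ?I" for i
        by (rule less.hyps[of "Suc n"]) (use False less.prems var_mult in auto)
      then show ?thesis using soc[OF less.prems(1)] less.prems(2) by (auto simp: in_socle_def)
    qed (use N less in blast)
  qed
  have climb: "\<exists>R\<in>forms (5 - n). R * P \<notin> ?I" if "P \<in> forms n" "P \<notin> ?I" "n \<le> 5" for n P
    using that
  proof (induction "5 - n" arbitrary: n P rule: less_induct)
    case less
    show ?case
    proof (cases "n = 5")
      case True
      then show ?thesis using less.prems forms_1 by (intro bexI[of _ 1]) auto
    next
      case False
      then obtain i where "var i * P \<notin> ?I" using soc less.prems by (auto simp: in_socle_def)
      moreover have "5 - Suc n < 5 - n" "Suc n \<le> 5" using less.prems(3) False by auto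
      ultimately obtain R where R: "R \<in> forms (5 - Suc n)" "R * (var i * P) \<notin> ?I"
        using less.hyps[OF _ var_mult[OF less.prems(1)], of i] by blast
      have "5 - Suc n + 1 = 5 - n" using less.prems(3) False by auto
      with forms_mult[OF R(1) forms_var] have "R * var i \<in> forms (5 - n)" by metis
      then show ?thesis using R by (intro bexI[of _ "R * var i"]) (auto simp: mult.assoc)
    qed
  qed
  have "1 \<notin> ?I"
  proof
    assume "1 \<in> ?I"
    then have "peval (1 :: poly5) (\<lambda>_. 0) = 0"
      by (rule ideal_span_vanish) (use peval_form_zero[OF f] in auto)
    then show False by simp
  qed
  \<comment> \<open>Climbing from the constant 1 shows that the ideal does not contain all quintics,
    so the socle is exactly a line.\<close>
  then obtain e where e: "e \<in> forms 5" "e \<notin> ?I"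
    using climb[of 1 0] forms_1 by auto
  have socle5: "in_socle (range f) P" if "P \<in> forms 5" for P
    using top[of _ 6] var_mult[OF that] by (auto simp: in_socle_def)
  have ex: "\<exists>c. P - cst c * e \<in> ?I" if P: "P \<in> forms 5" for P
  proof -
    obtain \<alpha> \<beta> where ab: "\<alpha> \<noteq> 0 \<or> \<beta> \<noteq> 0" "cst \<alpha> * P + cst \<beta> * e \<in> ?I"
      using soc5[OF P e(1)] socle5 P e by blast
    have "\<alpha> \<noteq> 0" using ab e ideal_span_cst_mult_cancel[of \<beta> e] by auto
    have "cst \<alpha> * (P - cst (- (\<beta> / \<alpha>)) * e) = cst \<alpha> * P - cst (\<alpha> * - (\<beta> / \<alpha>)) * e"
      by (simp only: right_diff_distrib cst_mult mult.assoc)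
    also have "\<dots> = cst \<alpha> * P + cst \<beta> * e" using \<open>\<alpha> \<noteq> 0\<close> by (simp add: cst_uminus)
    finally have "cst \<alpha> * (P - cst (- (\<beta> / \<alpha>)) * e) \<in> ?I" using ab by (simp only:)
    from ideal_span_cst_mult_cancel[OF \<open>\<alpha> \<noteq> 0\<close> this]
    have "P - cst (- (\<beta> / \<alpha>)) * e \<in> ?I" .
    then show ?thesis by blast
  qed
  have uniq: "c = d" if "P - cst c * e \<in> ?I" "P - cst d * e \<in> ?I" for P c d
  proof (rule ccontr)
    assume "c \<noteq> d"
    have "(P - cst c * e) - (P - cst d * e) = cst (d - c) * e" by (simp add: cst_diff algebra_simps)
    then have "cst (d - c) * e \<in> ?I" using rmod.span_diff[OF that] by simp
    then show False using \<open>c \<noteq> d\<close> e ideal_span_cst_mult_cancel[of "d - c" e] by auto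
  qed
  \<comment> \<open>Projecting to degree 5 makes \<rho> linear on all polynomials.\<close>
  define \<rho> where "\<rho> P = (THE c. hcomp 5 P - cst c * e \<in> ?I)" for P
  have \<rho>: "hcomp 5 P - cst (\<rho> P) * e \<in> ?I" for P
    unfolding \<rho>_def by (rule theI', rule ex_ex1I[OF ex[OF hcomp_in_forms] uniq])
  have \<rho>_eq: "\<rho> P = c" if "hcomp 5 P - cst c * e \<in> ?I" for P c
    using uniq[OF \<rho> that] .
  have zero: "\<rho> P = 0 \<longleftrightarrow> P \<in> ?I" if "P \<in> forms 5" for P
    using \<rho>[of P] \<rho>_eq[of P 0] that by (auto simp: hcomp_form)
  have lin: "linear_functional \<rho>"
    unfolding linear_functional_def
  proof (intro conjI allI)
    fix P Q
    have "(hcomp 5 P - cst (\<rho> P) * e) + (hcomp 5 Q - cst (\<rho> Q) * e) \<in> ?I"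
      by (intro rmod.span_add \<rho>)
    then show "\<rho> (P + Q) = \<rho> P + \<rho> Q"
      by (intro \<rho>_eq) (simp add: hcomp_add cst_add algebra_simps)
  next
    fix c P
    have "hcomp 5 (cst c * P) = cst c * hcomp 5 P"
      by (rule poly_mapping_eqI) (simp add: lookup_hcomp)
    moreover have "cst c * (hcomp 5 P - cst (\<rho> P) * e) \<in> ?I" by (intro ideal_span_mult \<rho>)
    ultimately show "\<rho> (cst c * P) = c * \<rho> P"
      by (intro \<rho>_eq) (simp add: cst_mult algebra_simps)
  qed
  show thesis
  proof (rule that[OF lin zero])
    fix b assume b: "b \<in> forms 3" "\<And>Q. Q \<in> forms 2 \<Longrightarrow> \<rho> (b * Q) = 0"
    show "b \<in> ?I"
    proof (rule ccontr)
      assume "b \<notin> ?I"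
      then obtain R where R: "R \<in> forms (5 - 3)" "R * b \<notin> ?I" using climb[OF b(1)] by auto
      then have "b * R \<in> forms 5" using forms_mult[OF b(1), of R 2] by simp
      then show False using zero[of "b * R"] b(2)[of R] R by (simp add: mult.commute)
    qed
  qed
qed

section \<open>A Bertini theorem for diagonal quadrics\<close>

lemma peval_UNIV: "peval P a = (\<Sum>m\<in>keys P. lookup P m * (\<Prod>i\<in>UNIV. a i ^ lookup m i))"
  for P :: poly5
  by (simp add: peval_alt mono_eval_superset[of UNIV])

lemma peval_line:
  assumes "P \<in> forms k"
  obtains p where "degree p \<le> k" "\<And>t. poly p t = peval P (\<lambda>i. x i + t * v i)"
proof
  let ?M = "\<lambda>m. \<Prod>i\<in>UNIV. [:x i, v i:] ^ lookup m i"
  have "degree (?M m) \<le> mdeg m" for m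
  proof -
    have "degree (?M m) \<le> (\<Sum>i\<in>UNIV. degree ([:x i, v i:] ^ lookup m i))"
      using degree_prod_sum_le[of UNIV "\<lambda>i. [:x i, v i:] ^ lookup m i"] by (simp add: o_def)
    also have "\<dots> \<le> (\<Sum>i\<in>UNIV. lookup m i)"
    proof (rule sum_mono)
      fix i
      have "degree ([:x i, v i:] ^ lookup m i) \<le> degree [:x i, v i:] * lookup m i" by (rule degree_power_le)
      also have "\<dots> \<le> 1 * lookup m i" by (intro mult_right_mono) auto
      finally show "degree ([:x i, v i:] ^ lookup m i) \<le> lookup m i" by simp
    qed
    finally show ?thesis by (simp add: mdeg_alt)
  qed
  then show "degree (\<Sum>m\<in>keys P. smult (lookup P m) (?M m)) \<le> k"
    using assms by (intro degree_sum_le) (auto simp: forms_def intro: order.trans[OF degree_smult_le])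
  show "poly (\<Sum>m\<in>keys P. smult (lookup P m) (?M m)) t = peval P (\<lambda>i. x i + t * v i)" for t
    by (simp add: poly_sum poly_prod peval_UNIV mult.commute)
qed

text \<open>The coefficient of t^k along the line is P(v), so the restriction \<open>p\<close> is
  not zero. This is seen by reversal: u^k p(1/u) agrees for nonzero u with q(u) = P(v + u x), and
  q(0) = P(v).\<close>

lemma peval_line_roots:
  assumes P: "P \<in> forms k" and v: "peval P v \<noteq> 0"
  shows "finite {t. peval P (\<lambda>i. x i + t * v i) = 0} \<and> card {t. peval P (\<lambda>i. x i + t * v i) = 0} \<le> k"
proof -
  obtain p where p: "degree p \<le> k" "\<And>t. poly p t = peval P (\<lambda>i. x i + t * v i)"
    using peval_line[OF P] by blast
  obtain q where q: "\<And>t. poly q t = peval P (\<lambda>i. v i + t * x i)"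
    using peval_line[OF P] by blast
  have "p \<noteq> 0"
  proof
    assume "p = 0"
    have "poly q u = 0" if "u \<noteq> 0" for u
    proof -
      have "u * (x i + inverse u * v i) = v i + u * x i" for i
        using that by (simp add: distrib_left flip: mult.assoc)
      then have "poly q u = peval P (\<lambda>i. u * (x i + inverse u * v i))" by (simp add: q)
      also have "\<dots> = u ^ k * poly p (inverse u)" by (simp only: peval_form_scale[OF P] p)
      finally show ?thesis using \<open>p = 0\<close> by simp
    qed
    then have "- {0} \<subseteq> {u. poly q u = 0}" by auto
    moreover have "infinite (- {0 :: complex})" by (simp add: Compl_eq_Diff_UNIV infinite_UNIV_char_0)
    ultimately have "q = 0" using poly_roots_finite[of q] finite_subset by blast
    then show False using q[of 0] v by simp
  qed
  then show ?thesis using p poly_roots_finite[of p] card_poly_roots_bound[of p] by simp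
qed

text \<open>A set met by each line of some fixed direction in at most \<open>k\<close> points has many almost
  disjoint translates in a bounded region.\<close>
lemma negligible_few_points_on_lines:
  fixes S :: "'a::euclidean_space set"
  assumes "closed S" and few: "\<And>x. finite {t::real. x + t *\<^sub>R v \<in> S} \<and> card {t. x + t *\<^sub>R v \<in> S} \<le> k"
  shows "negligible S"
proof (subst negligible_on_intervals, intro allI)
  fix a b :: 'a
  define T where "T = S \<inter> cbox a b"
  have "compact T" unfolding T_def using assms(1) by (intro closed_Int_compact compact_cbox)
  then obtain r where r: "\<And>x. x \<in> T \<Longrightarrow> norm x \<le> r" using compact_imp_bounded bounded_iff by metis
  define B where "B = cball (0::'a) (r + norm v)"
  define \<mu> where "\<mu> = measure (lebesgue :: 'a measure)"
  have T: "T \<in> lmeasurable" using \<open>compact T\<close> by (rule lmeasurable_compact)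
  have "real M * \<mu> T \<le> real k * \<mu> B" for M
  proof (cases "M = 0")
    case False
    \<comment> \<open>M translates by distinct fractions of \<open>v\<close>; all of them stay in
      the ball \<open>B\<close>.\<close>
    define c where "c j = real j / real M" for j
    define U where "U j = (+) (c j *\<^sub>R v) ` T" for j
    have U: "U j \<in> lmeasurable" for j unfolding U_def by (rule measurable_translation[OF T])
    have int_U: "integrable lebesgue (indicator (U j) :: 'a \<Rightarrow> real)" for j
      using U[of j] by (auto simp: fmeasurable_def)
    have int_B: "integrable lebesgue (indicator B :: 'a \<Rightarrow> real)"
      using lmeasurable_cball[of 0 "r + norm v"] by (auto simp: B_def fmeasurable_def)
    \<comment> \<open>If x lies in \<open>U j\<close>, then -c_j is a parameter where the line
      through x meets \<open>S\<close>, so at most k translates cover x.\<close>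
    have pointwise: "(\<Sum>j<M. indicator (U j) x) \<le> real k * indicator B x" for x
    proof (cases "x \<in> B")
      case True
      have "(\<Sum>j<M. indicator (U j) x) = real (card {j\<in>{..<M}. x \<in> U j})"
        by (simp add: indicator_def sum.If_cases Int_def)
      also have "card {j\<in>{..<M}. x \<in> U j} = card ((\<lambda>j. - c j) ` {j\<in>{..<M}. x \<in> U j})"
        using False by (intro card_image[symmetric]) (auto simp: inj_on_def c_def)
      also have "\<dots> \<le> card {t. x + t *\<^sub>R v \<in> S}"
        using few[of x] by (intro card_mono) (auto simp: U_def T_def)
      also have "\<dots> \<le> k" using few by blast
      finally show ?thesis using True by simp
    next
      case False
      have "x \<notin> U j" if "j < M" for j
      proof
        assume "x \<in> U j"
        then obtain y where y: "y \<in> T" "x = c j *\<^sub>R v + y" by (auto simp: U_def)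
        have "norm (c j *\<^sub>R v) \<le> 1 * norm v"
          unfolding norm_scaleR using that by (intro mult_right_mono) (auto simp: c_def)
        then have "norm x \<le> r + norm v" using norm_triangle_ineq[of "c j *\<^sub>R v" y] r[OF y(1)] y by simp
        then show False using False by (simp add: B_def)
      qed
      then show ?thesis using False by simp
    qed
    have "real M * \<mu> T = (\<Sum>j<M. \<mu> (U j))" by (simp add: \<mu>_def U_def measure_translation)
    also have "\<dots> = (\<Sum>j<M. integral\<^sup>L lebesgue (indicator (U j)))"
      by (simp add: \<mu>_def)
    also have "\<dots> = integral\<^sup>L lebesgue (\<lambda>x. \<Sum>j<M. indicator (U j) x)"
      using int_U by (intro Bochner_Integration.integral_sum[symmetric]) auto
    also have "\<dots> \<le> integral\<^sup>L lebesgue (\<lambda>x. real k * indicator B x)"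
      using pointwise int_U int_B
      by (intro integral_mono Bochner_Integration.integrable_sum integrable_mult_right)
    also have "\<dots> = real k * \<mu> B" by (simp add: \<mu>_def)
    finally show ?thesis .
  qed (simp add: \<mu>_def)
  then have bound: "real M * \<mu> T \<le> real k * \<mu> B" for M .
  have "\<mu> T \<le> 0"
  proof (rule ccontr)
    assume "\<not> \<mu> T \<le> 0"
    then obtain M :: nat where "real k * \<mu> B < real M * \<mu> T"
      using reals_Archimedean3[of "\<mu> T"] by auto
    with bound[of M] show False by simp
  qed
  then have "\<mu> T = 0" by (simp add: \<mu>_def measure_le_0_iff)
  then show "negligible (S \<inter> cbox a b)" using T by (simp add: negligible_iff_measure0 \<mu>_def T_def)
qed

text \<open>Points vanishing on \<open>I\<close> are parametrised by the whole space, which leaves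
  the coordinates in \<open>I\<close> free to carry other parameters.\<close>

definition restrict_zero :: "5 set \<Rightarrow> complex ^ 5 \<Rightarrow> 5 \<Rightarrow> complex" where
  "restrict_zero I w i = (if i \<in> I then 0 else w $ i)"

lemma differentiable_prod:
  fixes f :: "'i \<Rightarrow> 'a::real_normed_vector \<Rightarrow> 'b::{real_normed_field}"
  assumes "finite A" "\<And>i. i \<in> A \<Longrightarrow> f i differentiable (at x within S)"
  shows "(\<lambda>x. \<Prod>i\<in>A. f i x) differentiable (at x within S)"
  using assms by (induction A) auto

lemma differentiable_restrict_zero: "(\<lambda>w. restrict_zero I w i) differentiable (at w within S)"
  by (cases "i \<in> I")
    (auto simp: restrict_zero_def intro!: bounded_linear_imp_differentiable bounded_linear_vec_nth)

lemma differentiable_peval_restrict_zero: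
  "(\<lambda>w. peval P (restrict_zero I w)) differentiable (at w within S)"
  unfolding peval_UNIV
  by (intro differentiable_sum differentiable_mult differentiable_const differentiable_prod
      differentiable_power differentiable_restrict_zero ballI finite_keys finite)

text \<open>On a real line with direction \<open>v\<close> the zeros are among the complex roots of
  a nonzero polynomial of degree at most k.\<close>

lemma negligible_form_zeros:
  assumes P: "P \<in> forms k" and v: "peval P (restrict_zero I v) \<noteq> 0"
  shows "negligible {w. peval P (restrict_zero I w) = 0}"
proof (rule negligible_few_points_on_lines[of _ v k])
  have "continuous_on UNIV (\<lambda>w. peval P (restrict_zero I w))"
    using differentiable_peval_restrict_zero[of P I]
    by (auto simp: continuous_on_eq_continuous_within intro: differentiable_imp_continuous_within)
  then show "closed {w. peval P (restrict_zero I w) = 0}"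
    by (intro closed_Collect_eq) auto
  fix x
  let ?R = "{t. peval P (\<lambda>i. restrict_zero I x i + t * restrict_zero I v i) = 0}"
  have "restrict_zero I (x + t *\<^sub>R v) = (\<lambda>i. restrict_zero I x i + of_real t * restrict_zero I v i)" for t
    by (rule ext) (simp add: restrict_zero_def, simp add: scaleR_conv_of_real)
  then have eq: "of_real ` {t. x + t *\<^sub>R v \<in> {w. peval P (restrict_zero I w) = 0}} \<subseteq> ?R"
    by auto
  have R: "finite ?R" "card ?R \<le> k" using peval_line_roots[OF P v] by blast+
  have inj: "inj_on (of_real :: real \<Rightarrow> complex) X" for X by (simp add: inj_on_def)
  have "finite {t. x + t *\<^sub>R v \<in> {w. peval P (restrict_zero I w) = 0}}"
    using finite_subset[OF eq R(1)] inj by (rule finite_imageD)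
  moreover have "card {t. x + t *\<^sub>R v \<in> {w. peval P (restrict_zero I w) = 0}} \<le> k"
    using card_mono[OF R(1) eq] R(2) by (simp add: card_image[OF inj])
  ultimately show "finite {t. x + t *\<^sub>R v \<in> {w. peval P (restrict_zero I w) = 0}} \<and>
    card {t. x + t *\<^sub>R v \<in> {w. peval P (restrict_zero I w) = 0}} \<le> k" ..
qed

lemma pd_single: "pd i (single m c) = single (m - single i 1) (of_nat (lookup m i) * c)"
  by (cases "c = 0") (simp_all add: pd_def)

lemma pd_sum: "pd i (sum f A) = (\<Sum>j\<in>A. pd i (f j))"
  by (induction A rule: infinite_finite_induct) (auto simp: pd_add)

text \<open>Links formal and analytic derivatives, so that a cubic vanishing on a coordinate
  subspace is seen to have zero derivatives along it.\<close>

lemma has_field_derivative_peval: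
  "((\<lambda>t. peval P (a(i := t))) has_field_derivative peval (pd i P) a) (at (a i))"
proof (induction P rule: poly_mapping_additive_induct)
  case (add P Q)
  then show ?case by (auto simp: pd_add intro: DERIV_add)
next
  case (single m c)
  have split: "mono_eval m b = b i ^ lookup m i * (\<Prod>j\<in>UNIV - {i}. b j ^ lookup m j)" for m :: "5 \<Rightarrow>\<^sub>0 nat" and b
    by (simp add: mono_eval_superset[of UNIV] prod.remove[of UNIV i])
  define K where "K = (\<Prod>j\<in>UNIV - {i}. a j ^ lookup m j)"
  have 1: "(\<lambda>t. peval (single m c) (a(i := t))) = (\<lambda>t. c * (t ^ lookup m i * K))"
  proof
    fix t
    have "(\<Prod>j\<in>UNIV - {i}. (a(i := t)) j ^ lookup m j) = K" unfolding K_def by (intro prod.cong) auto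
    then show "peval (single m c) (a(i := t)) = c * (t ^ lookup m i * K)" by (simp add: split)
  qed
  have "(\<Prod>j\<in>UNIV - {i}. a j ^ lookup (m - single i 1) j) = K"
    unfolding K_def by (intro prod.cong) (auto simp: lookup_minus lookup_single when_def)
  then have 2: "peval (pd i (single m c)) a = of_nat (lookup m i) * c * (a i ^ (lookup m i - 1) * K)"
    by (simp add: pd_single split lookup_minus)
  show ?case unfolding 1 2 by (auto intro!: derivative_eq_intros)
qed

definition diag_quadric :: "(5 \<Rightarrow> complex) \<Rightarrow> poly5" where
  "diag_quadric c = (\<Sum>i\<in>UNIV. cst (c i) * sq_vars i)"

lemma diag_quadric_forms: "diag_quadric c \<in> forms 2"
  unfolding diag_quadric_def by (intro forms_sum forms_cst_mult sq_vars_forms)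

lemma peval_pd_diag_quadric: "peval (pd i (diag_quadric c)) a = 2 * c i * a i"
proof -
  have "peval (pd i (sq_vars j)) a = (if j = i then 2 * a i else 0)" for j
  proof (cases "j = i")
    case True
    have "single i 2 - single i 1 = (single i 1 :: 5 \<Rightarrow>\<^sub>0 nat)"
      by (simp add: single_diff[symmetric])
    then show ?thesis using True by (simp add: sq_vars_alt pd_single)
  qed (simp add: sq_vars_alt pd_single lookup_single_not_eq)
  then have "peval (pd i (diag_quadric c)) a = (\<Sum>j\<in>UNIV. if j = i then c j * (2 * a i) else 0)"
    unfolding diag_quadric_def pd_sum pd_cst_mult peval_sum peval_mult peval_cst
    by (intro sum.cong) auto
  then show ?thesis by simp
qed

text \<open>Singular points of \<open>F = Q\<^sub>c = 0\<close> satisfy \<open>c\<^sub>i a\<^sub>i = \<partial>\<^sub>i F(a)\<close> after rescaling \<open>a\<close>. The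
  points with zero set \<open>I\<close> then give parameters \<open>c\<close> in the image of a hypersurface: the
  coordinates of \<open>w\<close> are \<open>c\<^sub>i\<close> for \<open>i \<in> I\<close> and \<open>a\<^sub>i\<close> otherwise.\<close>
lemma exists_smooth_quadric_section:
  assumes F: "F \<in> forms 3" "smooth_form F"
  obtains Q where "Q \<in> forms 2" "smooth_surface F Q"
proof -
  \<comment> \<open>For a singular point b with zero set \<open>I\<close>, the equations c_i b_i =
    \<partial>_i F(b) force the derivatives in \<open>I\<close> to vanish and determine c_i =
    \<partial>_i F(b)/b_i outside \<open>I\<close>; \<open>g I\<close> recovers c from this
    data.\<close>
  define S where "S I = {w. peval F (restrict_zero I w) = 0 \<and>
      (\<forall>i\<in>I. peval (pd i F) (restrict_zero I w) = 0) \<and> (\<forall>i. i \<notin> I \<longrightarrow> w $ i \<noteq> 0)}" for I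
  define g :: "5 set \<Rightarrow> complex ^ 5 \<Rightarrow> complex ^ 5" where
    "g I w = (\<chi> i. if i \<in> I then w $ i else peval (pd i F) (restrict_zero I w) / w $ i)" for I w
  have pdF: "pd i F \<in> forms 2" for i using F by (intro pd_forms) (simp add: numeral_3_eq_3)
  have S: "negligible (S I)" if "I \<noteq> UNIV" for I
  proof (cases "\<exists>v. peval F (restrict_zero I v) \<noteq> 0")
    case True
    then obtain v where "peval F (restrict_zero I v) \<noteq> 0" by blast
    from negligible_form_zeros[OF F(1) this] show ?thesis
      by (rule negligible_subset) (auto simp: S_def)
  next
    case False
    \<comment> \<open>Here F vanishes on the whole coordinate subspace, and so do its derivatives
      along it. Smoothness leaves a transversal derivative that is not identically zero there, and
      its zeros form the hypersurface containing \<open>S I\<close>.\<close>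
    then have F0: "peval F (restrict_zero I w) = 0" for w by blast
    from that obtain k where k: "k \<notin> I" by blast
    define a where "a = restrict_zero I (\<chi> i. 1)"
    have "a k \<noteq> 0" using k by (simp add: a_def restrict_zero_def)
    then have "a \<noteq> (\<lambda>_. 0)" by auto
    then obtain j where j: "peval (pd j F) a \<noteq> 0" using F by (auto simp: smooth_form_def)
    have "j \<in> I"
    proof (rule ccontr)
      assume "j \<notin> I"
      then have "a(j := t) = restrict_zero I (\<chi> i. if i = j then t else 1)" for t
        by (auto simp: a_def restrict_zero_def)
      then have "(\<lambda>t. peval F (a(j := t))) = (\<lambda>_. 0)" by (simp add: F0)
      with has_field_derivative_peval[of F a j] have "((\<lambda>_. 0) has_field_derivative peval (pd j F) a) (at (a j))"
        by simp
      then have "peval (pd j F) a = 0" using DERIV_unique DERIV_const by blast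
      with j show False by simp
    qed
    have "negligible {w. peval (pd j F) (restrict_zero I w) = 0}"
      using negligible_form_zeros[OF pdF] j unfolding a_def by blast
    then show ?thesis by (rule negligible_subset) (use \<open>j \<in> I\<close> in \<open>auto simp: S_def\<close>)
  qed
  have "g I differentiable_on S I" for I
    unfolding differentiable_on_def
  proof
    fix w assume w: "w \<in> S I"
    have comp: "(\<lambda>w. g I w $ i) differentiable (at w within S I)" for i
    proof (cases "i \<in> I")
      case True
      then show ?thesis
        by (simp add: g_def bounded_linear_imp_differentiable bounded_linear_vec_nth)
    next
      case False
      then have "(\<lambda>w. peval (pd i F) (restrict_zero I w) / w $ i) differentiable (at w within S I)"
        using w by (intro differentiable_divide differentiable_peval_restrict_zero
            bounded_linear_imp_differentiable bounded_linear_vec_nth) (simp add: S_def)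
      then show ?thesis using False by (simp add: g_def)
    qed
    show "g I differentiable (at w within S I)"
    proof (subst differentiable_componentwise_within, intro ballI)
      fix b :: "complex ^ 5" assume "b \<in> Basis"
      then obtain i u where "b = axis i u" by (auto simp: Basis_vec_def)
      then show "(\<lambda>w. g I w \<bullet> b) differentiable (at w within S I)"
        using differentiable_inner[OF comp[of i] differentiable_const[of u]] by (simp add: inner_axis)
    qed
  qed
  then have neg: "negligible (g I ` S I)" if "I \<noteq> UNIV" for I
    using S[OF that] by (intro negligible_differentiable_image_negligible) auto
  \<comment> \<open>Nonzero c_i make the diagonal quadric nondegenerate, which rules out \<sigma> =
    0 below.\<close>
  define Z where "Z i = {w :: complex ^ 5. w $ i = 0}" for i
  have Z: "negligible (Z i)" for i
    using negligible_form_zeros[OF forms_var, of i "{}" "\<chi> i. 1"] by (simp add: Z_def restrict_zero_def)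
  have "negligible ((\<Union>I\<in>- {UNIV}. g I ` S I) \<union> (\<Union>i. Z i))"
    using neg Z by (intro negligible_Un negligible_Union) auto
  moreover define B where "B = (\<Union>I\<in>- {UNIV}. g I ` S I) \<union> (\<Union>i. Z i)"
  ultimately have "B \<noteq> UNIV" using non_negligible_UNIV by metis
  then obtain c where "c \<notin> B" by blast
  then have c: "c \<notin> (\<Union>I\<in>- {UNIV}. g I ` S I) \<union> (\<Union>i. Z i)" by (simp add: B_def)
  show thesis
  proof (rule that[OF diag_quadric_forms])
    show "smooth_surface F (diag_quadric (\<lambda>i. c $ i))"
      unfolding smooth_surface_def
    proof (intro allI impI; elim conjE)
      fix a s t
      assume a: "a \<noteq> (\<lambda>_. 0)" "peval F a = 0"
        and st: "\<forall>i. s * peval (pd i F) a + t * peval (pd i (diag_quadric (\<lambda>i. c $ i))) a = 0"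
      have rel: "s * peval (pd i F) a + t * (2 * c $ i * a i) = 0" for i
        using st by (simp add: peval_pd_diag_quadric)
      obtain j where j: "peval (pd j F) a \<noteq> 0" using F a by (auto simp: smooth_form_def)
      have "t = 0"
      proof (rule ccontr)
        assume t: "t \<noteq> 0"
        define \<sigma> where "\<sigma> = - s / (2 * t)"
        have \<sigma>: "c $ i * a i = \<sigma> * peval (pd i F) a" for i
          using rel[of i] t by (simp add: \<sigma>_def field_simps) (metis add_eq_0_iff mult.commute minus_mult_right)
        have "\<sigma> \<noteq> 0"
        proof
          assume "\<sigma> = 0"
          then have "a i = 0" for i using \<sigma>[of i] c by (auto simp: Z_def)
          with a show False by auto
        qed
        \<comment> \<open>In c_i a_i = \<sigma> \<partial>_i F(a) the left side is linear in a and
          the right side quadratic, so scaling a by \<sigma> absorbs the factor.\<close>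
        define b where "b i = \<sigma> * a i" for i
        have b: "c $ i * b i = peval (pd i F) b" "peval F b = 0" for i
          using \<sigma>[of i] a peval_form_scale[OF pdF, of i \<sigma> a] peval_form_scale[OF F(1), of \<sigma> a]
          by (simp_all add: b_def[abs_def] power2_eq_square mult_ac)
        define I where "I = {i. b i = 0}"
        have "I \<noteq> UNIV" using a \<open>\<sigma> \<noteq> 0\<close> by (auto simp: I_def b_def)
        define w :: "complex ^ 5" where "w = (\<chi> i. if i \<in> I then c $ i else b i)"
        have rw: "restrict_zero I w = b" by (auto simp: restrict_zero_def w_def I_def)
        have "w \<in> S I" using b by (auto simp: S_def rw) (auto simp: I_def w_def simp flip: b(1))
        moreover have "g I w = c"
          by (auto simp: g_def vec_eq_iff rw simp flip: b(1)) (auto simp: w_def I_def)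
        ultimately show False using c \<open>I \<noteq> UNIV\<close> by blast
      qed
      with rel[of j] j show "s = 0 \<and> t = 0" by simp
    qed
  qed
qed

section \<open>Smoothness along a line\<close>

text \<open>The 2x2 minors of the Jacobian matrix turn dependence of the gradients into equations.
  The index type adds two elements to the pairs (i, j), for \<open>F\<close> and \<open>Q\<close>,
  and is finite as elimination requires.\<close>

definition section_equations :: "poly5 \<Rightarrow> poly5 \<Rightarrow> (5 \<times> 5) option option \<Rightarrow> poly5" where
  "section_equations F Q e = (case e of None \<Rightarrow> F | Some None \<Rightarrow> Q
     | Some (Some (i, j)) \<Rightarrow> pd i F * pd j Q - pd j F * pd i Q)"

lemma smooth_surface_iff: "smooth_surface F Q \<longleftrightarrow> base_point_free (range (section_equations F Q))"
proof
  assume S: "smooth_surface F Q"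
  show "base_point_free (range (section_equations F Q))"
    unfolding base_point_free_def
  proof (intro allI impI, rule ccontr)
    fix a assume "\<forall>f\<in>range (section_equations F Q). peval f a = 0" and a: "a \<noteq> (\<lambda>_. 0)"
    then have eqs: "peval (section_equations F Q e) a = 0" for e by blast
    have FQ: "peval F a = 0" "peval Q a = 0"
      using eqs[of None] eqs[of "Some None"] by (simp_all add: section_equations_def)
    have minors: "peval (pd i F) a * peval (pd j Q) a = peval (pd j F) a * peval (pd i Q) a" for i j
      using eqs[of "Some (Some (i, j))"] by (simp add: section_equations_def)
    have indep: "s = 0 \<and> t = 0" if "\<forall>i. s * peval (pd i F) a + t * peval (pd i Q) a = 0" for s t
      using S a FQ that unfolding smooth_surface_def by blast
    \<comment> \<open>By the vanishing minors, \<partial>_k Q and -\<partial>_k F are the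
      coefficients of a relation between the gradients, for every k.\<close>
    have "peval (pd k F) a = 0" for k
      using indep[of "peval (pd k Q) a" "- peval (pd k F) a"] minors[of k] by (simp add: mult.commute)
    then show False using indep[of 1 0] by simp
  qed
next
  assume B: "base_point_free (range (section_equations F Q))"
  show "smooth_surface F Q"
    unfolding smooth_surface_def
  proof (intro allI impI; elim conjE)
    fix a s t
    assume a: "a \<noteq> (\<lambda>_. 0)" "peval F a = 0" "peval Q a = 0"
      and "\<forall>i. s * peval (pd i F) a + t * peval (pd i Q) a = 0"
    then have st: "s * peval (pd i F) a = - (t * peval (pd i Q) a)" for i by (simp add: add_eq_0_iff2)
    from B a obtain e where e: "peval (section_equations F Q e) a \<noteq> 0"
      unfolding base_point_free_def by blast
    with a obtain i j where "e = Some (Some (i, j))"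
      by (auto simp: section_equations_def split: option.splits)
    with e have minor: "peval (pd i F) a * peval (pd j Q) a - peval (pd j F) a * peval (pd i Q) a \<noteq> 0"
      by (simp add: section_equations_def)
    have "s * (peval (pd i F) a * peval (pd j Q) a - peval (pd j F) a * peval (pd i Q) a) =
        (s * peval (pd i F) a) * peval (pd j Q) a - (s * peval (pd j F) a) * peval (pd i Q) a"
      by (simp add: algebra_simps)
    also have "\<dots> = 0" by (simp add: st)
    finally have "s = 0" using minor by simp
    with st[of i] st[of j] have "t * peval (pd i Q) a = 0" "t * peval (pd j Q) a = 0" by simp_all
    with minor \<open>s = 0\<close> show "s = 0 \<and> t = 0" by auto
  qed
qed

lemma forms_numeral_Suc: "P \<in> forms 3 \<Longrightarrow> pd i P \<in> forms 2" "P \<in> forms 2 \<Longrightarrow> pd i P \<in> forms 1"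
  by (auto intro: pd_forms simp: numeral_3_eq_3 numeral_2_eq_2)

lemma smooth_surface_line:
  assumes F: "F \<in> forms 3" and Q: "Q \<in> forms 2" "R \<in> forms 2" and smooth: "smooth_surface F Q"
  shows "\<exists>D\<in>polynomial_functions. D 0 \<noteq> 0 \<and> (\<forall>t. D t \<noteq> 0 \<longrightarrow> smooth_surface F (Q + cst t * R))"
proof -
  note alg = function_algebraD[OF function_algebra_polynomial]
  define d :: "(5 \<times> 5) option option \<Rightarrow> nat" where "d e = (if e = Some None then 2 else 3)" for e
  have 1: "section_equations F (Q + cst t * R) e \<in> forms (d e)" for t e
  proof -
    have Qt: "Q + cst t * R \<in> forms 2" using Q by (intro forms_add forms_cst_mult)
    have "pd i F * pd j (Q + cst t * R) \<in> forms (2 + 1)" for i j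
      using F Qt by (intro forms_mult forms_numeral_Suc)
    then show ?thesis using F Qt
      by (auto simp: section_equations_def d_def split: option.splits intro!: forms_diff)
  qed
  have Qt: "(\<lambda>t. lookup (Q + cst t * R) m) \<in> polynomial_functions" for m
    by (auto simp: lookup_add intro!: alg polynomial_functions_id)
  then have pdQt: "(\<lambda>t. lookup (pd i (Q + cst t * R)) m) \<in> polynomial_functions" for i m
    unfolding lookup_pd by (intro alg)
  have "(\<lambda>t. lookup (pd i F * pd j (Q + cst t * R)) m) \<in> polynomial_functions" for i j m
    by (rule coefficients_mult_const[OF function_algebra_polynomial pdQt])
  note prod = this
  have 2: "(\<lambda>t. lookup (section_equations F (Q + cst t * R) e) m) \<in> polynomial_functions" for e m
  proof -
    consider "e = None" | "e = Some None" | i j where "e = Some (Some (i, j))"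
      by (metis option.exhaust surj_pair)
    then show ?thesis
      by cases (simp_all add: section_equations_def lookup_minus Qt prod alg)
  qed
  have "base_point_free (range (section_equations F (Q + cst 0 * R)))"
    using smooth by (simp add: smooth_surface_iff)
  from elimination[OF function_algebra_polynomial finite[of UNIV] 1 2 this]
  show ?thesis by (simp add: smooth_surface_iff)
qed

lemma smooth_form_line:
  assumes G: "G \<in> forms 3" "C \<in> forms 3" and smooth: "smooth_form G"
  shows "\<exists>D\<in>polynomial_functions. D 0 \<noteq> 0 \<and> (\<forall>t. D t \<noteq> 0 \<longrightarrow> smooth_form (G + cst t * C))"
proof -
  note alg = function_algebraD[OF function_algebra_polynomial]
  have 1: "pd i (G + cst t * C) \<in> forms 2" for t i
    using G by (intro forms_numeral_Suc forms_add forms_cst_mult)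
  have 2: "(\<lambda>t. lookup (pd i (G + cst t * C)) m) \<in> polynomial_functions" for i m
    by (auto simp: lookup_pd lookup_add intro!: alg polynomial_functions_id)
  have "base_point_free (range (\<lambda>i. pd i (G + cst 0 * C)))"
    using smooth by (simp add: smooth_form_iff)
  from elimination[OF function_algebra_polynomial finite[of UNIV] 1 2 this]
  show ?thesis by (simp add: smooth_form_iff)
qed

lemma smooth_form_cst_mult: "smooth_form G \<Longrightarrow> c \<noteq> 0 \<Longrightarrow> smooth_form (cst c * G)"
  unfolding smooth_form_iff base_point_free_def by (auto simp: pd_cst_mult)

section \<open>The associated cubic\<close>

text \<open>The functional b \<mapsto> \<rho>(bQ) on cubics has kernel (J_{F,5} : Q), and
  \<open>C\<close> represents it, so \<open>C\<close> spans the orthogonal complement.\<close>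

lemma associated_cubicI:
  assumes "linear_functional \<rho>" and \<rho>: "\<And>P. P \<in> forms 5 \<Longrightarrow> \<rho> P = 0 \<longleftrightarrow> P \<in> ideal_span (range (\<lambda>i. pd i F))"
    and Q: "Q \<in> forms 2" and C: "C \<in> forms 3" "\<And>b. b \<in> forms 3 \<Longrightarrow> polar_pairing b C = \<rho> (b * Q)"
  shows "associated_cubic F Q C"
proof -
  have "b * Q \<in> forms 5" if "b \<in> forms 3" for b using forms_mult[OF that Q] by simp
  then have "colon F Q = {b \<in> forms 3. polar_pairing b C = 0}"
    using C \<rho> by (auto simp: colon_def jacobian_part_eq)
  then show ?thesis using C perp_kernel[OF C(1)] by (simp add: associated_cubic_def)
qed

lemma cubic_from_quadric:
  assumes "linear_functional \<rho>" "Q \<in> forms 2"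
  obtains C where "C \<in> forms 3" "\<And>b. b \<in> forms 3 \<Longrightarrow> polar_pairing b C = \<rho> (b * Q)"
proof -
  note lin = linear_functionalD[OF assms(1)]
  have "linear_functional (\<lambda>b. \<rho> (b * Q))"
    unfolding linear_functional_def by (simp add: lin distrib_right mult.assoc)
  then show thesis using that by (rule functional_represented)
qed

text \<open>By nondegeneracy the functionals b \<mapsto> \<rho>(b m), for monomials m of degree 2,
  have common kernel inside J_{F,3}. The pairing with \<open>G\<close> vanishes there, so it is a
  combination of them, whose coefficients are those of the quadric.\<close>

lemma quadric_from_perp:
  assumes "linear_functional \<rho>"
    and nondeg: "\<And>b. b \<in> forms 3 \<Longrightarrow> (\<And>Q. Q \<in> forms 2 \<Longrightarrow> \<rho> (b * Q) = 0) \<Longrightarrow> b \<in> ideal_span (range (\<lambda>i. pd i F))"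
    and G: "G \<in> perp (jacobian_part F 3)"
  obtains Q where "Q \<in> forms 2" "\<And>b. b \<in> forms 3 \<Longrightarrow> polar_pairing b G = \<rho> (b * Q)"
proof -
  note lin = linear_functionalD[OF assms(1)]
  have GF: "G \<in> forms 3" using G by (simp add: perp_def)
  let ?M = "{m :: 5 \<Rightarrow>\<^sub>0 nat. mdeg m = 2}"
  have "\<exists>c. \<forall>b\<in>forms 3. polar_pairing b G = (\<Sum>m\<in>?M. c m * \<rho> (b * single m 1))"
  proof (rule functional_in_span[OF finite_mdeg_eq cvs_subspace_forms linear_functional_polar_pairing[OF GF]])
    show "linear_functional (\<lambda>b. \<rho> (b * single m 1))" for m
      unfolding linear_functional_def by (simp add: lin distrib_right mult.assoc)
    fix b assume b: "b \<in> forms 3" "\<And>m. m \<in> ?M \<Longrightarrow> \<rho> (b * single m 1) = 0"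
    have "\<rho> (b * Q) = 0" if "Q \<in> forms 2" for Q
    proof -
      have "b * Q = (\<Sum>m\<in>?M. cst (lookup Q m) * (b * single m 1))"
        by (subst form_expand[OF that]) (simp add: sum_distrib_left mult.left_commute)
      then show ?thesis using b by (simp add: lin)
    qed
    then have "b \<in> jacobian_part F 3" using nondeg b by (simp add: jacobian_part_eq)
    then show "polar_pairing b G = 0" using G by (simp add: perp_def)
  qed
  then obtain c where c: "\<And>b. b \<in> forms 3 \<Longrightarrow> polar_pairing b G = (\<Sum>m\<in>?M. c m * \<rho> (b * single m 1))"
    by blast
  define Q where "Q = (\<Sum>m\<in>?M. cst (c m) * single m 1)"
  have "Q \<in> forms 2" unfolding Q_def by (intro forms_sum forms_cst_mult forms_single) simp
  moreover have "\<rho> (b * Q) = (\<Sum>m\<in>?M. c m * \<rho> (b * single m 1))" for b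
    by (simp add: Q_def sum_distrib_left mult.left_commute[of b] lin)
  ultimately show thesis using c by (intro that[of Q]) auto
qed

lemma polar_pairing_add_right:
  "G \<in> forms 3 \<Longrightarrow> H \<in> forms 3 \<Longrightarrow> polar_pairing b (G + H) = polar_pairing b G + polar_pairing b H"
  by (simp add: polar_pairing_eq forms_add lookup_add distrib_left sum.distrib)

lemma polar_pairing_cst_right:
  "G \<in> forms 3 \<Longrightarrow> polar_pairing b (cst c * G) = c * polar_pairing b G"
  by (simp add: polar_pairing_eq forms_cst_mult sum_distrib_left) (simp add: mult_ac)

lemma exists_smooth_surface_and_cubic:
  assumes F: "F \<in> forms 3" "smooth_form F" and G: "G \<in> perp (jacobian_part F 3)" "smooth_form G"
  shows "\<exists>Q\<in>forms 2. smooth_surface F Q \<and> (\<exists>C. associated_cubic F Q C \<and> smooth_form C)"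
proof -
  have GF: "G \<in> forms 3" using G by (simp add: perp_def)
  obtain \<rho> where lin: "linear_functional \<rho>"
    and \<rho>: "\<And>P. P \<in> forms 5 \<Longrightarrow> \<rho> P = 0 \<longleftrightarrow> P \<in> ideal_span (range (\<lambda>i. pd i F))"
    and nondeg: "\<And>b. b \<in> forms 3 \<Longrightarrow> (\<And>Q. Q \<in> forms 2 \<Longrightarrow> \<rho> (b * Q) = 0) \<Longrightarrow> b \<in> ideal_span (range (\<lambda>i. pd i F))"
    using macaulay_duality[of "\<lambda>i. pd i F", OF forms_numeral_Suc(1)[OF F(1)]] F(2)
    unfolding smooth_form_iff by blast
  obtain Q0 where Q0: "Q0 \<in> forms 2" "\<And>b. b \<in> forms 3 \<Longrightarrow> polar_pairing b G = \<rho> (b * Q0)"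
    using quadric_from_perp[OF lin nondeg G(1)] by blast
  obtain Q1 where Q1: "Q1 \<in> forms 2" "smooth_surface F Q1"
    using exists_smooth_quadric_section[OF F] by blast
  obtain C1 where C1: "C1 \<in> forms 3" "\<And>b. b \<in> forms 3 \<Longrightarrow> polar_pairing b C1 = \<rho> (b * Q1)"
    using cubic_from_quadric[OF lin Q1(1)] by blast
  obtain D where D: "D \<in> polynomial_functions" "D 0 \<noteq> 0" "\<And>t. D t \<noteq> 0 \<Longrightarrow> smooth_surface F (Q1 + cst t * Q0)"
    using smooth_surface_line[OF F(1) Q1(1) Q0(1) Q1(2)] by blast
  obtain E where E: "E \<in> polynomial_functions" "E 0 \<noteq> 0" "\<And>t. E t \<noteq> 0 \<Longrightarrow> smooth_form (G + cst t * C1)"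
    using smooth_form_line[OF GF C1(1) G(2)] by blast
  \<comment> \<open>C1 + tG is t times G + C1/t, so the cubic is tested at 1/t while the surface is
    tested at t.\<close>
  obtain t where t: "t \<noteq> 0" "D t \<noteq> 0" "E (inverse t) \<noteq> 0"
    using generic_point_on_line[OF D(1,2) E(1,2)] by blast
  define Q where "Q = Q1 + cst t * Q0"
  define C where "C = C1 + cst t * G"
  have Q: "Q \<in> forms 2" and C: "C \<in> forms 3"
    using Q0 Q1 C1 GF by (auto simp: Q_def C_def intro: forms_add forms_cst_mult)
  have "cst t * (G + cst (inverse t) * C1) = cst t * G + cst (t * inverse t) * C1"
    by (simp only: distrib_left cst_mult mult.assoc)
  also have "\<dots> = C" using t(1) by (simp add: C_def)
  finally have "smooth_form C" using smooth_form_cst_mult[OF E(3)[OF t(3)] t(1)] by simp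
  moreover have "associated_cubic F Q C"
  proof (rule associated_cubicI[OF lin \<rho> Q C])
    fix b assume b: "b \<in> forms 3"
    have "b * Q = b * Q1 + cst t * (b * Q0)" by (simp add: Q_def distrib_left mult.left_commute)
    then have "\<rho> (b * Q) = \<rho> (b * Q1) + t * \<rho> (b * Q0)" by (simp add: linear_functionalD[OF lin])
    also have "\<dots> = polar_pairing b C"
      using b C1 Q0 GF by (simp add: C_def polar_pairing_add_right polar_pairing_cst_right forms_cst_mult)
    finally show "polar_pairing b C = \<rho> (b * Q)" ..
  qed
  ultimately show ?thesis using Q D(3)[OF t(2)] by (auto simp: Q_def)
qed

section \<open>Openness\<close>

definition coefficient_functions :: "(poly5 \<Rightarrow> complex) set" where
  "coefficient_functions = range (\<lambda>P F. peval P (lookup F))"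

lemma function_algebra_coefficient: "function_algebra coefficient_functions"
  unfolding function_algebra_def coefficient_functions_def
proof (intro conjI allI ballI)
  show "(\<lambda>_. c) \<in> range (\<lambda>P F. peval P (lookup F))" for c
    by (rule range_eqI[of _ _ "cst c"]) simp
  fix f g :: "poly5 \<Rightarrow> complex"
  assume "f \<in> range (\<lambda>P F. peval P (lookup F))" "g \<in> range (\<lambda>P F. peval P (lookup F))"
  then obtain P Q where "f = (\<lambda>F. peval P (lookup F))" "g = (\<lambda>F. peval Q (lookup F))" by blast
  then have "(\<lambda>F. f F + g F) = (\<lambda>F. peval (P + Q) (lookup F))"
    "(\<lambda>F. f F * g F) = (\<lambda>F. peval (P * Q) (lookup F))" by auto
  then show "(\<lambda>F. f F + g F) \<in> range (\<lambda>P F. peval P (lookup F))"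
    "(\<lambda>F. f F * g F) \<in> range (\<lambda>P F. peval P (lookup F))" by blast+
qed

lemma coefficient_functions_lookup: "(\<lambda>F. lookup F m) \<in> coefficient_functions"
  unfolding coefficient_functions_def by (rule range_eqI[of _ _ "var m"]) simp

text \<open>The complement is cut out by all polynomials vanishing on it: on forms of degree k,
  \<open>D\<close> is nonzero only inside \<open>U\<close>, so it is one of them, and it excludes
  \<open>F0\<close>.\<close>

lemma zariski_open_formsI:
  assumes "U \<subseteq> forms k"
    and "\<And>F0. F0 \<in> U \<Longrightarrow> \<exists>D\<in>coefficient_functions. D F0 \<noteq> 0 \<and> (\<forall>F\<in>forms k. D F \<noteq> 0 \<longrightarrow> F \<in> U)"
  shows "zariski_open_forms k U"
proof -
  define Ps where "Ps = {P :: (5 \<Rightarrow>\<^sub>0 nat) cpoly. \<forall>F\<in>forms k - U. peval P (lookup F) = 0}"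
  have "forms k - U = {F \<in> forms k. \<forall>P\<in>Ps. peval P (lookup F) = 0}"
  proof
    show "{F \<in> forms k. \<forall>P\<in>Ps. peval P (lookup F) = 0} \<subseteq> forms k - U"
    proof clarify
      fix F assume F: "F \<in> forms k" "\<forall>P\<in>Ps. peval P (lookup F) = 0" "F \<in> U"
      then obtain D where D: "D \<in> coefficient_functions" "D F \<noteq> 0" "\<forall>F\<in>forms k. D F \<noteq> 0 \<longrightarrow> F \<in> U"
        using assms(2) by blast
      then obtain P where P: "D = (\<lambda>F. peval P (lookup F))" by (auto simp: coefficient_functions_def)
      have "P \<in> Ps" using D(3) by (auto simp: Ps_def P)
      then show False using F D(2) by (auto simp: P)
    qed
  qed (auto simp: Ps_def)
  with assms(1) show ?thesis unfolding zariski_open_forms_def zariski_closed_forms_def by blast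
qed

text \<open>The 25 products span J_{F,3}, which is the tangent space at F to its orbit under linear
  changes of coordinates.\<close>

definition tangent :: "poly5 \<Rightarrow> 5 \<times> 5 \<Rightarrow> poly5" where
  "tangent F s = var (fst s) * pd (snd s) F"

lemma linear_form_expand:
  assumes "r \<in> forms 1"
  shows "r = (\<Sum>j\<in>UNIV. cst (lookup r (single j 1)) * var j)"
proof (rule poly_mapping_eqI)
  fix m
  have eq: "lookup (\<Sum>j\<in>UNIV. cst (lookup r (single j 1)) * var j) m =
      (\<Sum>j\<in>UNIV. lookup r (single j 1) * (if single j 1 = m then 1 else 0))"
    by (simp add: lookup_sum var_def lookup_single when_def)
  show "lookup r m = lookup (\<Sum>j\<in>UNIV. cst (lookup r (single j 1)) * var j) m"
  proof (cases "mdeg m = 1")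
    case True
    then have "m \<noteq> 0" by auto
    then obtain i where "lookup m i \<noteq> 0" by (metis lookup_zero poly_mapping_eqI)
    then have m: "(m - single i 1) + single i 1 = m"
      by (intro poly_mapping_eqI) (auto simp: lookup_add lookup_minus lookup_single when_def)
    then have "mdeg (m - single i 1) + mdeg (single i 1) = 1" using True by (metis mdeg_add)
    then have "m - single i 1 = 0" by simp
    with m have m: "m = single i 1" by simp
    have "(single j 1 = m) = (j = i)" for j
      unfolding m by (metis lookup_single_eq lookup_single_not_eq zero_neq_one)
    then have "lookup (\<Sum>j\<in>UNIV. cst (lookup r (single j 1)) * var j) m =
        (\<Sum>j\<in>UNIV. if j = i then lookup r (single j 1) else 0)"
      unfolding eq by (intro sum.cong) simp_all
    then show ?thesis by (simp add: m)
  next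
    case False
    then have "single j 1 \<noteq> m" for j by auto
    moreover have "lookup r m = 0" using False assms unfolding forms_iff by blast
    ultimately show ?thesis unfolding eq by simp
  qed
qed

lemma jacobian_part_3_iff:
  assumes F: "F \<in> forms 3"
  shows "b \<in> jacobian_part F 3 \<longleftrightarrow> (\<exists>x. b = (\<Sum>s\<in>UNIV. cst (x s) * tangent F s))"
proof
  assume b: "b \<in> jacobian_part F 3"
  then have b': "b \<in> forms 3" "b \<in> ideal_span (range (\<lambda>i. pd i F))" by (auto simp: jacobian_part_eq)
  obtain r where r: "\<And>i. r i \<in> forms (3 - 2)" "b = (\<Sum>i\<in>UNIV. r i * pd i F)"
    using form_in_homogeneous_ideal[of UNIV "\<lambda>i. pd i F" "\<lambda>_. 2" b 3,
        OF finite forms_numeral_Suc(1)[OF F] b'] by blast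
  have "r i = (\<Sum>j\<in>UNIV. cst (lookup (r i) (single j 1)) * var j)" for i
    using r(1)[of i] by (intro linear_form_expand) simp
  then have "r i * pd i F = (\<Sum>j\<in>UNIV. cst (lookup (r i) (single j 1)) * var j) * pd i F" for i
    by (rule arg_cong)
  then have "r i * pd i F = (\<Sum>j\<in>UNIV. cst (lookup (r i) (single j 1)) * tangent F (j, i))" for i
    by (simp only: sum_distrib_right tangent_def fst_conv snd_conv mult.assoc)
  then have "b = (\<Sum>i\<in>UNIV. \<Sum>j\<in>UNIV. cst (lookup (r i) (single j 1)) * tangent F (j, i))"
    by (simp only: r(2))
  also have "\<dots> = (\<Sum>j\<in>UNIV. \<Sum>i\<in>UNIV. cst (lookup (r i) (single j 1)) * tangent F (j, i))"
    by (rule sum.swap)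
  also have "\<dots> = (\<Sum>s\<in>UNIV \<times> UNIV. cst (lookup (r (snd s)) (single (fst s) 1)) * tangent F s)"
    by (simp add: sum.cartesian_product case_prod_unfold)
  finally show "\<exists>x. b = (\<Sum>s\<in>UNIV. cst (x s) * tangent F s)"
    unfolding UNIV_Times_UNIV
    by (intro exI[of _ "\<lambda>s. lookup (r (snd s)) (single (fst s) 1)"])
next
  assume "\<exists>x. b = (\<Sum>s\<in>UNIV. cst (x s) * tangent F s)"
  then obtain x where b: "b = (\<Sum>s\<in>UNIV. cst (x s) * tangent F s)" by blast
  have "tangent F s \<in> forms (1 + 2)" for s
    unfolding tangent_def by (intro forms_mult forms_var forms_numeral_Suc F)
  then have "tangent F s \<in> forms 3" for s by (simp add: numeral_3_eq_3)
  moreover have "tangent F s \<in> ideal_span (range (\<lambda>i. pd i F))" for s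
    unfolding tangent_def by (intro ideal_span_mult rmod.span_base) simp
  ultimately show "b \<in> jacobian_part F 3"
    by (auto simp: jacobian_part_eq b intro!: rmod.span_sum ideal_span_mult forms_sum forms_cst_mult)
qed

lemma tangent_in_jacobian_part: "F \<in> forms 3 \<Longrightarrow> tangent F s \<in> jacobian_part F 3"
  unfolding jacobian_part_3_iff by (rule exI[of _ "\<lambda>r. if r = s then 1 else 0"])
    (simp add: if_distrib[of cst] if_distrib[of "\<lambda>x. x * _"] cong: if_cong)

lemma perp_jacobian_part_iff:
  assumes F: "F \<in> forms 3"
  shows "G \<in> perp (jacobian_part F 3) \<longleftrightarrow> G \<in> forms 3 \<and> (\<forall>s. polar_pairing (tangent F s) G = 0)"
proof safe
  assume "G \<in> perp (jacobian_part F 3)"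
  then show "G \<in> forms 3" "polar_pairing (tangent F s) G = 0" for s
    using tangent_in_jacobian_part[OF F] by (auto simp: perp_def)
next
  assume G: "G \<in> forms 3" "\<forall>s. polar_pairing (tangent F s) G = 0"
  have "polar_pairing b G = 0" if b: "b \<in> jacobian_part F 3" for b
  proof -
    obtain x where "b = (\<Sum>s\<in>UNIV. cst (x s) * tangent F s)"
      using b unfolding jacobian_part_3_iff[OF F] by blast
    moreover have "polar_pairing (tangent F s) G = 0" for s using G(2) by blast
    ultimately show ?thesis
      by (simp add: linear_functionalD[OF linear_functional_polar_pairing[OF G(1)]])
  qed
  with G show "G \<in> perp (jacobian_part F 3)" by (simp add: perp_def)
qed

text \<open>A dependency is a syzygy of the derivatives with linear forms l_i as coefficients.
  Regularity puts each l_k into the ideal of the other four quadrics, so l_k = 0 by degree.\<close>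

lemma tangent_independent:
  assumes F: "F \<in> forms 3" "smooth_form F" and rel: "(\<Sum>s\<in>UNIV. cst (x s) * tangent F s) = 0"
  shows "x s = 0"
proof -
  let ?f = "\<lambda>i. pd i F"
  note f = forms_numeral_Suc(1)[OF F(1)]
  have reg: "regular ?f" using base_point_free_quadrics[of ?f, OF f] F by (simp add: smooth_form_iff)
  define l where "l i = (\<Sum>j\<in>UNIV. cst (x (j, i)) * var j)" for i
  have l: "l i \<in> forms 1" for i unfolding l_def by (intro forms_sum forms_cst_mult forms_var)
  have "(\<Sum>s\<in>UNIV \<times> UNIV. cst (x s) * tangent F s) = (\<Sum>j\<in>UNIV. \<Sum>i\<in>UNIV. cst (x (j, i)) * tangent F (j, i))"
    by (simp only: sum.cartesian_product case_prod_unfold prod.collapse)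
  also have "\<dots> = (\<Sum>i\<in>UNIV. \<Sum>j\<in>UNIV. cst (x (j, i)) * tangent F (j, i))" by (rule sum.swap)
  also have "\<dots> = (\<Sum>i\<in>UNIV. l i * ?f i)"
    by (simp add: l_def tangent_def sum_distrib_right mult.assoc)
  finally have sum0: "(\<Sum>i\<in>UNIV. l i * ?f i) = 0" using rel by simp
  obtain j k where s: "s = (j, k)" by (cases s)
  have "(\<Sum>i\<in>UNIV. l i * ?f i) = ?f k * l k + (\<Sum>i\<in>- {k}. l i * ?f i)"
    by (simp add: sum.remove[of UNIV k] Compl_eq_Diff_UNIV mult.commute)
  with sum0 have "?f k * l k = - (\<Sum>i\<in>- {k}. l i * ?f i)" by (simp add: eq_neg_iff_add_eq_0)
  moreover have "(\<Sum>i\<in>- {k}. l i * ?f i) \<in> ideal_span (?f ` (- {k}))"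
    by (intro rmod.span_sum ideal_span_mult rmod.span_base imageI)
  ultimately have "?f k * l k \<in> ideal_span (?f ` (- {k}))" by (simp add: rmod.span_neg)
  then have "l k \<in> ideal_span (?f ` (- {k}))" using regularD[OF reg _ l, where T = "- {k}"] by simp
  then have "l k = 0"
    by (rule form_in_homogeneous_ideal[of "- {k}" ?f "\<lambda>_. 2" "l k" 1, rotated 3]) (use f l in auto)
  then have "lookup (l k) (single j 1) = 0" by simp
  moreover have "lookup (l k) (single j 1) = (\<Sum>i\<in>UNIV. if i = j then x (i, k) else 0)"
    unfolding l_def lookup_sum
  proof (rule sum.cong)
    fix i
    have "(single i 1 = (single j 1 :: 5 \<Rightarrow>\<^sub>0 nat)) = (i = j)"
      by (metis lookup_single_eq lookup_single_not_eq zero_neq_one)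
    then show "lookup (cst (x (i, k)) * var i) (single j 1) = (if i = j then x (i, k) else 0)"
      by (simp add: var_def lookup_single when_def)
  qed simp
  ultimately show ?thesis by (simp add: s)
qed

text \<open>Conjugating coefficients turns the polar pairing on cubics into a positive definite
  Hermitian form, which makes Gram matrices of independent cubics invertible.\<close>

definition conj_form :: "poly5 \<Rightarrow> poly5" where
  "conj_form P = (\<Sum>m\<in>keys P. single m (cnj (lookup P m)))"

lemma lookup_conj_form: "lookup (conj_form P) m = cnj (lookup P m)"
  by (auto simp: conj_form_def lookup_sum lookup_single when_def in_keys_iff)

lemma conj_form_forms: "P \<in> forms k \<Longrightarrow> conj_form P \<in> forms k"
  by (simp add: forms_iff lookup_conj_form)

lemma polar_pairing_sum_right:
  "(\<And>i. i \<in> A \<Longrightarrow> g i \<in> forms 3) \<Longrightarrow> polar_pairing b (sum g A) = (\<Sum>i\<in>A. polar_pairing b (g i))"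
proof (induction A rule: infinite_finite_induct)
  case (insert x A)
  then show ?case by (simp add: polar_pairing_add_right forms_sum)
qed (simp_all add: polar_pairing_eq)

lemma polar_pairing_conj_form_eq_0:
  assumes W: "W \<in> forms 3" and 0: "polar_pairing W (conj_form W) = 0"
  shows "W = 0"
proof -
  define q where "q n = (\<Prod>i\<in>UNIV. fact (lookup n i)) * (norm (lookup W n))\<^sup>2" for n
  have q0: "q n \<ge> 0" for n by (auto simp: q_def intro!: mult_nonneg_nonneg prod_nonneg)
  have "mfact n * lookup W n * lookup (conj_form W) n = of_real (q n)" for n
    by (simp add: q_def mfact_def lookup_conj_form mult.assoc flip: complex_norm_square)
  then have "of_real (\<Sum>n | mdeg n = 3. q n) = (0 :: complex)"
    using 0 by (simp add: polar_pairing_eq conj_form_forms W)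
  then have "(\<Sum>n | mdeg n = 3. q n) = 0" by (simp only: of_real_eq_0_iff)
  then have q: "q n = 0" if "mdeg n = 3" for n
    using that q0 by (simp add: sum_nonneg_eq_0_iff finite_mdeg_eq)
  have "lookup W n = 0" for n
  proof (cases "mdeg n = 3")
    case True
    then show ?thesis using q[of n] by (simp add: q_def)
  qed (use W in \<open>auto simp: forms_iff\<close>)
  then show ?thesis by (intro poly_mapping_eqI) simp
qed

lemma smooth_form_condition_open:
  assumes G: "\<And>F. G F \<in> forms 3" "\<And>m. (\<lambda>F. lookup (G F) m) \<in> coefficient_functions" and "smooth_form (G F0)"
  shows "\<exists>D\<in>coefficient_functions. D F0 \<noteq> 0 \<and> (\<forall>F. D F \<noteq> 0 \<longrightarrow> smooth_form (G F))"
proof -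
  have 1: "pd i (G F) \<in> forms 2" for i F using G by (intro forms_numeral_Suc)
  have 2: "(\<lambda>F. lookup (pd i (G F)) m) \<in> coefficient_functions" for i m
    unfolding lookup_pd by (intro function_algebraD[OF function_algebra_coefficient] G)
  have "base_point_free (range (\<lambda>i. pd i (G F0)))" using assms(3) by (simp add: smooth_form_iff)
  from elimination[OF function_algebra_coefficient finite[of UNIV] 1 2 this]
  show ?thesis by (simp add: smooth_form_iff)
qed

text \<open>The 25 products \<open>x\<^sub>j \<partial>\<^sub>i F\<close> stay linearly independent near \<open>F\<^sub>0\<close>, so by Cramer's rule the
  correction that makes \<open>G\<^sub>0\<close> orthogonal to all of them depends rationally on \<open>F\<close>.\<close>
lemma perp_family:
  assumes F0: "F0 \<in> forms 3" "smooth_form F0" and G0: "G0 \<in> perp (jacobian_part F0 3)"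
  obtains G c where "c \<noteq> 0" "G F0 = cst c * G0" "\<And>F. G F \<in> forms 3"
    "\<And>m. (\<lambda>F. lookup (G F) m) \<in> coefficient_functions"
    "\<And>F. F \<in> forms 3 \<Longrightarrow> G F \<in> perp (jacobian_part F 3)"
proof -
  note alg = function_algebraD[OF function_algebra_coefficient]
  have G0F: "G0 \<in> forms 3" using G0 by (simp add: perp_def)
  have tan: "tangent F s \<in> forms 3" if "F \<in> forms 3" for F s
    using tangent_in_jacobian_part[OF that] by (simp add: jacobian_part_eq)
  define \<xi> where "\<xi> r = conj_form (tangent F0 r)" for r
  have \<xi>: "\<xi> r \<in> forms 3" for r unfolding \<xi>_def by (intro conj_form_forms tan F0)
  \<comment> \<open>At \<open>F0\<close> this is the Hermitian Gram matrix of the 25 products. The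
    second arguments stay fixed, since conjugating the varying \<open>F\<close> would not be
    polynomial in its coefficients.\<close>
  define E where "E F r s = polar_pairing (tangent F s) (\<xi> r)" for F r s
  have pairing_coeff: "(\<lambda>F. polar_pairing (tangent F s) H) \<in> coefficient_functions" if "H \<in> forms 3" for s H
  proof -
    have "(\<lambda>F. lookup (pd i F) m) \<in> coefficient_functions" for i m
      unfolding lookup_pd by (intro alg coefficient_functions_lookup)
    then have "(\<lambda>F. lookup (tangent F s) m) \<in> coefficient_functions" for m
      unfolding tangent_def by (rule coefficients_mult_const[OF function_algebra_coefficient])
    then show ?thesis unfolding polar_pairing_eq[OF that] by (intro alg)
  qed
  have E: "(\<lambda>F. E F r s) \<in> coefficient_functions" for r s unfolding E_def by (intro pairing_coeff \<xi>)
  have "\<exists>D B. D \<in> coefficient_functions \<and> D F0 \<noteq> 0 \<and>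
    (\<forall>i\<in>UNIV. \<forall>j\<in>UNIV. (\<lambda>F. B F j i) \<in> coefficient_functions) \<and>
    (\<forall>F v. \<forall>j\<in>UNIV. D F * v j = (\<Sum>i\<in>UNIV. B F j i * (\<Sum>k\<in>UNIV. E F i k * v k)))"
  proof (rule left_inverse_family[OF function_algebra_coefficient finite finite E])
    fix v assume v: "\<And>r. r \<in> UNIV \<Longrightarrow> (\<Sum>s\<in>UNIV. E F0 r s * v s) = 0"
    define W where "W = (\<Sum>s\<in>UNIV. cst (v s) * tangent F0 s)"
    have W: "W \<in> forms 3" unfolding W_def by (intro forms_sum forms_cst_mult tan F0)
    have orth: "polar_pairing W (\<xi> r) = 0" for r
      using v[of r] by (simp add: W_def E_def linear_functionalD[OF linear_functional_polar_pairing[OF \<xi>]]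
          mult.commute[of _ "v _"])
    have "conj_form W = (\<Sum>r\<in>UNIV. cst (cnj (v r)) * \<xi> r)"
      by (rule poly_mapping_eqI) (simp add: lookup_conj_form W_def lookup_sum \<xi>_def)
    then have "polar_pairing W (conj_form W) = (\<Sum>r\<in>UNIV. cnj (v r) * polar_pairing W (\<xi> r))"
      using \<xi> by (simp add: polar_pairing_sum_right polar_pairing_cst_right forms_cst_mult)
    then have "W = 0" using orth W by (intro polar_pairing_conj_form_eq_0) auto
    then show "\<forall>j\<in>UNIV. v j = 0" using tangent_independent[OF F0] by (simp add: W_def)
  qed
  then obtain D B where D: "D \<in> coefficient_functions" "D F0 \<noteq> 0"
    and B: "\<And>i j. (\<lambda>F. B F j i) \<in> coefficient_functions"
    and DB: "\<And>F v j. D F * v j = (\<Sum>i\<in>UNIV. B F j i * (\<Sum>k\<in>UNIV. E F i k * v k))" by blast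
  have inv: "(\<Sum>i\<in>UNIV. B F j i * E F i s) = (if j = s then D F else 0)" for F j s
    using DB[of F "\<lambda>k. if k = s then 1 else 0" j]
    by (simp add: if_distrib[of "\<lambda>x. _ * x"] cong: if_cong)
  define w where "w F s = polar_pairing (tangent F s) G0" for F s
  define x where "x F r = (\<Sum>j\<in>UNIV. w F j * B F j r)" for F r
  \<comment> \<open>The subtracted combination has the same pairings with the products for
    \<open>F\<close> as \<open>D F\<close> times \<open>G0\<close>; at \<open>F0\<close> these
    vanish and no correction remains.\<close>
  define G where "G F = cst (D F) * G0 - (\<Sum>r\<in>UNIV. cst (x F r) * \<xi> r)" for F
  have wc: "(\<lambda>F. w F s) \<in> coefficient_functions" for s unfolding w_def by (intro pairing_coeff G0F)
  have "w F0 s = 0" for s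
    using iffD1[OF perp_jacobian_part_iff[OF F0(1)] G0] unfolding w_def by blast
  then have "G F0 = cst (D F0) * G0" by (simp add: G_def x_def)
  moreover have GF: "G F \<in> forms 3" for F
    unfolding G_def by (intro forms_diff forms_sum forms_cst_mult G0F \<xi>)
  moreover have "(\<lambda>F. lookup (G F) m) \<in> coefficient_functions" for m
    unfolding G_def x_def lookup_minus lookup_sum lookup_cst_mult by (intro alg D(1) wc B)
  moreover have "G F \<in> perp (jacobian_part F 3)" if F: "F \<in> forms 3" for F
    unfolding perp_jacobian_part_iff[OF F]
  proof (intro conjI allI GF)
    fix s
    have "G F + (\<Sum>r\<in>UNIV. cst (x F r) * \<xi> r) = cst (D F) * G0" by (simp add: G_def)
    then have "polar_pairing (tangent F s) (G F) + polar_pairing (tangent F s) (\<Sum>r\<in>UNIV. cst (x F r) * \<xi> r) =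
        polar_pairing (tangent F s) (cst (D F) * G0)"
      using GF \<xi> by (simp add: polar_pairing_add_right[symmetric] forms_sum forms_cst_mult)
    then have "polar_pairing (tangent F s) (G F) + (\<Sum>r\<in>UNIV. x F r * E F r s) = D F * w F s"
      using \<xi> G0F by (simp add: polar_pairing_sum_right polar_pairing_cst_right forms_cst_mult E_def w_def)
    moreover have "(\<Sum>r\<in>UNIV. x F r * E F r s) = (\<Sum>j\<in>UNIV. w F j * (\<Sum>r\<in>UNIV. B F j r * E F r s))"
      unfolding x_def sum_distrib_left sum_distrib_right by (subst sum.swap) (simp add: mult.assoc)
    moreover have "\<dots> = D F * w F s"
      by (simp add: inv if_distrib[of "\<lambda>x. _ * x"] mult.commute cong: if_cong)
    ultimately show "polar_pairing (tangent F s) (G F) = 0" by simp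
  qed
  ultimately show thesis using D(2) that by blast
qed

lemma hcomp_coefficient: "(\<lambda>F. lookup (hcomp 3 F) m) \<in> coefficient_functions"
  by (cases "mdeg m = 3")
    (auto simp: lookup_hcomp coefficient_functions_lookup function_algebraD(1)[OF function_algebra_coefficient])

theorem cubic_locus_open: "zariski_open_forms 3 cubic_locus"
proof (rule zariski_open_formsI)
  show "cubic_locus \<subseteq> forms 3" by (auto simp: cubic_locus_def)
  fix F0 assume "F0 \<in> cubic_locus"
  then obtain G0 where F0: "F0 \<in> forms 3" "smooth_form F0"
    and G0: "G0 \<in> perp (jacobian_part F0 3)" "smooth_form G0" by (auto simp: cubic_locus_def)
  obtain G c where G: "c \<noteq> 0" "G F0 = cst c * G0" "\<And>F. G F \<in> forms 3"
    "\<And>m. (\<lambda>F. lookup (G F) m) \<in> coefficient_functions"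
    "\<And>F. F \<in> forms 3 \<Longrightarrow> G F \<in> perp (jacobian_part F 3)"
    by (rule perp_family[OF F0 G0(1)]) (rule that)
  have "smooth_form (G F0)" using G(1,2) smooth_form_cst_mult[OF G0(2)] by simp
  then obtain D where D: "D \<in> coefficient_functions" "D F0 \<noteq> 0" "\<And>F. D F \<noteq> 0 \<Longrightarrow> smooth_form (G F)"
    using smooth_form_condition_open[of G, OF G(3,4)] by blast
  \<comment> \<open>\<open>hcomp 3\<close> supplies a family of cubics over all parameters, as
    elimination demands, and is the identity on cubics.\<close>
  have "smooth_form (hcomp 3 F0)" using F0 by (simp add: hcomp_form)
  then obtain E where E: "E \<in> coefficient_functions" "E F0 \<noteq> 0" "\<And>F. E F \<noteq> 0 \<Longrightarrow> smooth_form (hcomp 3 F)"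
    using smooth_form_condition_open[of "hcomp 3", OF hcomp_in_forms hcomp_coefficient] by blast
  show "\<exists>D\<in>coefficient_functions. D F0 \<noteq> 0 \<and> (\<forall>F\<in>forms 3. D F \<noteq> 0 \<longrightarrow> F \<in> cubic_locus)"
  proof (intro bexI[of _ "\<lambda>F. D F * E F"] conjI ballI impI)
    show "(\<lambda>F. D F * E F) \<in> coefficient_functions"
      by (intro function_algebraD[OF function_algebra_coefficient] D E)
    fix F assume F: "F \<in> forms 3" "D F * E F \<noteq> 0"
    then have "smooth_form F" using E(3)[of F] by (simp add: hcomp_form)
    with F D(3)[of F] G(5) show "F \<in> cubic_locus" by (auto simp: cubic_locus_def)
  qed (use D E in simp)
qed

section \<open>A cubic in the locus\<close>

definition expo :: "nat \<Rightarrow> nat \<Rightarrow> nat \<Rightarrow> nat \<Rightarrow> nat \<Rightarrow> 5 \<Rightarrow>\<^sub>0 nat" where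
  "expo a b c d e = single 0 a + single 1 b + single 2 c + single 3 d + single 4 e"

lemma all_5: "(\<forall>i::5. R i) \<longleftrightarrow> R 0 \<and> R 1 \<and> R 2 \<and> R 3 \<and> R 4"
  using UNIV_5 by (metis UNIV_I empty_iff insert_iff)

lemma lookup_expo [simp]:
  "lookup (expo a b c d e) 0 = a" "lookup (expo a b c d e) 1 = b" "lookup (expo a b c d e) 2 = c"
  "lookup (expo a b c d e) 3 = d" "lookup (expo a b c d e) 4 = e"
  by (simp_all add: expo_def lookup_add lookup_single when_def)

lemma poly_mapping_eq_iff_5: "m = n \<longleftrightarrow> (\<forall>i::5. lookup m i = lookup n i)"
  by (auto intro: poly_mapping_eqI)

lemma expo_eq_iff [simp]:
  "expo a b c d e = expo a' b' c' d' e' \<longleftrightarrow> a = a' \<and> b = b' \<and> c = c' \<and> d = d' \<and> e = e'"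
  by (auto simp: poly_mapping_eq_iff_5 all_5)

lemma mdeg_expo [simp]: "mdeg (expo a b c d e) = a + b + c + d + e"
  by (simp add: expo_def)

lemma expo_add: "expo a b c d e + expo a' b' c' d' e' = expo (a + a') (b + b') (c + c') (d + d') (e + e')"
  by (simp add: poly_mapping_eq_iff_5 all_5 lookup_add)

lemma single_eq_expo:
  "single 0 (Suc 0) = expo 1 0 0 0 0" "single 1 (Suc 0) = expo 0 1 0 0 0" "single 2 (Suc 0) = expo 0 0 1 0 0"
  "single 3 (Suc 0) = expo 0 0 0 1 0" "single 4 (Suc 0) = expo 0 0 0 0 1"
  by (simp_all add: expo_def)

lemma expo_diff: "expo a b c d e - expo a' b' c' d' e' = expo (a - a') (b - b') (c - c') (d - d') (e - e')"
  by (simp add: poly_mapping_eq_iff_5 all_5 lookup_minus)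

lemma mfact_expo: "mfact (expo a b c d e) = fact a * fact b * fact c * fact d * fact e"
  unfolding mfact_def UNIV_5 by (simp add: mult.assoc)

lemma mono_eval_expo: "mono_eval (expo a b c d e) x = x 0 ^ a * x 1 ^ b * x 2 ^ c * x 3 ^ d * x 4 ^ e"
  by (simp add: expo_def mono_eval_add)

text \<open>Two Hesse cubics glued along \<open>x\<^sub>0\<close>: as \<open>x\<^sub>0x\<^sub>1x\<^sub>2\<close> and \<open>x\<^sub>0x\<^sub>3x\<^sub>4\<close> share only one
  variable, two such cubics are orthogonal up to two conditions on their coefficients.\<close>
definition glued_hesse_cubic :: "complex \<Rightarrow> complex \<Rightarrow> complex \<Rightarrow> poly5" where
  "glued_hesse_cubic k l n = single (expo 3 0 0 0 0) k + single (expo 0 3 0 0 0) l + single (expo 0 0 3 0 0) l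
     + single (expo 0 0 0 3 0) l + single (expo 0 0 0 0 3) l
     + single (expo 1 1 1 0 0) n + single (expo 1 0 0 1 1) n"

lemma glued_hesse_cubic_forms: "glued_hesse_cubic k l n \<in> forms 3"
  unfolding glued_hesse_cubic_def by (intro forms_add forms_single) auto

lemma pd_glued_hesse_cubic:
  "pd 0 (glued_hesse_cubic k l n) = single (expo 2 0 0 0 0) (3 * k) + single (expo 0 1 1 0 0) n + single (expo 0 0 0 1 1) n"
  "pd 1 (glued_hesse_cubic k l n) = single (expo 0 2 0 0 0) (3 * l) + single (expo 1 0 1 0 0) n"
  "pd 2 (glued_hesse_cubic k l n) = single (expo 0 0 2 0 0) (3 * l) + single (expo 1 1 0 0 0) n"
  "pd 3 (glued_hesse_cubic k l n) = single (expo 0 0 0 2 0) (3 * l) + single (expo 1 0 0 0 1) n"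
  "pd 4 (glued_hesse_cubic k l n) = single (expo 0 0 0 0 2) (3 * l) + single (expo 1 0 0 1 0) n"
  by (simp_all add: glued_hesse_cubic_def pd_add pd_single single_eq_expo expo_diff)

text \<open>For each pair y, z the product of its two equations gives yz = 0 or 9 l^2 yz = n^2
  x_0^2. Inserted into the equation of \<partial>_0, this leaves x_0^2 times 27 k l^2 plus 0, 1 or 2
  times n^3, so x_0 = 0 and the other coordinates follow.\<close>

lemma smooth_glued_hesse_cubic:
  assumes "k \<noteq> 0" "l \<noteq> 0" "27 * k * l\<^sup>2 + n ^ 3 \<noteq> 0" "27 * k * l\<^sup>2 + 2 * n ^ 3 \<noteq> 0"
  shows "smooth_form (glued_hesse_cubic k l n)"
  unfolding smooth_form_iff base_point_free_def
proof (intro allI impI)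
  fix x assume "\<forall>f\<in>range (\<lambda>i. pd i (glued_hesse_cubic k l n)). peval f x = 0"
  then have eqs: "\<forall>i. peval (pd i (glued_hesse_cubic k l n)) x = 0" by blast
  then have e0: "3 * k * (x 0)\<^sup>2 + n * (x 1 * x 2) + n * (x 3 * x 4) = 0"
    and e: "3 * l * (x 1)\<^sup>2 + n * (x 0 * x 2) = 0" "3 * l * (x 2)\<^sup>2 + n * (x 0 * x 1) = 0"
      "3 * l * (x 3)\<^sup>2 + n * (x 0 * x 4) = 0" "3 * l * (x 4)\<^sup>2 + n * (x 0 * x 3) = 0"
    by (simp_all add: all_5 pd_glued_hesse_cubic mono_eval_expo)
  have pq: "y * z = 0 \<or> 9 * l\<^sup>2 * (y * z) = n\<^sup>2 * (x 0)\<^sup>2"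
    if "3 * l * y\<^sup>2 + n * (x 0 * z) = 0" "3 * l * z\<^sup>2 + n * (x 0 * y) = 0" for y z
  proof -
    have "3 * l * y\<^sup>2 = - (n * (x 0 * z))" "3 * l * z\<^sup>2 = - (n * (x 0 * y))"
      using that by (simp_all add: eq_neg_iff_add_eq_0)
    then have "(3 * l * y\<^sup>2) * (3 * l * z\<^sup>2) = (n * (x 0 * z)) * (n * (x 0 * y))" by simp
    then have "(y * z) * (9 * l\<^sup>2 * (y * z) - n\<^sup>2 * (x 0)\<^sup>2) = 0"
      by (simp add: power2_eq_square algebra_simps)
    then show ?thesis by simp
  qed
  define p q where "p = x 1 * x 2" and "q = x 3 * x 4"
  have e0': "3 * k * (x 0)\<^sup>2 + n * p + n * q = 0" using e0 by (simp add: p_def q_def)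
  have "(27 * k * l\<^sup>2) * (x 0)\<^sup>2 + n * (9 * l\<^sup>2 * p) + n * (9 * l\<^sup>2 * q) = 9 * l\<^sup>2 * (3 * k * (x 0)\<^sup>2 + n * p + n * q)"
    by (simp add: algebra_simps)
  then have 9: "(27 * k * l\<^sup>2) * (x 0)\<^sup>2 + n * (9 * l\<^sup>2 * p) + n * (9 * l\<^sup>2 * q) = 0"
    by (simp only: e0' mult_zero_right)
  have cases: "A * X = 0 \<or> (A + n ^ 3) * X = 0 \<or> (A + 2 * n ^ 3) * X = 0"
    if "A * X + n * y + n * z = 0" "y = 0 \<or> y = n\<^sup>2 * X" "z = 0 \<or> z = n\<^sup>2 * X" for A X y z
    using that(2,3,1) by (elim disjE) (simp_all add: power2_eq_square power3_eq_cube algebra_simps)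
  have "9 * l\<^sup>2 * p = 0 \<or> 9 * l\<^sup>2 * p = n\<^sup>2 * (x 0)\<^sup>2" "9 * l\<^sup>2 * q = 0 \<or> 9 * l\<^sup>2 * q = n\<^sup>2 * (x 0)\<^sup>2"
    using pq[OF e(1,2)] pq[OF e(3,4)] by (auto simp: p_def q_def)
  from cases[OF 9 this]
  have "x 0 = 0" using assms by auto
  then have "\<forall>i. x i = 0" using e assms by (auto simp: all_5)
  then show "x = (\<lambda>_. 0)" by blast
qed

lemma polar_pairing_single':
  "G \<in> forms 3 \<Longrightarrow> mdeg m = 3 \<Longrightarrow> polar_pairing (single m c) G = c * mfact m * lookup G m"
  by (subst single_eq_cst_mult)
    (simp add: linear_functionalD(2)[OF linear_functional_polar_pairing] polar_pairing_single mult.assoc)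

text \<open>Only the diagonal products x_i \<partial>_i F share monomials with the second cubic.
  Cubes pair with weight 6 and squarefree monomials with weight 1; as x_0 occurs in both triple
  products, i = 0 contributes n n' twice and every other i once.\<close>

lemma glued_hesse_cubic_perp:
  assumes "18 * k * k' + 2 * (n * n') = 0" "18 * l * l' + n * n' = 0"
  shows "glued_hesse_cubic k' l' n' \<in> perp (jacobian_part (glued_hesse_cubic k l n) 3)"
  unfolding perp_jacobian_part_iff[OF glued_hesse_cubic_forms]
proof (intro conjI glued_hesse_cubic_forms)
  note lin = linear_functionalD(1)[OF linear_functional_polar_pairing[OF glued_hesse_cubic_forms]]
  have "\<forall>i j. polar_pairing (tangent (glued_hesse_cubic k l n) (i, j)) (glued_hesse_cubic k' l' n') = 0"
    unfolding all_5 tangent_def fst_conv snd_conv pd_glued_hesse_cubic var_def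
    by (simp add: single_eq_expo distrib_left mult_single expo_add lin polar_pairing_single'
        glued_hesse_cubic_forms mfact_expo)
      (insert assms, simp add: glued_hesse_cubic_def lookup_add lookup_single fact_numeral algebra_simps)
  then show "\<forall>s. polar_pairing (tangent (glued_hesse_cubic k l n) s) (glued_hesse_cubic k' l' n') = 0"
    by (simp add: split_paired_All)
qed

lemma cubic_locus_nonempty: "cubic_locus \<noteq> {}"
proof -
  \<comment> \<open>With n n' = -18 both orthogonality equations hold for l' = 1 and k' = 2. The
    smoothness expressions are 54 and 81 for the first cubic, -162 and -378 for the second.\<close>
  have "glued_hesse_cubic 1 1 3 \<in> cubic_locus"
    unfolding cubic_locus_def
  proof (intro CollectI conjI glued_hesse_cubic_forms bexI)
    show "smooth_form (glued_hesse_cubic 1 1 3)" "smooth_form (glued_hesse_cubic 2 1 (- 6))"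
      by (intro smooth_glued_hesse_cubic; simp)+
    show "glued_hesse_cubic 2 1 (- 6) \<in> perp (jacobian_part (glued_hesse_cubic 1 1 3) 3)"
      by (rule glued_hesse_cubic_perp) simp_all
  qed
  then show ?thesis by blast
qed

theorem theorem1p3:
  "cubic_locus \<noteq> {} \<and> zariski_open_forms 3 cubic_locus \<and>
   (\<forall>F\<in>cubic_locus. \<exists>Q\<in>forms 2. smooth_surface F Q \<and>
      (\<exists>C. associated_cubic F Q C \<and> smooth_form C))"
proof (intro conjI ballI cubic_locus_nonempty cubic_locus_open)
  fix F assume "F \<in> cubic_locus"
  then show "\<exists>Q\<in>forms 2. smooth_surface F Q \<and> (\<exists>C. associated_cubic F Q C \<and> smooth_form C)"
    using exists_smooth_surface_and_cubic by (auto simp: cubic_locus_def)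
qed

end
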